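(* Let $\Omega\subset\mathbb{R}^2$ be a simply connected Lipschitz polygonal domain and let $\mathcal{T}_h$ be a member of a quasi-uniform and shape-regular family of partitions of $\Omega$ into convex quadrilaterals. With the finite element spaces $W_h$, $\boldsymbol{V}_h$, $P_h$ defined in the context, the sequence $$0\longrightarrow W_h\xrightarrow{\ \mathbf{curl}_h\ }\boldsymbol{V}_h\xrightarrow{\ \mathrm{div}_h\ }P_h\longrightarrow0$$ is exact, where $\mathbf{curl}_h$ and $\mathrm{div}_h$ are the cellwise operators $\mathbf{curl}_h|_K=\mathbf{curl}$ and $\mathrm{div}_h|_K=\mathrm{div}$ on each $K\in\mathcal{T}_h$.
   Context: $\mathbf{curl}\,w=(\partial w/\partial y,-\partial w/\partial x)^T$. $L_0^2(\Omega)$ is the space of $L^2$ functions with zero mean. $P_k$ denotes polynomials of degree at most $k$. $\mathcal{E}_h$ is the set of all edges, $\mathcal{V}_h^i$ and $\mathcal{V}_h^b$ the sets of interior and boundary vertices of $\mathcal{T}_h$. For $E\in\mathcal{E}_h$, $\boldsymbol{n}_E$ is a fixed unit normal; for an interior edge $E$ shared by $K_1,K_2$ with $\boldsymbol{n}_E$ pointing from $K_1$ to $K_2$, the jump is $[v]_E=v|_{K_1}-v|_{K_2}$; for a boundary edge $E$ of $K$, $[v]_E=v|_K$. Local spaces on a convex quadrilateral $K$: $K$ has vertices $V_1,\dots,V_4$ in counterclockwise order, indices modulo 4, $E_i=V_iV_{i+1}$ is the $i$-th edge with length $|E_i|$, midpoint $M_i$, unit normal $\boldsymbol{n}_i$ and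 unit tangent $\boldsymbol{t}_i$. Let $l_i$, $m_{13}$, $m_{24}$, $l_{13}$, $l_{24}$ be the affine functions vanishing respectively on the lines containing $E_i$, $M_1M_3$, $M_2M_4$, $V_1V_3$, $V_2V_4$, uniquely normalized by $l_1(M_3)=l_2(M_4)=l_3(M_1)=l_4(M_2)=m_{13}(M_2)=m_{24}(M_3)=l_{13}(V_4)=l_{24}(V_3)=1$. Let $\boldsymbol{A}=\frac14\left(V_3-V_4-V_1+V_2,\;V_3+V_4-V_1-V_2\right)$ (columns), $\boldsymbol{d}=\frac14(V_3-V_4+V_1-V_2)$, $(s_1,s_2)^T=\boldsymbol{A}^{-1}\boldsymbol{d}$, and $$\phi_1=(s_2-1)(s_2+1)l_1l_3m_{13}m_{24}-s_1s_2l_1l_3m_{24}^2+s_1l_1l_3m_{24}^2m_{13},$$ $$\phi_2=(s_1-1)(s_1+1)l_2l_4m_{13}m_{24}-s_1s_2l_2l_4m_{13}^2+s_2l_2l_4m_{13}^2m_{24}.$$ Put $W_K^-=P_3(K)\oplus\mathrm{span}\{\phi_1,\phi_2\}$, $W_K^b=\mathrm{span}\{b_0,b_0x,b_0y,b_0l_{13}l_{24}\}$ with $b_0=l_1l_2l_3l_4$, and $$W_K=\left\{w\in W_K^-\oplus W_K^b:\ \frac{1}{|E_{i}|}\int_{E_{i}}\frac{\partial w}{\partial \boldsymbol{n}_{i}}\,\mathrm{d}s=\frac{1}{2}\left(\frac{\partial w}{\partial \boldsymbol{n}_{i}}(V_i)+\frac{\partial w}{\partial \boldsymbol{n}_{i}}(V_{i+1})\right),\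 i=1,2,3,4\right\}.$$ Put $\boldsymbol{V}_K^b=\mathbf{curl}\,W_K^b$, $$\boldsymbol{V}_K^-=[P_1(K)]^2\oplus\mathrm{span}\{\mathbf{curl}\,x^3,\mathbf{curl}\,x^2y,\mathbf{curl}\,xy^2,\mathbf{curl}\,y^3,\mathbf{curl}\,\phi_1,\mathbf{curl}\,\phi_2\},$$ $$\boldsymbol{V}_K=\left\{\boldsymbol{v}\in \boldsymbol{V}_K^-\oplus \boldsymbol{V}_K^b:\ \frac{1}{|E_{i}|}\int_{E_{i}}\boldsymbol{v}\cdot\boldsymbol{t}_i\,\mathrm{d}s=\frac{1}{2}\left(\boldsymbol{v}(V_i)+\boldsymbol{v}(V_{i+1})\right)\cdot\boldsymbol{t}_i,\ i=1,2,3,4\right\}.$$ Global spaces: $W_h$ is the set of $w\in L^2(\Omega)$ with $w|_K\in W_K$ for all $K\in\mathcal{T}_h$ such that $w$ and $\nabla w$ are continuous at all $V\in\mathcal{V}_h^i$ and vanish at all $V\in\mathcal{V}_h^b$. $\boldsymbol{V}_h$ is the set of $\boldsymbol{v}\in[L^2(\Omega)]^2$ with $\boldsymbol{v}|_K\in\boldsymbol{V}_K$ for all $K\in\mathcal{T}_h$, $\int_E[\boldsymbol{v}\cdot\boldsymbol{n}_E]_E\,\mathrm{d}s=0$ for all $E\in\mathcal{E}_h$, and $\boldsymbol{v}$ continuous at all $V\in\mathcal{V}_h^i$ and vanishing at all $V\in\mathcal{V}_h^b$. $P_h=\{q\in L_0^2(\Omega):q|_K\in P_0(K)\ \forall K\in\mathcal{T}_h\}$.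 *)

theory Defs
  imports "HOL-Analysis.Analysis"
begin

section \<open>Differential operators in the plane\<close>

definition pderiv2 :: "2 \<Rightarrow> (real^2 \<Rightarrow> real) \<Rightarrow> real^2 \<Rightarrow> real" where
  "pderiv2 i w x = frechet_derivative w (at x) (axis i 1)"

definition grad :: "(real^2 \<Rightarrow> real) \<Rightarrow> real^2 \<Rightarrow> real^2" where
  "grad w x = vector [pderiv2 1 w x, pderiv2 2 w x]"

definition curl :: "(real^2 \<Rightarrow> real) \<Rightarrow> real^2 \<Rightarrow> real^2" where
  "curl w x = vector [pderiv2 2 w x, - pderiv2 1 w x]"

definition divergence :: "(real^2 \<Rightarrow> real^2) \<Rightarrow> real^2 \<Rightarrow> real" where
  "divergence v x = pderiv2 1 (\<lambda>y. v y $ 1) x + pderiv2 2 (\<lambda>y. v y $ 2) x"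

definition dir_deriv :: "(real^2 \<Rightarrow> real) \<Rightarrow> real^2 \<Rightarrow> real^2 \<Rightarrow> real" where
  "dir_deriv w n x = frechet_derivative w (at x) n"

text \<open>Arc-length integral over the segment from \<open>a\<close> to \<open>b\<close>.\<close>

definition seg_integral :: "real^2 \<Rightarrow> real^2 \<Rightarrow> (real^2 \<Rightarrow> real) \<Rightarrow> real" where
  "seg_integral a b f = dist a b * integral {0..1} (\<lambda>t. f (linepath a b t))"

section \<open>Spaces of polynomial functions\<close>

text \<open>A polynomial on a cell is identified with the polynomial function on the whole plane
  that extends it.\<close>

definition Pk :: "nat \<Rightarrow> (real^2 \<Rightarrow> real) set" where
  "Pk k = {p. \<exists>c. p = (\<lambda>x. \<Sum>i\<le>k. \<Sum>j\<le>k - i. c i j * (x$1) ^ i * (x$2) ^ j)}"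

definition fun_span :: "('a \<Rightarrow> 'b::real_vector) set \<Rightarrow> ('a \<Rightarrow> 'b) set" where
  "fun_span B = {f. \<exists>t r. finite t \<and> t \<subseteq> B \<and> f = (\<lambda>x. \<Sum>b\<in>t. r b *\<^sub>R b x)}"

definition fun_sum :: "('a \<Rightarrow> 'b::real_vector) set \<Rightarrow> ('a \<Rightarrow> 'b) set \<Rightarrow> ('a \<Rightarrow> 'b) set" where
  "fun_sum S T = {\<lambda>x. f x + g x | f g. f \<in> S \<and> g \<in> T}"

section \<open>Convex quadrilaterals\<close>

text \<open>A quadrilateral is given by its labelled vertices \<open>V 1, V 2, V 3, V 4\<close>. Arithmetic in the
  index type \<open>4\<close> is modulo 4 (so \<open>V 4 = V 0\<close>).\<close>

type_synonym quad = "4 \<Rightarrow> real^2"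

definition cross2 :: "real^2 \<Rightarrow> real^2 \<Rightarrow> real" where
  "cross2 a b = a$1 * b$2 - a$2 * b$1"

text \<open>Only left turns at the four vertices: for a closed polygon with four vertices this says that
  it is strictly convex and labelled counterclockwise.\<close>

definition convex_quad :: "quad \<Rightarrow> bool" where
  "convex_quad V \<longleftrightarrow> (\<forall>i. cross2 (V (i+1) - V i) (V (i+2) - V (i+1)) > 0)"

definition cell :: "quad \<Rightarrow> (real^2) set" where
  "cell V = convex hull (range V)"

definition edge :: "quad \<Rightarrow> 4 \<Rightarrow> (real^2) set" where
  "edge V i = closed_segment (V i) (V (i+1))"

definition edge_mid :: "quad \<Rightarrow> 4 \<Rightarrow> real^2" where
  "edge_mid V i = midpoint (V i) (V (i+1))"

definition edge_tangent :: "quad \<Rightarrow> 4 \<Rightarrow> real^2" where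
  "edge_tangent V i = (1 / dist (V i) (V (i+1))) *\<^sub>R (V (i+1) - V i)"

definition edge_normal :: "quad \<Rightarrow> 4 \<Rightarrow> real^2" where
  "edge_normal V i = vector [edge_tangent V i $ 2, - edge_tangent V i $ 1]"

text \<open>The affine function that vanishes on the line through \<open>p\<close> and \<open>q\<close> and equals 1 at \<open>r\<close>.\<close>

definition line_fun :: "real^2 \<Rightarrow> real^2 \<Rightarrow> real^2 \<Rightarrow> real^2 \<Rightarrow> real" where
  "line_fun p q r = (THE l. (\<exists>a c. l = (\<lambda>x. a \<bullet> x + c)) \<and>
      (\<forall>x \<in> affine hull {p, q}. l x = 0) \<and> l r = 1)"

lemma line_fun_eq:
  assumes nz: "cross2 (q - p) (r - p) \<noteq> 0"
  shows "line_fun p q r = (\<lambda>x. cross2 (q - p) (x - p) / cross2 (q - p) (r - p))"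
proof -
  define k where "k = cross2 (q - p) (r - p)"
  define m where "m = (\<lambda>x. cross2 (q - p) (x - p) / k)"
  have k: "k \<noteq> 0" using nz by (simp add: k_def)
  show ?thesis
    unfolding line_fun_def k_def[symmetric] m_def[symmetric]
  proof (rule the_equality)
    have "m = (\<lambda>x. (vector [- (q - p)$2 / k, (q - p)$1 / k] :: real^2) \<bullet> x
            + ((q - p)$2 * p$1 - (q - p)$1 * p$2) / k)"
      using k by (auto simp: m_def cross2_def inner_vec_def sum_2 field_simps)
    moreover have "m x = 0" if "x \<in> affine hull {p, q}" for x
    proof -
      from that obtain u v where uv: "x = u *\<^sub>R p + v *\<^sub>R q" "u + v = 1"
        unfolding affine_hull_2 by blast
      have "u = 1 - v" using uv(2) by simp
      then have "x - p = v *\<^sub>R (q - p)" using uv(1) by (simp add: scaleR_diff_left scaleR_diff_right)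
      then show ?thesis
        by (simp add: m_def cross2_def del: vector_minus_component)
    qed
    moreover have "m r = 1" using k by (simp add: m_def k_def)
    ultimately show "(\<exists>a c. m = (\<lambda>x. a \<bullet> x + c)) \<and> (\<forall>x \<in> affine hull {p, q}. m x = 0) \<and> m r = 1"
      by blast
  next
    fix l :: "real^2 \<Rightarrow> real"
    assume l: "(\<exists>a c. l = (\<lambda>x. a \<bullet> x + c)) \<and> (\<forall>x \<in> affine hull {p, q}. l x = 0) \<and> l r = 1"
    then obtain a c where l_eq: "l = (\<lambda>x. a \<bullet> x + c)" by blast
    have "l p = 0" "l q = 0" using l by (auto simp: hull_inc)
    then have c: "c = - (a \<bullet> p)" and q0: "a \<bullet> (q - p) = 0"
      by (auto simp: l_eq inner_diff_right)
    have r1: "a \<bullet> (r - p) = 1" using l c by (auto simp: l_eq inner_diff_right)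
    let ?u = "(q - p)$1" and ?v = "(q - p)$2"
    have e1: "a$1 * ?u + a$2 * ?v = 0" using q0 by (simp add: inner_vec_def sum_2)
    have e2: "a$1 * (r - p)$1 + a$2 * (r - p)$2 = 1" using r1 by (simp add: inner_vec_def sum_2)
    have kk: "k = ?u * (r - p)$2 - ?v * (r - p)$1" by (simp add: k_def cross2_def)
    have a1: "a$1 * k = - ?v"
    proof -
      have "a$1 * k = (a$1 * ?u + a$2 * ?v) * (r - p)$2
          - ?v * (a$1 * (r - p)$1 + a$2 * (r - p)$2)"
        unfolding kk by (simp only: algebra_simps)
      then show ?thesis unfolding e1 e2 by simp
    qed
    have a2: "a$2 * k = ?u"
    proof -
      have "a$2 * k = ?u * (a$1 * (r - p)$1 + a$2 * (r - p)$2)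
          - (a$1 * ?u + a$2 * ?v) * (r - p)$1"
        unfolding kk by (simp only: algebra_simps)
      then show ?thesis unfolding e1 e2 by simp
    qed
    show "l = m"
    proof
      fix x
      have "l x = a \<bullet> (x - p)" by (simp add: l_eq c inner_diff_right)
      also have "\<dots> = a$1 * (x - p)$1 + a$2 * (x - p)$2" by (simp add: inner_vec_def sum_2)
      finally have "l x * k = (a$1 * k) * (x - p)$1 + (a$2 * k) * (x - p)$2"
        by (simp only: distrib_left distrib_right mult_ac)
      also have "\<dots> = cross2 (q - p) (x - p)"
        unfolding a1 a2 by (simp add: cross2_def algebra_simps)
      also have "\<dots> = m x * k" using k by (simp add: m_def)
      finally show "l x = m x" using k by simp
    qed
  qed
qed

definition lE :: "quad \<Rightarrow> 4 \<Rightarrow> real^2 \<Rightarrow> real" where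
  "lE V i = line_fun (V i) (V (i+1)) (edge_mid V (i+2))"

definition m13 :: "quad \<Rightarrow> real^2 \<Rightarrow> real" where
  "m13 V = line_fun (edge_mid V 1) (edge_mid V 3) (edge_mid V 2)"

definition m24 :: "quad \<Rightarrow> real^2 \<Rightarrow> real" where
  "m24 V = line_fun (edge_mid V 2) (edge_mid V 4) (edge_mid V 3)"

definition l13 :: "quad \<Rightarrow> real^2 \<Rightarrow> real" where
  "l13 V = line_fun (V 1) (V 3) (V 4)"

definition l24 :: "quad \<Rightarrow> real^2 \<Rightarrow> real" where
  "l24 V = line_fun (V 2) (V 4) (V 3)"

definition matA :: "quad \<Rightarrow> real^2^2" where
  "matA V = transpose (vector [(1/4) *\<^sub>R (V 3 - V 4 - V 1 + V 2), (1/4) *\<^sub>R (V 3 + V 4 - V 1 - V 2)])"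

definition vecd :: "quad \<Rightarrow> real^2" where
  "vecd V = (1/4) *\<^sub>R (V 3 - V 4 + V 1 - V 2)"

definition svec :: "quad \<Rightarrow> real^2" where
  "svec V = matrix_inv (matA V) *v vecd V"

definition phi1 :: "quad \<Rightarrow> real^2 \<Rightarrow> real" where
  "phi1 V = (let s1 = svec V $ 1; s2 = svec V $ 2 in
     (\<lambda>x. (s2 - 1) * (s2 + 1) * lE V 1 x * lE V 3 x * m13 V x * m24 V x
        - s1 * s2 * lE V 1 x * lE V 3 x * (m24 V x)\<^sup>2
        + s1 * lE V 1 x * lE V 3 x * (m24 V x)\<^sup>2 * m13 V x))"

definition phi2 :: "quad \<Rightarrow> real^2 \<Rightarrow> real" where
  "phi2 V = (let s1 = svec V $ 1; s2 = svec V $ 2 in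
     (\<lambda>x. (s1 - 1) * (s1 + 1) * lE V 2 x * lE V 4 x * m13 V x * m24 V x
        - s1 * s2 * lE V 2 x * lE V 4 x * (m13 V x)\<^sup>2
        + s2 * lE V 2 x * lE V 4 x * (m13 V x)\<^sup>2 * m24 V x))"

definition b0 :: "quad \<Rightarrow> real^2 \<Rightarrow> real" where
  "b0 V x = lE V 1 x * lE V 2 x * lE V 3 x * lE V 4 x"

section \<open>Local spaces\<close>

definition WKminus :: "quad \<Rightarrow> (real^2 \<Rightarrow> real) set" where
  "WKminus V = fun_sum (Pk 3) (fun_span {phi1 V, phi2 V})"

definition WKb :: "quad \<Rightarrow> (real^2 \<Rightarrow> real) set" where
  "WKb V = fun_span {b0 V, \<lambda>x. b0 V x * x$1, \<lambda>x. b0 V x * x$2, \<lambda>x. b0 V x * l13 V x * l24 V x}"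

definition WK :: "quad \<Rightarrow> (real^2 \<Rightarrow> real) set" where
  "WK V = {w \<in> fun_sum (WKminus V) (WKb V). \<forall>i.
     1 / dist (V i) (V (i+1)) * seg_integral (V i) (V (i+1)) (dir_deriv w (edge_normal V i))
     = 1/2 * (dir_deriv w (edge_normal V i) (V i) + dir_deriv w (edge_normal V i) (V (i+1)))}"

definition VKb :: "quad \<Rightarrow> (real^2 \<Rightarrow> real^2) set" where
  "VKb V = curl ` WKb V"

definition VKminus :: "quad \<Rightarrow> (real^2 \<Rightarrow> real^2) set" where
  "VKminus V = fun_sum {v. (\<lambda>x. v x $ 1) \<in> Pk 1 \<and> (\<lambda>x. v x $ 2) \<in> Pk 1}
     (fun_span {curl (\<lambda>x. (x$1)^3), curl (\<lambda>x. (x$1)^2 * x$2), curl (\<lambda>x. x$1 * (x$2)^2),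
        curl (\<lambda>x. (x$2)^3), curl (phi1 V), curl (phi2 V)})"

definition VK :: "quad \<Rightarrow> (real^2 \<Rightarrow> real^2) set" where
  "VK V = {v \<in> fun_sum (VKminus V) (VKb V). \<forall>i.
     1 / dist (V i) (V (i+1)) * seg_integral (V i) (V (i+1)) (\<lambda>x. v x \<bullet> edge_tangent V i)
     = 1/2 * ((v (V i) + v (V (i+1))) \<bullet> edge_tangent V i)}"

section \<open>Domains and meshes\<close>

text \<open>The boundary is locally the graph of a Lipschitz function, in the orthonormal coordinates
  given by \<open>e\<close> and \<open>e\<close> rotated by a right angle, with the domain on one side of it.\<close>

definition lipschitz_boundary :: "(real^2) set \<Rightarrow> bool" where
  "lipschitz_boundary \<Omega> \<longleftrightarrow> (\<forall>z \<in> frontier \<Omega>. \<exists>r>0. \<exists>e g C. norm e = 1 \<and> C-lipschitz_on UNIV g \<and>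
     \<Omega> \<inter> ball z r = {x \<in> ball z r. vector [- e$2, e$1] \<bullet> x < g (e \<bullet> x)})"

definition lipschitz_polygonal_domain :: "(real^2) set \<Rightarrow> bool" where
  "lipschitz_polygonal_domain \<Omega> \<longleftrightarrow>
     open \<Omega> \<and> connected \<Omega> \<and> bounded \<Omega> \<and> \<Omega> \<noteq> {} \<and> lipschitz_boundary \<Omega> \<and>
     (\<exists>S. finite S \<and> frontier \<Omega> = (\<Union>(a, b) \<in> S. closed_segment a b))"

text \<open>A conforming partition (no hanging nodes). Distinct members never describe the same cell with
  two different labellings, since then the intersection would be a whole cell.\<close>

definition quad_partition :: "(real^2) set \<Rightarrow> quad set \<Rightarrow> bool" where
  "quad_partition \<Omega> T \<longleftrightarrow>
     finite T \<and> (\<forall>K\<in>T. convex_quad K) \<and> (\<Union>K\<in>T. cell K) = closure \<Omega> \<and>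
     (\<forall>K\<in>T. \<forall>K'\<in>T. K \<noteq> K' \<longrightarrow>
        cell K \<inter> cell K' = {} \<or>
        (\<exists>i j. cell K \<inter> cell K' = {K i} \<and> K i = K' j) \<or>
        (\<exists>i j. cell K \<inter> cell K' = edge K i \<and> edge K i = edge K' j))"

text \<open>Shape regularity for quadrilaterals in the sense of Girault and Raviart: every triangle formed
  by three vertices of \<open>K\<close> contains a disc of radius comparable to the diameter of \<open>K\<close>, uniformly
  over the family.\<close>

definition shape_regular :: "quad set set \<Rightarrow> bool" where
  "shape_regular F \<longleftrightarrow> (\<exists>\<sigma>>0. \<forall>T\<in>F. \<forall>K\<in>T. \<forall>i. \<exists>c.
     cball c (diameter (cell K) / \<sigma>) \<subseteq> convex hull {K (i-1), K i, K (i+1)})"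

definition quasi_uniform :: "quad set set \<Rightarrow> bool" where
  "quasi_uniform F \<longleftrightarrow> (\<exists>C>0. \<forall>T\<in>F. \<forall>K\<in>T. \<forall>K'\<in>T. diameter (cell K) \<le> C * diameter (cell K'))"

definition mesh_vertices :: "quad set \<Rightarrow> (real^2) set" where
  "mesh_vertices T = (\<Union>K\<in>T. range K)"

definition interior_vertices :: "(real^2) set \<Rightarrow> quad set \<Rightarrow> (real^2) set" where
  "interior_vertices \<Omega> T = mesh_vertices T \<inter> \<Omega>"

definition boundary_vertices :: "(real^2) set \<Rightarrow> quad set \<Rightarrow> (real^2) set" where
  "boundary_vertices \<Omega> T = mesh_vertices T \<inter> frontier \<Omega>"

definition mesh_edges :: "quad set \<Rightarrow> (real^2) set set" where
  "mesh_edges T = (\<Union>K\<in>T. range (edge K))"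

definition unit_normals :: "quad set \<Rightarrow> ((real^2) set \<Rightarrow> real^2) \<Rightarrow> bool" where
  "unit_normals T \<nu> \<longleftrightarrow> (\<forall>K\<in>T. \<forall>i. norm (\<nu> (edge K i)) = 1 \<and> \<nu> (edge K i) \<bullet> (K (i+1) - K i) = 0)"

section \<open>Piecewise polynomial functions in \<open>L\<^sup>2\<close>\<close>

text \<open>Elements of \<open>L\<^sup>2(\<Omega>)\<close> are given by representatives; equality is equality almost everywhere
  on \<open>\<Omega>\<close>.\<close>

definition L2 :: "(real^2) set \<Rightarrow> (real^2 \<Rightarrow> 'b::euclidean_space) set" where
  "L2 \<Omega> = {f. f \<in> borel_measurable (lebesgue_on \<Omega>) \<and> integrable (lebesgue_on \<Omega>) (\<lambda>x. (norm (f x))\<^sup>2)}"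

definition ae_eq :: "(real^2) set \<Rightarrow> (real^2 \<Rightarrow> 'b::euclidean_space) \<Rightarrow> (real^2 \<Rightarrow> 'b) \<Rightarrow> bool" where
  "ae_eq \<Omega> f g \<longleftrightarrow> (AE x in lebesgue_on \<Omega>. f x = g x)"

text \<open>\<open>restricts_into f K S\<close> is \<open>f|\<^sub>K \<in> S\<close>; \<open>restr f K\<close> is the (unique) polynomial that coincides with
  \<open>f\<close> almost everywhere on \<open>K\<close>, so that its point values on the boundary of \<open>K\<close> are the traces
  taken from inside \<open>K\<close>.\<close>

definition restricts_into ::
    "(real^2 \<Rightarrow> 'b::euclidean_space) \<Rightarrow> quad \<Rightarrow> (real^2 \<Rightarrow> 'b) set \<Rightarrow> bool" where
  "restricts_into f K S \<longleftrightarrow> (\<exists>p\<in>S. ae_eq (cell K) f p)"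

definition restr :: "(real^2 \<Rightarrow> 'b::euclidean_space) \<Rightarrow> quad \<Rightarrow> real^2 \<Rightarrow> 'b" where
  "restr f K = (THE p. polynomial_function p \<and> ae_eq (cell K) f p)"

definition cellwise :: "quad set \<Rightarrow> ((real^2 \<Rightarrow> 'a::euclidean_space) \<Rightarrow> real^2 \<Rightarrow> 'b::euclidean_space)
    \<Rightarrow> (real^2 \<Rightarrow> 'a) \<Rightarrow> real^2 \<Rightarrow> 'b" where
  "cellwise T D f x = (\<Sum>K\<in>T. indicator (interior (cell K)) x *\<^sub>R D (restr f K) x)"

definition curl_h :: "quad set \<Rightarrow> (real^2 \<Rightarrow> real) \<Rightarrow> real^2 \<Rightarrow> real^2" where
  "curl_h T = cellwise T curl"

definition div_h :: "quad set \<Rightarrow> (real^2 \<Rightarrow> real^2) \<Rightarrow> real^2 \<Rightarrow> real" where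
  "div_h T = cellwise T divergence"

text \<open>In \<open>single_valued_at T g a\<close> and \<open>vanishes_at T g a\<close>, \<open>g K\<close> is the function on the cell \<open>K\<close>
  of a piecewise smooth function.\<close>

definition single_valued_at :: "quad set \<Rightarrow> (quad \<Rightarrow> real^2 \<Rightarrow> 'b) \<Rightarrow> real^2 \<Rightarrow> bool" where
  "single_valued_at T g a \<longleftrightarrow> (\<forall>K\<in>T. \<forall>K'\<in>T. a \<in> range K \<longrightarrow> a \<in> range K' \<longrightarrow> g K a = g K' a)"

definition vanishes_at :: "quad set \<Rightarrow> (quad \<Rightarrow> real^2 \<Rightarrow> 'b::zero) \<Rightarrow> real^2 \<Rightarrow> bool" where
  "vanishes_at T g a \<longleftrightarrow> (\<forall>K\<in>T. a \<in> range K \<longrightarrow> g K a = 0)"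

text \<open>\<open>behind n E K\<close>: the vector \<open>n\<close>, normal to the edge \<open>E\<close> of \<open>K\<close>, points out of \<open>K\<close>.\<close>

definition behind :: "real^2 \<Rightarrow> (real^2) set \<Rightarrow> quad \<Rightarrow> bool" where
  "behind n E K \<longleftrightarrow> (\<forall>x\<in>cell K. \<forall>y\<in>E. n \<bullet> (x - y) \<le> 0)"

definition boundary_edge :: "quad set \<Rightarrow> (real^2) set \<Rightarrow> bool" where
  "boundary_edge T E \<longleftrightarrow> (\<exists>!K. K \<in> T \<and> E \<in> range (edge K))"

definition jump :: "quad set \<Rightarrow> ((real^2) set \<Rightarrow> real^2) \<Rightarrow> (real^2 \<Rightarrow> 'b::euclidean_space)
    \<Rightarrow> (real^2) set \<Rightarrow> real^2 \<Rightarrow> 'b" where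
  "jump T \<nu> f E x =
     (if boundary_edge T E then restr f (THE K. K \<in> T \<and> E \<in> range (edge K)) x
      else restr f (THE K. K \<in> T \<and> E \<in> range (edge K) \<and> behind (\<nu> E) E K) x
         - restr f (THE K. K \<in> T \<and> E \<in> range (edge K) \<and> behind (- \<nu> E) E K) x)"

section \<open>Global spaces\<close>

definition Wh :: "(real^2) set \<Rightarrow> quad set \<Rightarrow> (real^2 \<Rightarrow> real) set" where
  "Wh \<Omega> T = {w \<in> L2 \<Omega>. (\<forall>K\<in>T. restricts_into w K (WK K)) \<and>
     (\<forall>a \<in> interior_vertices \<Omega> T.
        single_valued_at T (restr w) a \<and> single_valued_at T (\<lambda>K. grad (restr w K)) a) \<and>
     (\<forall>a \<in> boundary_vertices \<Omega> T.
        vanishes_at T (restr w) a \<and> vanishes_at T (\<lambda>K. grad (restr w K)) a)}"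

definition Vh :: "(real^2) set \<Rightarrow> quad set \<Rightarrow> ((real^2) set \<Rightarrow> real^2) \<Rightarrow> (real^2 \<Rightarrow> real^2) set" where
  "Vh \<Omega> T \<nu> = {v \<in> L2 \<Omega>. (\<forall>K\<in>T. restricts_into v K (VK K)) \<and>
     (\<forall>a b. closed_segment a b \<in> mesh_edges T \<longrightarrow>
        (let E = closed_segment a b in seg_integral a b (jump T \<nu> (\<lambda>x. v x \<bullet> \<nu> E) E) = 0)) \<and>
     (\<forall>a \<in> interior_vertices \<Omega> T. single_valued_at T (restr v) a) \<and>
     (\<forall>a \<in> boundary_vertices \<Omega> T. vanishes_at T (restr v) a)}"

definition Ph :: "(real^2) set \<Rightarrow> quad set \<Rightarrow> (real^2 \<Rightarrow> real) set" where
  "Ph \<Omega> T = {q \<in> L2 \<Omega>. (LINT x|lebesgue_on \<Omega>. q x) = 0 \<and> (\<forall>K\<in>T. restricts_into q K (Pk 0))}"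

section \<open>Exactness modulo equality almost everywhere\<close>

definition fun_subspace :: "(real^2 \<Rightarrow> 'b::euclidean_space) set \<Rightarrow> bool" where
  "fun_subspace X \<longleftrightarrow> (\<lambda>x. 0) \<in> X \<and>
     (\<forall>f\<in>X. \<forall>g\<in>X. \<forall>a b. (\<lambda>x. a *\<^sub>R f x + b *\<^sub>R g x) \<in> X)"

definition ae_linear_map :: "(real^2) set \<Rightarrow> (real^2 \<Rightarrow> 'a::euclidean_space) set \<Rightarrow>
    (real^2 \<Rightarrow> 'b::euclidean_space) set \<Rightarrow> ((real^2 \<Rightarrow> 'a) \<Rightarrow> real^2 \<Rightarrow> 'b) \<Rightarrow> bool" where
  "ae_linear_map \<Omega> X Y D \<longleftrightarrow> D ` X \<subseteq> Y \<and>
     (\<forall>f\<in>X. \<forall>g\<in>X. ae_eq \<Omega> f g \<longrightarrow> ae_eq \<Omega> (D f) (D g)) \<and>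
     (\<forall>f\<in>X. \<forall>g\<in>X. \<forall>a b. ae_eq \<Omega> (D (\<lambda>x. a *\<^sub>R f x + b *\<^sub>R g x)) (\<lambda>x. a *\<^sub>R D f x + b *\<^sub>R D g x))"

text \<open>Exactness of \<open>0 \<rightarrow> X \<rightarrow> Y \<rightarrow> Z \<rightarrow> 0\<close> with maps \<open>D\<close> and \<open>D'\<close>: these are well-defined linear maps
  between the vector spaces of classes, and the kernel of each map is the image of the previous
  one.\<close>

definition short_exact :: "(real^2) set \<Rightarrow> (real^2 \<Rightarrow> 'a::euclidean_space) set \<Rightarrow>
    (real^2 \<Rightarrow> 'b::euclidean_space) set \<Rightarrow> (real^2 \<Rightarrow> 'c::euclidean_space) set \<Rightarrow>
    ((real^2 \<Rightarrow> 'a) \<Rightarrow> real^2 \<Rightarrow> 'b) \<Rightarrow> ((real^2 \<Rightarrow> 'b) \<Rightarrow> real^2 \<Rightarrow> 'c) \<Rightarrow> bool" where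
  "short_exact \<Omega> X Y Z D D' \<longleftrightarrow>
     fun_subspace X \<and> fun_subspace Y \<and> fun_subspace Z \<and>
     ae_linear_map \<Omega> X Y D \<and> ae_linear_map \<Omega> Y Z D' \<and>
     (\<forall>f\<in>X. ae_eq \<Omega> (D f) (\<lambda>x. 0) \<longleftrightarrow> ae_eq \<Omega> f (\<lambda>x. 0)) \<and>
     (\<forall>g\<in>Y. ae_eq \<Omega> (D' g) (\<lambda>x. 0) \<longleftrightarrow> (\<exists>f\<in>X. ae_eq \<Omega> (D f) g)) \<and>
     (\<forall>h\<in>Z. \<exists>g\<in>Y. ae_eq \<Omega> (D' g) h)"

end

theory Submission
  imports Defs
begin

text \<open>On a cell, a field in \<open>V\<^sub>K\<close> is an affine field plus the curl of a scalar function, so its divergence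
  is constant and determined by its four edge fluxes. The complex therefore reduces to combinatorics of
  fluxes. A field with zero divergence is cellwise a curl, and its fluxes form a circulation on the dual
  graph; summing the changes of argument around a point \<open>a\<close> along the dual paths, weighted by the fluxes,
  gives a function whose differences along the edges are the fluxes, and which vanishes for \<open>a \<notin> \<Omega>\<close> because
  \<open>\<Omega>\<close> is simply connected, so that \<open>x - a\<close> has a continuous logarithm on \<open>\<Omega>\<close>. This function fixes the
  constants of the local potentials. Surjectivity of the divergence needs fluxes with
  prescribed sums on the cells, which exist since \<open>\<Omega>\<close> minus the vertices is connected, and the fact that
  fluxes and vertex values can be prescribed in \<open>V\<^sub>K\<close>.\<close>

section \<open>Polynomial calculus in the plane\<close>

text \<open>The pieces are glued weakly: functions in W_h match only through values and gradients at
  vertices, fields in V_h only through vertex values and one normal moment per edge. The bridge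
  between the two is that the flux of curl w through an edge is the difference of w at its
  endpoints. For cellwise curls, flux balance is therefore the same as matching vertex values up to
  one constant per cell, and choosing these constants consistently is the only place that uses
  simple connectivity. The winding sum is a closed formula for the common vertex values, defined at
  every point of the plane, so it requires neither an ordering of the cells nor a count of vertices,
  edges and cells. Locally the obstacle is the four edge constraints in W_K and V_K. The four bubble
  functions absorb them without touching values and gradients at the vertices. Both there and in the
  Hermite interpolation, four data are met by P_1 plus one extra function. Four points in the plane
  satisfy one affine relation, so solvability means that the extra function violates it; convexity
  of the cell is what guarantees this.\<close>

lemma vec2_eq_iff: "(v::real^2) = w \<longleftrightarrow> v$1 = w$1 \<and> v$2 = w$2"
  by (auto simp: vec_eq_iff forall_2)

lemma has_derivative_vec_nth2 [derivative_intros]: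
  "((\<lambda>x::real^2. x$i) has_derivative (\<lambda>h. h$i)) (at x within S)"
  by (rule bounded_linear_imp_has_derivative) (rule bounded_linear_vec_nth)

lemma pderiv2_eqI:
  assumes "(f has_derivative f') (at x)" shows "pderiv2 i f x = f' (axis i 1)"
  using frechet_derivative_at[OF assms] by (simp add: pderiv2_def)

lemma has_derivative_pderiv2:
  fixes f :: "real^2 \<Rightarrow> real"
  assumes "f differentiable (at x)"
  shows "(f has_derivative (\<lambda>h. h$1 * pderiv2 1 f x + h$2 * pderiv2 2 f x)) (at x)"
proof -
  obtain f' where f': "(f has_derivative f') (at x)"
    using assms by (auto simp: differentiable_def)
  interpret f': bounded_linear f' by (rule has_derivative_bounded_linear[OF f'])
  have "f' h = h$1 * pderiv2 1 f x + h$2 * pderiv2 2 f x" for h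
  proof -
    have "h = h$1 *\<^sub>R axis 1 1 + h$2 *\<^sub>R axis 2 1"
      by (simp add: vec2_eq_iff axis_def)
    then have "f' h = f' (h$1 *\<^sub>R axis 1 1 + h$2 *\<^sub>R axis 2 1)" by simp
    then show ?thesis by (simp add: f'.add f'.scaleR pderiv2_eqI[OF f'])
  qed
  then show ?thesis using f' by (metis (no_types, lifting) ext)
qed

lemma real_polynomial_function_differentiable [simp]:
  fixes f :: "'a::real_normed_vector \<Rightarrow> real"
  assumes "real_polynomial_function f" shows "f differentiable (at x)"
  using assms
  by (induction) (auto simp: bounded_linear_imp_differentiable)

lemma dir_deriv_eq:
  assumes "f differentiable (at x)"
  shows "dir_deriv f n x = n$1 * pderiv2 1 f x + n$2 * pderiv2 2 f x"
  unfolding dir_deriv_def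
  by (simp flip: frechet_derivative_at[OF has_derivative_pderiv2[OF assms]])

lemma pderiv2_const [simp]: "pderiv2 i (\<lambda>x. c) x = 0"
  using pderiv2_eqI[OF has_derivative_const] by simp

lemma pderiv2_nth [simp]: "pderiv2 i (\<lambda>x. x$j) x = (if i = j then 1 else 0)"
  using pderiv2_eqI[OF has_derivative_vec_nth2] by (auto simp: axis_def)

lemma
  assumes f: "f differentiable (at x)" and g: "g differentiable (at x)"
  shows pderiv2_add: "pderiv2 i (\<lambda>x. f x + g x) x = pderiv2 i f x + pderiv2 i g x"
    and pderiv2_mult: "pderiv2 i (\<lambda>x. f x * g x) x = f x * pderiv2 i g x + pderiv2 i f x * g x"
proof -
  obtain f' g' where f': "(f has_derivative f') (at x)" and g': "(g has_derivative g') (at x)"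
    using assms by (auto simp: differentiable_def)
  show "pderiv2 i (\<lambda>x. f x + g x) x = pderiv2 i f x + pderiv2 i g x"
    using pderiv2_eqI[OF has_derivative_add[OF f' g']] pderiv2_eqI[OF f'] pderiv2_eqI[OF g'] by simp
  show "pderiv2 i (\<lambda>x. f x * g x) x = f x * pderiv2 i g x + pderiv2 i f x * g x"
    using pderiv2_eqI[OF has_derivative_mult[OF f' g']] pderiv2_eqI[OF f'] pderiv2_eqI[OF g'] by simp
qed

lemma pderiv2_cmult:
  assumes "f differentiable (at x)"
  shows "pderiv2 i (\<lambda>x. c * f x) x = c * pderiv2 i f x"
  using pderiv2_mult[of "\<lambda>x. c", OF _ assms] by simp

lemma pderiv2_linear:
  assumes "bounded_linear f" shows "pderiv2 i f x = f (axis i 1)"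
  using pderiv2_eqI[OF bounded_linear_imp_has_derivative[OF assms]] .

lemma real_polynomial_function_nth [intro, simp]:
  "real_polynomial_function (\<lambda>x::real^2. x$i)"
  by (rule real_polynomial_function.intros) (rule bounded_linear_vec_nth)

lemma real_polynomial_function_pderiv2:
  assumes "real_polynomial_function f" shows "real_polynomial_function (pderiv2 i f)"
  using assms
proof induction
  case (linear f)
  then have "pderiv2 i f = (\<lambda>x. f (axis i 1))" by (auto simp: pderiv2_linear)
  then show ?case by (simp add: real_polynomial_function.intros)
next
  case (const c)
  then show ?case by (simp add: fun_eq_iff[THEN iffD2] real_polynomial_function.intros)
next
  case (add f g)
  then have "pderiv2 i (\<lambda>x. f x + g x) = (\<lambda>x. pderiv2 i f x + pderiv2 i g x)"
    by (auto simp: pderiv2_add)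
  with add show ?case by (simp add: real_polynomial_function.intros)
next
  case (mult f g)
  then have "pderiv2 i (\<lambda>x. f x * g x) = (\<lambda>x. f x * pderiv2 i g x + pderiv2 i f x * g x)"
    by (auto simp: pderiv2_mult)
  with mult show ?case by (simp add: real_polynomial_function.intros real_polynomial_function.intros)
qed

text \<open>Symmetry of mixed derivatives follows the construction of polynomials: in the product
  case both orders expand, by the Leibniz rule applied twice, into the same four terms. It is what
  makes the divergence of a curl vanish.\<close>

lemma pderiv2_commute:
  assumes "real_polynomial_function f"
  shows "pderiv2 i (pderiv2 j f) x = pderiv2 j (pderiv2 i f) x"
  using assms
proof (induction arbitrary: x)
  case (linear f)
  have "pderiv2 k f = (\<lambda>x. f (axis k 1))" for k
    using linear by (auto simp: pderiv2_linear)
  then show ?case by simp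
next
  case (const c)
  have "pderiv2 k (\<lambda>x. c) = (\<lambda>x. 0)" for k by auto
  then show ?case by simp
next
  case (add f g)
  have "pderiv2 k (\<lambda>x. f x + g x) = (\<lambda>x. pderiv2 k f x + pderiv2 k g x)" for k
    using add.hyps by (auto simp: pderiv2_add)
  with add show ?case by (simp add: pderiv2_add real_polynomial_function_pderiv2)
next
  case (mult f g)
  have *: "pderiv2 k (\<lambda>x. f x * g x) = (\<lambda>x. f x * pderiv2 k g x + pderiv2 k f x * g x)" for k
    using mult.hyps by (auto simp: pderiv2_mult)
  note d = real_polynomial_function_differentiable[OF real_polynomial_function_pderiv2]
    real_polynomial_function_differentiable
  show ?case using mult unfolding *
    by (simp add: pderiv2_add pderiv2_mult d real_polynomial_function_pderiv2
        real_polynomial_function.intros real_polynomial_function.intros)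
qed

lemma polynomial_function_vec2_iff:
  "polynomial_function (v :: real^2 \<Rightarrow> real^2) \<longleftrightarrow>
     real_polynomial_function (\<lambda>x. v x $ 1) \<and> real_polynomial_function (\<lambda>x. v x $ 2)"
  by (auto simp: polynomial_function_iff_Basis_inner Basis_vec_def inner_axis forall_2)

lemma polynomial_function_curl:
  assumes "real_polynomial_function w" shows "polynomial_function (curl w)"
  unfolding polynomial_function_vec2_iff
  using assms by (simp add: curl_def real_polynomial_function_pderiv2 real_polynomial_function_minus)

lemma real_polynomial_function_divergence:
  assumes "polynomial_function v" shows "real_polynomial_function (divergence v)"
  using assms unfolding polynomial_function_vec2_iff divergence_def
  by (simp add: real_polynomial_function_pderiv2 real_polynomial_function.intros)

lemma divergence_curl:
  assumes "real_polynomial_function w" shows "divergence (curl w) x = 0"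
proof -
  have "(\<lambda>y. curl w y $ 1) = pderiv2 2 w" by (simp add: curl_def)
  moreover have "(\<lambda>y. curl w y $ 2) = (\<lambda>y. (-1) * pderiv2 1 w y)" by (simp add: curl_def)
  moreover have "pderiv2 2 (\<lambda>y. (-1) * pderiv2 1 w y) x = - pderiv2 2 (pderiv2 1 w) x"
    using assms by (subst pderiv2_cmult) (auto simp: real_polynomial_function_pderiv2)
  ultimately show ?thesis
    using pderiv2_commute[OF assms, of 1 2 x] by (simp add: divergence_def)
qed

lemma curl_lincomb:
  assumes "real_polynomial_function f" "real_polynomial_function g"
  shows "curl (\<lambda>x. a * f x + b * g x) = (\<lambda>x. a *\<^sub>R curl f x + b *\<^sub>R curl g x)"
  using assms
  by (auto simp: curl_def vec2_eq_iff pderiv2_add pderiv2_cmult real_polynomial_function.intros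
      real_polynomial_function.intros fun_eq_iff algebra_simps)

lemma curl_const: "curl (\<lambda>x. c) = (\<lambda>x. 0)"
  by (simp add: curl_def vec2_eq_iff fun_eq_iff)

lemma divergence_lincomb:
  assumes "polynomial_function f" "polynomial_function g"
  shows "divergence (\<lambda>x. a *\<^sub>R f x + b *\<^sub>R g x) = (\<lambda>x. a * divergence f x + b * divergence g x)"
  using assms unfolding polynomial_function_vec2_iff
  by (auto simp: divergence_def pderiv2_add pderiv2_cmult real_polynomial_function.intros
      real_polynomial_function.intros fun_eq_iff algebra_simps)

text \<open>On the line from a point of \<open>S\<close> to \<open>y\<close> the function is a
  univariate polynomial with infinitely many zeros. This is why a polynomial is determined by its
  values inside a cell, so that its traces on the boundary of the cell are meaningful.\<close>

lemma real_polynomial_function_zero_on_open: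
  fixes f :: "'a::real_normed_vector \<Rightarrow> real"
  assumes f: "real_polynomial_function f" and S: "open S" "S \<noteq> {}" and 0: "\<And>x. x \<in> S \<Longrightarrow> f x = 0"
  shows "f y = 0"
proof -
  obtain x where x: "x \<in> S" using S by auto
  define l where "l t = x + t *\<^sub>R (y - x)" for t :: real
  have pl: "polynomial_function l"
    unfolding l_def by (intro polynomial_function_add polynomial_function_mult) auto
  have "real_polynomial_function (f \<circ> l)"
    by (rule real_polynomial_function_compose[OF pl f])
  then obtain a n where an: "(f \<circ> l) = (\<lambda>t. \<Sum>i\<le>n. a i * t^i)"
    unfolding real_polynomial_function_iff_sum by blast
  have "open (l -` S)"
    by (rule open_vimage[OF S(1)]) (auto simp: l_def intro!: continuous_intros)
  moreover have "0 \<in> l -` S" using x by (simp add: l_def)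
  ultimately obtain e where e: "e > 0" "ball 0 e \<subseteq> l -` S"
    unfolding open_contains_ball by blast
  have "infinite {t. (\<Sum>i\<le>n. a i * t^i) = 0}"
  proof -
    have "{0<..<e} \<subseteq> {t. (\<Sum>i\<le>n. a i * t^i) = 0}"
    proof
      fix t assume "t \<in> {0<..<e}"
      then have "t \<in> ball 0 e" by (auto simp: dist_real_def)
      then have "t \<in> l -` S" using e(2) by blast
      then have "(f \<circ> l) t = 0" using 0 by simp
      then show "t \<in> {t. (\<Sum>i\<le>n. a i * t^i) = 0}" using an by (simp add: fun_eq_iff)
    qed
    then show ?thesis using e(1) infinite_Ioo[of 0 e] finite_subset by blast
  qed
  then have "\<forall>i\<le>n. a i = 0"
    using polyfun_finite_roots by blast
  then have "(f \<circ> l) 1 = 0" by (simp add: an)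
  then show ?thesis by (simp add: l_def)
qed

lemma polynomial_function_eq_on_open:
  fixes f g :: "'a::real_normed_vector \<Rightarrow> 'b::euclidean_space"
  assumes f: "polynomial_function f" and g: "polynomial_function g"
    and S: "open S" "S \<noteq> {}" and eq: "\<And>x. x \<in> S \<Longrightarrow> f x = g x"
  shows "f = g"
proof (rule ext, rule euclidean_eqI)
  fix y and b :: 'b assume b: "b \<in> Basis"
  have "real_polynomial_function (\<lambda>x. (f x - g x) \<bullet> b)"
    using polynomial_function_diff[OF f g] b by (auto simp: polynomial_function_iff_Basis_inner)
  then have "(f y - g y) \<bullet> b = 0"
    by (rule real_polynomial_function_zero_on_open[OF _ S]) (simp add: eq)
  then show "f y \<bullet> b = g y \<bullet> b" by (simp add: inner_diff_left)
qed

section \<open>Spans, sums and polynomial spaces of functions\<close>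

lemma fun_span_0: "(\<lambda>x. 0) \<in> fun_span B"
  unfolding fun_span_def by (rule CollectI, rule exI[of _ "{}"]) auto

lemma fun_span_base: "b \<in> B \<Longrightarrow> b \<in> fun_span B"
  unfolding fun_span_def
  by (rule CollectI, rule exI[of _ "{b}"], rule exI[of _ "\<lambda>_. 1"]) auto

lemma fun_span_scale: "f \<in> fun_span B \<Longrightarrow> (\<lambda>x. c *\<^sub>R f x) \<in> fun_span B"
  unfolding fun_span_def
proof safe
  fix t r assume t: "finite t" "t \<subseteq> B"
  then show "\<exists>t' r'. finite t' \<and> t' \<subseteq> B \<and> (\<lambda>x. c *\<^sub>R (\<Sum>b\<in>t. r b *\<^sub>R b x)) = (\<lambda>x. \<Sum>b\<in>t'. r' b *\<^sub>R b x)"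
    by (intro exI[of _ t] exI[of _ "\<lambda>b. c * r b"]) (auto simp: scaleR_sum_right)
qed

lemma fun_span_add: 
  assumes "f \<in> fun_span B" "g \<in> fun_span B" shows "(\<lambda>x. f x + g x) \<in> fun_span B"
proof -
  obtain t r t' r' where f: "finite t" "t \<subseteq> B" "f = (\<lambda>x. \<Sum>b\<in>t. r b *\<^sub>R b x)"
    and g: "finite t'" "t' \<subseteq> B" "g = (\<lambda>x. \<Sum>b\<in>t'. r' b *\<^sub>R b x)"
    using assms unfolding fun_span_def by blast
  let ?r = "\<lambda>b. if b \<in> t then r b else 0" and ?r' = "\<lambda>b. if b \<in> t' then r' b else 0"
  have "f x + g x = (\<Sum>b\<in>t \<union> t'. (?r b + ?r' b) *\<^sub>R b x)" for x
  proof -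
    have "f x = (\<Sum>b\<in>t \<union> t'. ?r b *\<^sub>R b x)"
      unfolding f(3) using f g by (intro sum.mono_neutral_cong_left) auto
    moreover have "g x = (\<Sum>b\<in>t \<union> t'. ?r' b *\<^sub>R b x)"
      unfolding g(3) using f g by (intro sum.mono_neutral_cong_left) auto
    ultimately show ?thesis by (simp only: sum.distrib scaleR_left_distrib)
  qed
  then show ?thesis using f g unfolding fun_span_def
    by (intro CollectI exI[of _ "t \<union> t'"] exI[of _ "\<lambda>b. ?r b + ?r' b"]) auto
qed

lemma fun_span_induct [consumes 1, case_names zero add]:
  assumes "f \<in> fun_span B" "P (\<lambda>x. 0)"
    and "\<And>b c g. b \<in> B \<Longrightarrow> g \<in> fun_span B \<Longrightarrow> P g \<Longrightarrow> P (\<lambda>x. c *\<^sub>R b x + g x)"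
  shows "P f"
proof -
  obtain t r where t: "finite t" "t \<subseteq> B" "f = (\<lambda>x. \<Sum>b\<in>t. r b *\<^sub>R b x)"
    using assms unfolding fun_span_def by blast
  have "(\<lambda>x. \<Sum>b\<in>t. r b *\<^sub>R b x) \<in> fun_span B \<and> P (\<lambda>x. \<Sum>b\<in>t. r b *\<^sub>R b x)"
    using t(1,2)
  proof (induction t)
    case empty
    then show ?case using assms(2) fun_span_0 by simp
  next
    case (insert b t)
    then show ?case using assms(3)[of b "\<lambda>x. \<Sum>b\<in>t. r b *\<^sub>R b x" "r b"]
        fun_span_add[OF fun_span_scale[OF fun_span_base[of b B], of "r b"], of "\<lambda>x. \<Sum>b\<in>t. r b *\<^sub>R b x"] by simp
  qed
  then show ?thesis using t(3) by simp
qed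

lemma fun_subspace_fun_span: "fun_subspace (fun_span B)"
  unfolding fun_subspace_def by (auto intro!: fun_span_add fun_span_scale fun_span_0)

lemma fun_sumI: "f \<in> S \<Longrightarrow> g \<in> T \<Longrightarrow> (\<lambda>x. f x + g x) \<in> fun_sum S T"
  unfolding fun_sum_def by blast

lemma fun_sumE:
  assumes "h \<in> fun_sum S T"
  obtains f g where "f \<in> S" "g \<in> T" "h = (\<lambda>x. f x + g x)"
  using assms unfolding fun_sum_def by blast

lemma fun_subspace_fun_sum:
  assumes S: "fun_subspace S" and T: "fun_subspace T" shows "fun_subspace (fun_sum S T)"
  unfolding fun_subspace_def
proof (intro conjI ballI allI)
  show "(\<lambda>x. 0) \<in> fun_sum S T"
    unfolding fun_sum_def using S T
    by (intro CollectI exI[of _ "\<lambda>x. 0"]) (auto simp: fun_subspace_def)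
  fix f g a b assume "f \<in> fun_sum S T" "g \<in> fun_sum S T"
  then obtain f1 f2 g1 g2 where "f = (\<lambda>x. f1 x + f2 x)" "g = (\<lambda>x. g1 x + g2 x)"
    and *: "f1 \<in> S" "f2 \<in> T" "g1 \<in> S" "g2 \<in> T" unfolding fun_sum_def by blast
  then have "(\<lambda>x. a *\<^sub>R f x + b *\<^sub>R g x)
      = (\<lambda>x. (a *\<^sub>R f1 x + b *\<^sub>R g1 x) + (a *\<^sub>R f2 x + b *\<^sub>R g2 x))"
    by (auto simp: algebra_simps)
  moreover have "(\<lambda>x. a *\<^sub>R f1 x + b *\<^sub>R g1 x) \<in> S" "(\<lambda>x. a *\<^sub>R f2 x + b *\<^sub>R g2 x) \<in> T"
    using S T * by (auto simp: fun_subspace_def)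
  ultimately show "(\<lambda>x. a *\<^sub>R f x + b *\<^sub>R g x) \<in> fun_sum S T" by (simp add: fun_sumI)
qed

lemma fun_subspace_Pk: "fun_subspace (Pk k)"
  unfolding fun_subspace_def
proof (intro conjI ballI allI)
  show "(\<lambda>x. 0) \<in> Pk k" unfolding Pk_def by (intro CollectI exI[of _ "\<lambda>i j. 0"]) auto
  fix f g :: "real^2 \<Rightarrow> real" and a b assume "f \<in> Pk k" "g \<in> Pk k"
  then obtain c d where f: "f = (\<lambda>x. \<Sum>i\<le>k. \<Sum>j\<le>k - i. c i j * (x$1) ^ i * (x$2) ^ j)"
    and g: "g = (\<lambda>x. \<Sum>i\<le>k. \<Sum>j\<le>k - i. d i j * (x$1) ^ i * (x$2) ^ j)" unfolding Pk_def by blast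
  show "(\<lambda>x. a *\<^sub>R f x + b *\<^sub>R g x) \<in> Pk k" unfolding Pk_def
    by (intro CollectI exI[of _ "\<lambda>i j. a * c i j + b * d i j"])
       (auto simp: f g sum_distrib_left sum.distrib algebra_simps)
qed

lemma fun_subspace_lincomb:
  "fun_subspace X \<Longrightarrow> f \<in> X \<Longrightarrow> g \<in> X \<Longrightarrow> (\<lambda>x. a *\<^sub>R f x + b *\<^sub>R g x) \<in> X"
  unfolding fun_subspace_def by blast

lemma fun_subspace_add: "fun_subspace X \<Longrightarrow> f \<in> X \<Longrightarrow> g \<in> X \<Longrightarrow> (\<lambda>x. f x + g x) \<in> X"
  using fun_subspace_lincomb[of X f g 1 1] by simp

lemma fun_subspace_scale: "fun_subspace X \<Longrightarrow> f \<in> X \<Longrightarrow> (\<lambda>x. a *\<^sub>R f x) \<in> X"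
  using fun_subspace_lincomb[of X f f a 0] by simp

lemma fun_subspace_sum:
  assumes S: "fun_subspace X" and "finite I" "\<And>i. i \<in> I \<Longrightarrow> h i \<in> X"
  shows "(\<lambda>x. \<Sum>i\<in>I. h i x) \<in> X"
  using assms(2,3)
proof (induction I)
  case empty
  show ?case using S by (simp add: fun_subspace_def)
next
  case (insert i I)
  then show ?case using fun_subspace_add[OF S, of "h i" "\<lambda>x. \<Sum>i\<in>I. h i x"] by simp
qed

lemma real_polynomial_function_Pk: "p \<in> Pk k \<Longrightarrow> real_polynomial_function p"
  unfolding Pk_def
  by (auto intro!: real_polynomial_function_sum real_polynomial_function.intros(2-)
      real_polynomial_function_power)

lemma Pk_monomial:
  assumes "i + j \<le> k" shows "(\<lambda>x. (x$1)^i * (x$2)^j) \<in> Pk k"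
proof -
  have "(\<Sum>i'\<le>k. \<Sum>j'\<le>k - i'. (if i' = i \<and> j' = j then 1 else 0) * (x$1) ^ i' * (x$2) ^ j')
      = (x$1)^i * (x$2)^j" (is "?L = _") for x :: "real^2"
  proof -
    have "?L = (\<Sum>i'\<le>k. if i' = i then (\<Sum>j'\<le>k - i. if j' = j then (x$1) ^ i * (x$2) ^ j else 0) else 0)"
    proof (intro sum.cong refl)
      fix i' assume "i' \<in> {..k}"
      have "(if i' = i \<and> j' = j then 1 else 0) * (x$1) ^ i' * (x$2) ^ j'
          = (if i' = i then if j' = j then (x$1) ^ i * (x$2) ^ j else 0 else 0)" for j' by auto
      then show "(\<Sum>j'\<le>k - i'. (if i' = i \<and> j' = j then 1 else 0) * (x$1) ^ i' * (x$2) ^ j') =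
          (if i' = i then (\<Sum>j'\<le>k - i. if j' = j then (x$1) ^ i * (x$2) ^ j else 0) else 0)"
        by simp
    qed
    also have "\<dots> = (x$1)^i * (x$2)^j" using assms by (simp add: sum.delta)
    finally show ?thesis .
  qed
  then show ?thesis unfolding Pk_def
    by (intro CollectI exI[of _ "\<lambda>i' j'. if i' = i \<and> j' = j then 1 else 0"]) (auto simp: fun_eq_iff)
qed

lemma Pk_1_iff: "p \<in> Pk 1 \<longleftrightarrow> (\<exists>a b c. p = (\<lambda>x. a + b * x$1 + c * x$2))"
proof
  assume "p \<in> Pk 1"
  then obtain c where "p = (\<lambda>x. \<Sum>i\<le>1. \<Sum>j\<le>1 - i. c i j * (x$1) ^ i * (x$2) ^ j)" unfolding Pk_def by blast
  then have "p = (\<lambda>x. c 0 0 + c 1 0 * x$1 + c 0 1 * x$2)" by (auto simp: fun_eq_iff)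
  then show "\<exists>a b c. p = (\<lambda>x. a + b * x$1 + c * x$2)" by blast
next
  assume "\<exists>a b c. p = (\<lambda>x. a + b * x$1 + c * x$2)"
  then obtain a b c where p: "p = (\<lambda>x. a + b * x$1 + c * x$2)" by blast
  show "p \<in> Pk 1" unfolding Pk_def
    by (intro CollectI exI[of _ "\<lambda>i j. if i = 0 then if j = 0 then a else c else b"])
       (auto simp: p fun_eq_iff)
qed

lemma Pk_0_iff: "p \<in> Pk 0 \<longleftrightarrow> (\<exists>a. p = (\<lambda>x. a))"
  unfolding Pk_def by (auto simp: fun_eq_iff)

lemma Pk_mono:
  assumes "k \<le> l" shows "Pk k \<subseteq> Pk l"
proof
  fix p assume "p \<in> Pk k"
  then obtain c where p: "p = (\<lambda>x. \<Sum>i\<le>k. \<Sum>j\<le>k - i. c i j * (x$1) ^ i * (x$2) ^ j)" unfolding Pk_def by blast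
  have S: "fun_subspace (Pk l)" by (rule fun_subspace_Pk)
  show "p \<in> Pk l" unfolding p
  proof (intro fun_subspace_sum[OF S])
    fix i j assume "i \<in> {..k}" "j \<in> {..k - i}"
    then have "i + j \<le> l" using assms by auto
    from fun_subspace_scale[OF S Pk_monomial[OF this], of "c i j"]
    show "(\<lambda>x. c i j * (x$1)^i * (x$2)^j) \<in> Pk l" by (simp add: mult_ac)
  qed auto
qed

section \<open>Geometry of convex quadrilaterals\<close>

lemma index4 [simp]:
  "1 + 1 = (2::4)" "2 + 1 = (3::4)" "3 + 1 = (4::4)" "4 + 1 = (1::4)"
  "1 + 2 = (3::4)" "2 + 2 = (4::4)" "3 + 2 = (1::4)" "4 + 2 = (2::4)"
  "1 + 3 = (4::4)" "2 + 3 = (1::4)" "3 + 3 = (2::4)" "4 + 3 = (3::4)"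
  by simp_all

lemma index4_wrap [simp]:
  fixes i :: 4
  shows "(5::4) = 1" "(6::4) = 2" "(7::4) = 3" "i + 4 = i" "i + 5 = i + 1" "i + 6 = i + 2"
  using exhaust_4[of i] by auto

lemma index4_shift:
  fixes i :: 4
  shows "i + 1 + 1 = i + 2" "i + 1 + 2 = i + 3" "i + 1 + 3 = i" "i + 2 + 1 = i + 3" "i + 3 + 1 = i"
    "i + 2 + 2 = i" "i + 3 + 2 = i + 1" "i \<noteq> i + 1" "i \<noteq> i + 2" "i \<noteq> i + 3"
    "i + 1 \<noteq> i + 2" "i + 1 \<noteq> i + 3" "i + 2 \<noteq> i + 3"
  using exhaust_4[of i] by auto

lemma index4_cases: "(k::4) = i \<or> k = i + 1 \<or> k = i + 2 \<or> k = i + 3"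
  using exhaust_4[of i] exhaust_4[of k] by auto

lemma cross2_self [simp]: "cross2 a a = 0" "cross2 0 a = 0" "cross2 a 0 = 0"
  by (auto simp: cross2_def)

lemma cross2_inner: "cross2 u v = vector [- u$2, u$1] \<bullet> v"
  by (simp add: cross2_def inner_vec_def sum_2)

text \<open>Twice the signed area of the triangle \<open>V i\<close>, \<open>V (i+1)\<close>,
  \<open>x\<close>: an affine function that is positive to the left of the directed edge, hence on
  the inner side of a counterclockwise cell.\<close>

definition side :: "quad \<Rightarrow> 4 \<Rightarrow> real^2 \<Rightarrow> real" where
  "side V i x = cross2 (V (i+1) - V i) (x - V i)"

lemma side_eq: "side V i x = vector [- (V (i+1) - V i)$2, (V (i+1) - V i)$1] \<bullet> x
    + ((V (i+1) - V i)$2 * V i$1 - (V (i+1) - V i)$1 * V i$2)"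
  by (simp add: side_def cross2_def inner_vec_def sum_2 algebra_simps)

lemma continuous_on_side [continuous_intros]: "continuous_on S (side V i)"
  unfolding side_eq[abs_def] by (intro continuous_intros)

lemma side_affine: "u + v = 1 \<Longrightarrow> side V i (u *\<^sub>R x + v *\<^sub>R y) = u * side V i x + v * side V i y"
proof -
  assume uv: "u + v = 1"
  then have u: "u = 1 - v" by simp
  show ?thesis unfolding side_eq u by (simp add: inner_add_right algebra_simps)
qed

lemma side_vertex [simp]: "side V i (V i) = 0" "side V i (V (i+1)) = 0"
  by (simp_all add: side_def)

text \<open>Both values are turns of the polygon, at \<open>V (i+1)\<close> and at
  \<open>V i\<close>; the second appears after a cyclic permutation of the corners of its triangle,
  which leaves the signed area unchanged.\<close>

lemma side_pos:
  assumes "convex_quad V"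
  shows "side V i (V (i+2)) > 0" "side V i (V (i+3)) > 0"
proof -
  have "cross2 (V (i+1) - V i) (V (i+2) - V (i+1)) > 0"
    using assms by (auto simp: convex_quad_def)
  then show "side V i (V (i+2)) > 0" by (simp add: side_def cross2_def algebra_simps)
  have "cross2 (V (i+3+1) - V (i+3)) (V (i+3+2) - V (i+3+1)) > 0"
    using assms unfolding convex_quad_def by blast
  then show "side V i (V (i+3)) > 0" by (simp add: index4_shift side_def cross2_def algebra_simps)
qed

lemma side_nonneg: "convex_quad V \<Longrightarrow> side V i (V k) \<ge> 0"
  using index4_cases[of k i] side_pos[of V i] by (auto simp: less_imp_le)

lemma side_pos': "convex_quad V \<Longrightarrow> k \<noteq> i \<Longrightarrow> k \<noteq> i + 1 \<Longrightarrow> side V i (V k) > 0"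
  using index4_cases[of k i] side_pos[of V i] by auto

text \<open>If two vertices coincided, each would lie on the line of the edge that starts at the
  other. This forces each index to be the successor of the other, which is impossible modulo
  4.\<close>

lemma inj_convex_quad: 
  assumes "convex_quad V" shows "inj V"
proof
  fix i j assume eq: "V i = V j"
  show "i = j"
  proof (rule ccontr)
    assume ne: "i \<noteq> j"
    have "side V i (V j) = 0" "side V j (V i) = 0" using eq by (metis side_vertex(1))+
    then have "j = i + 1" "i = j + 1"
      using side_pos'[OF assms, of j i] side_pos'[OF assms, of i j] ne by auto
    then show False using index4_shift(1)[of i] index4_shift(9)[of i] by metis
  qed
qed

text \<open>The barycentric coordinates of \<open>x\<close> are the quotients of the signed areas
  opposite to the corners by the area of the whole triangle.\<close>

lemma triangle_hull:
  assumes pos: "cross2 (b - a) (c - a) > 0"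
    and x: "cross2 (b - a) (x - a) \<ge> 0" "cross2 (c - b) (x - b) \<ge> 0" "cross2 (a - c) (x - c) \<ge> 0"
  shows "x \<in> convex hull {a, b, c}"
proof -
  define D u v w where "D = cross2 (b - a) (c - a)" and "u = cross2 (c - b) (x - b)"
    and "v = cross2 (a - c) (x - c)" and "w = cross2 (b - a) (x - a)"
  have D: "D > 0" using pos by (simp add: D_def)
  have s: "u + v + w = D" by (simp add: u_def v_def w_def D_def cross2_def algebra_simps)
  have "D *\<^sub>R x = u *\<^sub>R a + v *\<^sub>R b + w *\<^sub>R c"
    by (simp add: vec2_eq_iff u_def v_def w_def D_def cross2_def algebra_simps)
  then have "(1/D) *\<^sub>R (D *\<^sub>R x) = (1/D) *\<^sub>R (u *\<^sub>R a + v *\<^sub>R b + w *\<^sub>R c)" by simp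
  then have "x = (u/D) *\<^sub>R a + (v/D) *\<^sub>R b + (w/D) *\<^sub>R c"
    using D by (simp add: scaleR_add_right)
  moreover have "u/D + v/D + w/D = 1" using s D by (simp flip: add_divide_distrib)
  moreover have "u/D \<ge> 0" "v/D \<ge> 0" "w/D \<ge> 0"
    using D x by (auto simp: u_def v_def w_def)
  ultimately show ?thesis unfolding convex_hull_3 by blast
qed

lemma convex_side_ge: "convex {x. side V i x \<ge> 0}"
proof -
  have "{x. side V i x \<ge> 0} = {x. vector [- (V (i+1) - V i)$2, (V (i+1) - V i)$1] \<bullet> x
      \<ge> - ((V (i+1) - V i)$2 * V i$1 - (V (i+1) - V i)$1 * V i$2)}"
    unfolding side_eq by auto
  then show ?thesis by (simp only: convex_halfspace_ge)
qed

lemma cell_side: "convex_quad V \<Longrightarrow> x \<in> cell V \<Longrightarrow> side V i x \<ge> 0"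
proof -
  assume V: "convex_quad V" and x: "x \<in> cell V"
  have "cell V \<subseteq> {x. side V i x \<ge> 0}"
    unfolding cell_def
    by (rule hull_minimal) (use V in \<open>auto simp: side_nonneg convex_side_ge\<close>)
  then show ?thesis using x by auto
qed

lemma range_quad: "range V = {V 1, V 2, V 3, V (4::4)}"
  by (simp add: UNIV_4)

text \<open>A point on the inner side of all four edges lies on one side of the diagonal from
  \<open>V 1\<close> to \<open>V 3\<close>, hence in the triangle there. The triangles serve to
  compute the area, the half-planes to find interior points.\<close>

lemma cell_eq_Un_triangles:
  assumes V: "convex_quad V"
  shows "cell V = convex hull {V 1, V 2, V 3} \<union> convex hull {V 1, V 3, V 4}" (is "_ = ?R")
    and "cell V = {x. \<forall>i. side V i x \<ge> 0}"
proof -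
  have 1: "cell V \<subseteq> {x. \<forall>i. side V i x \<ge> 0}" using cell_side[OF V] by auto
  have 2: "{x. \<forall>i. side V i x \<ge> 0} \<subseteq> ?R"
  proof
    fix x assume "x \<in> {x. \<forall>i. side V i x \<ge> 0}"
    then have s: "side V 1 x \<ge> 0" "side V 2 x \<ge> 0" "side V 3 x \<ge> 0" "side V 4 x \<ge> 0" by auto
    have p: "side V 1 (V 3) > 0" "side V 3 (V 1) > 0"
      using side_pos[OF V, of 1] side_pos[OF V, of 3] by auto
    consider "cross2 (V 1 - V 3) (x - V 3) \<ge> 0" | "cross2 (V 3 - V 1) (x - V 1) \<ge> 0"
      by (fastforce simp: cross2_def algebra_simps)
    then show "x \<in> ?R"
    proof cases
      case 1
      then have "x \<in> convex hull {V 1, V 2, V 3}"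
        using s p by (intro triangle_hull) (auto simp: side_def)
      then show ?thesis ..
    next
      case 2
      then have "x \<in> convex hull {V 1, V 3, V 4}"
        using s p by (intro triangle_hull) (auto simp: side_def cross2_def algebra_simps)
      then show ?thesis ..
    qed
  qed
  have 3: "?R \<subseteq> cell V"
    unfolding cell_def range_quad by (intro Un_least hull_mono) auto
  show "cell V = ?R" "cell V = {x. \<forall>i. side V i x \<ge> 0}" using 1 2 3 by blast+
qed

lemma cell_convex [simp]: "convex (cell V)" and cell_compact [simp]: "compact (cell V)"
  and cell_closed [simp]: "closed (cell V)" and cell_bounded [simp]: "bounded (cell V)"
proof -
  show c: "compact (cell V)" unfolding cell_def by (simp add: finite_imp_compact_convex_hull)
  show "convex (cell V)" by (simp add: cell_def)
  show "closed (cell V)" "bounded (cell V)" using c compact_imp_closed compact_imp_bounded by auto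
qed

lemma vertex_in_cell [simp]: "V i \<in> cell V"
  by (simp add: cell_def hull_inc)

lemma edge_subset_cell: "edge V i \<subseteq> cell V"
  unfolding edge_def by (rule closed_segment_subset) auto

lemma interior_cellI:
  assumes V: "convex_quad V" and x: "\<And>i. side V i x > 0" shows "x \<in> interior (cell V)"
proof -
  have "open {x. \<forall>i. side V i x > 0}"
  proof -
    have "{x. \<forall>i. side V i x > 0} = (\<Inter>i. {x. 0 < side V i x})" by auto
    moreover have "open (\<Inter>i. {x. 0 < side V i x})"
      by (intro open_INT ballI open_Collect_less continuous_on_const continuous_on_side) auto
    ultimately show ?thesis by simp
  qed
  moreover have "{x. \<forall>i. side V i x > 0} \<subseteq> cell V"
    unfolding cell_eq_Un_triangles(2)[OF V] by (auto simp: less_imp_le)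
  ultimately show ?thesis using x by (auto intro!: interiorI)
qed

text \<open>The mean of the vertices, written with nested midpoints so that
  \<open>side_affine\<close>, which handles two points, evaluates the side functions there.\<close>

definition centre :: "quad \<Rightarrow> real^2" where
  "centre V = (1/2) *\<^sub>R ((1/2) *\<^sub>R V 1 + (1/2) *\<^sub>R V 2) + (1/2) *\<^sub>R ((1/2) *\<^sub>R V 3 + (1/2) *\<^sub>R V 4)"

lemma centre_in_interior:
  assumes V: "convex_quad V" shows "centre V \<in> interior (cell V)"
proof (rule interior_cellI[OF V])
  fix i
  have "side V i (centre V) = (side V i (V 1) + side V i (V 2) + side V i (V 3) + side V i (V 4)) / 4"
    unfolding centre_def by (simp add: side_affine add_divide_distrib)
  moreover have "side V i (V 1) \<ge> 0" "side V i (V 2) \<ge> 0" "side V i (V 3) \<ge> 0" "side V i (V 4) \<ge> 0"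
    using side_nonneg[OF V] by auto
  moreover have "side V i (V 1) > 0 \<or> side V i (V 2) > 0 \<or> side V i (V 3) > 0 \<or> side V i (V 4) > 0"
    using side_pos[OF V, of i] exhaust_4[of "i+2"] by metis
  ultimately show "side V i (centre V) > 0" by argo
qed

lemma interior_cell_nonempty: "convex_quad V \<Longrightarrow> interior (cell V) \<noteq> {}"
  using centre_in_interior by blast

lemma edge_side0: "x \<in> edge V i \<Longrightarrow> side V i x = 0"
  unfolding edge_def in_segment by (auto simp: side_affine)

lemma open_edge_side_pos:
  assumes V: "convex_quad V" and x: "x \<in> open_segment (V i) (V (i+1))" and j: "j \<noteq> i"
  shows "side V j x > 0"
proof -
  obtain t where t: "0 < t" "t < 1" "x = (1 - t) *\<^sub>R V i + t *\<^sub>R V (i+1)"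
    using x unfolding in_segment by auto
  have s: "side V j x = (1 - t) * side V j (V i) + t * side V j (V (i+1))"
    unfolding t(3) by (simp add: side_affine)
  have "side V j (V i) > 0 \<or> side V j (V (i+1)) > 0"
  proof (cases "i = j + 1")
    case True
    then show ?thesis using side_pos[OF V, of j] by (simp add: index4_shift)
  next
    case False
    then show ?thesis using side_pos'[OF V, of i j] j by auto
  qed
  moreover have "side V j (V i) \<ge> 0" "side V j (V (i+1)) \<ge> 0" using side_nonneg[OF V] by auto
  ultimately show ?thesis unfolding s using t(1,2)
    by (smt (verit, best) mult_nonneg_nonneg mult_pos_pos)
qed

lemma open_edge_unique:
  assumes "convex_quad V" "x \<in> open_segment (V i) (V (i+1))" "x \<in> edge V j" shows "j = i"
  using open_edge_side_pos[OF assms(1,2), of j] edge_side0[OF assms(3)] by force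

lemma open_edge_not_vertex:
  assumes "convex_quad V" "x \<in> open_segment (V i) (V (i+1))" shows "x \<noteq> V k"
proof
  assume "x = V k"
  then have "x \<in> edge V k" "x \<in> edge V (k + 3)" by (auto simp: edge_def index4_shift)
  from open_edge_unique[OF assms this(1)] open_edge_unique[OF assms this(2)]
  have "k = i" "k + 3 = i" by simp_all
  then show False using index4_shift(10)[of k] by auto
qed

text \<open>The three other side functions are positive at an inner point of the edge and stay so
  nearby; close to such a point the cell is therefore a half disc.\<close>

lemma near_open_edge:
  assumes V: "convex_quad V" and x: "x \<in> open_segment (V i) (V (i+1))"
  shows "\<exists>e>0. \<forall>y\<in>ball x e. side V i y \<ge> 0 \<longrightarrow> y \<in> cell V"
proof -
  let ?S = "\<Inter>j\<in>-{i}. {y. 0 < side V j y}"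
  have "open ?S"
    by (intro open_INT ballI open_Collect_less continuous_on_const continuous_on_side) auto
  moreover have "x \<in> ?S" using open_edge_side_pos[OF V x] by auto
  ultimately obtain e where e: "e > 0" "ball x e \<subseteq> ?S" unfolding open_contains_ball by blast
  have "y \<in> cell V" if y: "y \<in> ball x e" and s: "side V i y \<ge> 0" for y
  proof -
    have "\<forall>j. j \<noteq> i \<longrightarrow> side V j y > 0" using e(2) y by auto
    then have "\<forall>j. side V j y \<ge> 0" using s by (metis less_imp_le)
    then show ?thesis unfolding cell_eq_Un_triangles(2)[OF V] by simp
  qed
  with e(1) show ?thesis by blast
qed

lemma edge_mid_in_open_edge:
  "convex_quad V \<Longrightarrow> edge_mid V i \<in> open_segment (V i) (V (i+1))"
  unfolding edge_mid_def using inj_convex_quad[of V] index4_shift(8)[of i]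
  by (auto simp: midpoint_in_open_segment inj_eq)

lemma dist_pos: "convex_quad V \<Longrightarrow> dist (V i) (V (i+1)) > 0"
  using inj_convex_quad[of V] index4_shift(8)[of i] by (auto simp: inj_eq)

section \<open>Area of a cell and its outward normals\<close>

lemma measure_triangle:
  assumes "cross2 (b - a) (c - a) \<ge> 0"
  shows "measure lebesgue (convex hull {a, b, c :: real^2}) = cross2 (b - a) (c - a) / 2"
proof -
  have "closed (convex hull {a, b, c})"
    by (simp add: finite_imp_compact_convex_hull compact_imp_closed)
  then have "measure lebesgue (convex hull {a, b, c}) = measure lborel (convex hull {a, b, c})"
    by (simp add: measure_completion)
  also have "\<dots> = cross2 (b - a) (c - a) / 2"
    unfolding content_triangle using assms by (simp add: cross2_def abs_if algebra_simps)
  finally show ?thesis .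
qed

text \<open>The shoelace formula, from the two triangles on either side of a diagonal, whose overlap
  lies on a line. The cyclic form is the one in which the fluxes of an affine field add up in
  \<open>VK_divergence\<close>.\<close>

lemma measure_cell:
  assumes V: "convex_quad V"
  shows "measure lebesgue (cell V) = (\<Sum>i\<in>UNIV. cross2 (V i) (V (i+1))) / 2"
proof -
  let ?S = "convex hull {V 1, V 2, V 3}" and ?T = "convex hull {V 1, V 3, V 4}"
  let ?h = "\<lambda>x. cross2 (V 3 - V 1) (x - V 1)"
  have p: "side V 1 (V 3) > 0" "side V 3 (V 1) > 0"
    using side_pos[OF V, of 1] side_pos[OF V, of 3] by auto
  have h: "?h x = vector [- (V 3 - V 1)$2, (V 3 - V 1)$1] \<bullet> x
    - vector [- (V 3 - V 1)$2, (V 3 - V 1)$1] \<bullet> V 1" for x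
    by (simp add: cross2_inner inner_diff_right)
  have "?S \<subseteq> {x. ?h x \<le> 0}"
  proof (rule hull_minimal)
    show "convex {x. ?h x \<le> 0}" unfolding h by (simp add: convex_halfspace_le)
    show "{V 1, V 2, V 3} \<subseteq> {x. ?h x \<le> 0}"
      using p(1) by (auto simp: side_def cross2_def algebra_simps)
  qed
  moreover have "?T \<subseteq> {x. ?h x \<ge> 0}"
  proof (rule hull_minimal)
    show "convex {x. ?h x \<ge> 0}" unfolding h by (simp add: convex_halfspace_ge)
    show "{V 1, V 3, V 4} \<subseteq> {x. ?h x \<ge> 0}"
      using p(2) by (auto simp: side_def cross2_def algebra_simps)
  qed
  ultimately have sub: "?S \<inter> ?T \<subseteq> {x. ?h x = 0}" by force
  have ne: "vector [- (V 3 - V 1)$2, (V 3 - V 1)$1] \<noteq> (0::real^2)"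
    using p by (auto simp: vec2_eq_iff side_def cross2_def)
  have "negligible {x. ?h x = 0}"
    unfolding h using ne by (simp add: negligible_hyperplane)
  then have neg: "negligible (?S \<inter> ?T)" using sub negligible_subset by blast
  have lm: "?S \<in> lmeasurable" "?T \<in> lmeasurable"
    by (auto intro!: lmeasurable_compact simp: finite_imp_compact_convex_hull)
  have "measure lebesgue (?S \<union> ?T) = measure lebesgue ?S + measure lebesgue ?T"
    using measure_Un3[OF lm] negligible_imp_measure0[OF neg] by simp
  also have "measure lebesgue ?S = cross2 (V 2 - V 1) (V 3 - V 1) / 2"
    using p by (intro measure_triangle) (auto simp: side_def)
  also have "measure lebesgue ?T = cross2 (V 3 - V 1) (V 4 - V 1) / 2"
    using p by (intro measure_triangle) (auto simp: side_def cross2_def algebra_simps)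
  finally show ?thesis unfolding cell_eq_Un_triangles(1)[OF V]
    by (simp add: sum_4 cross2_def algebra_simps add_divide_distrib diff_divide_distrib)
qed

lemma norm_1_vec2: "norm (v :: real^2) = 1 \<Longrightarrow> v$1 * v$1 + v$2 * v$2 = 1"
  using power2_norm_eq_inner[of v] by (simp add: inner_vec_def sum_2)

lemma unit_normal_cases:
  assumes V: "convex_quad V" and n: "norm n = 1" "n \<bullet> (V (i+1) - V i) = 0"
  shows "n = edge_normal V i \<or> n = - edge_normal V i"
proof -
  define t where "t = edge_tangent V i"
  have d: "dist (V i) (V (i+1)) > 0" by (rule dist_pos[OF V])
  have "norm t = 1" using d by (simp add: t_def edge_tangent_def dist_norm norm_minus_commute)
  then have t1: "t$1 * t$1 + t$2 * t$2 = 1" by (rule norm_1_vec2)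
  have n1: "n$1 * n$1 + n$2 * n$2 = 1" using n(1) by (rule norm_1_vec2)
  have nt: "n$1 * t$1 + n$2 * t$2 = 0"
  proof -
    have "n \<bullet> t = 0" using n(2) by (simp add: t_def edge_tangent_def)
    then show ?thesis by (simp add: inner_vec_def sum_2)
  qed
  \<comment> \<open>The component of \<open>n\<close> along \<open>edge_normal V i\<close>; since
    \<open>n\<close> is a unit vector orthogonal to \<open>t\<close>, it is 1 or -1.\<close>
  define k where "k = n$1 * t$2 - n$2 * t$1"
  have a: "n$1 = k * t$2" using t1 nt unfolding k_def by algebra
  have b: "n$2 = - k * t$1" using t1 nt unfolding k_def by algebra
  have "k * k = 1" using t1 n1 nt unfolding k_def by algebra
  then have "k = 1 \<or> k = -1" by (simp add: square_eq_1_iff)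
  then show ?thesis using a b by (auto simp: vec2_eq_iff edge_normal_def t_def)
qed

lemma edge_normal_inner: "edge_normal V i \<bullet> (x - V i) = - side V i x / dist (V i) (V (i+1))"
  by (simp add: edge_normal_def edge_tangent_def side_def cross2_def inner_vec_def sum_2
      divide_simps)

text \<open>With counterclockwise labels \<open>edge_normal\<close> points outwards. The vertex
  \<open>V (i+2)\<close> lies strictly inside and refutes the reversed normal.\<close>

lemma behind_edge_normal:
  assumes V: "convex_quad V"
  shows "behind (edge_normal V i) (edge V i) V" "\<not> behind (- edge_normal V i) (edge V i) V"
proof -
  have d: "dist (V i) (V (i+1)) > 0" by (rule dist_pos[OF V])
  have "edge_normal V i \<bullet> (x - y) \<le> 0" if "x \<in> cell V" "y \<in> edge V i" for x y
  proof -
    have "edge_normal V i \<bullet> (x - y) = edge_normal V i \<bullet> (x - V i) - edge_normal V i \<bullet> (y - V i)"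
      by (simp add: inner_diff_right)
    also have "\<dots> = - side V i x / dist (V i) (V (i+1))"
      using edge_side0[OF that(2)] by (simp add: edge_normal_inner)
    also have "\<dots> \<le> 0" using cell_side[OF V that(1), of i] d by simp
    finally show ?thesis .
  qed
  then show "behind (edge_normal V i) (edge V i) V" by (auto simp: behind_def)
  show "\<not> behind (- edge_normal V i) (edge V i) V"
  proof
    assume "behind (- edge_normal V i) (edge V i) V"
    moreover have "V (i+2) \<in> cell V" "V i \<in> edge V i" by (auto simp: edge_def)
    ultimately have "- edge_normal V i \<bullet> (V (i+2) - V i) \<le> 0" unfolding behind_def by blast
    then have "side V i (V (i+2)) / dist (V i) (V (i+1)) \<le> 0" by (simp add: edge_normal_inner)
    then show False using side_pos(1)[OF V, of i] d by (simp add: divide_le_0_iff)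
  qed
qed

section \<open>Potentials of circulations as winding sums\<close>

lemma interior_cell_side:
  assumes V: "convex_quad V" shows "interior (cell V) \<subseteq> {x. side V i x > 0}"
proof -
  let ?n = "vector [- (V (i+1) - V i)$2, (V (i+1) - V i)$1] :: real^2"
  let ?c = "(V (i+1) - V i)$2 * V i$1 - (V (i+1) - V i)$1 * V i$2"
  have "?n \<noteq> 0" using dist_pos[OF V, of i] by (auto simp: vec2_eq_iff)
  then have "interior {x. ?n \<bullet> x \<ge> - ?c} = {x. ?n \<bullet> x > - ?c}"
    by (rule interior_halfspace_ge)
  moreover have "cell V \<subseteq> {x. ?n \<bullet> x \<ge> - ?c}"
    using cell_side[OF V, of _ i] unfolding side_eq by fastforce
  ultimately have "interior (cell V) \<subseteq> {x. ?n \<bullet> x > - ?c}" using interior_mono by metis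
  then show ?thesis unfolding side_eq by auto
qed

definition cpx :: "real^2 \<Rightarrow> complex" where "cpx x = Complex (x$1) (x$2)"

lemma cpx_simps: "Re (cpx x) = x$1" "Im (cpx x) = x$2"
  "cpx (x + y) = cpx x + cpx y" "cpx (x - y) = cpx x - cpx y" "cpx (r *\<^sub>R x) = r *\<^sub>R cpx x"
  "cpx x = cpx y \<longleftrightarrow> x = y"
  by (auto simp: cpx_def complex_eq_iff vec2_eq_iff)

lemma continuous_on_cpx [continuous_intros]: "continuous_on S cpx"
  unfolding cpx_def[abs_def] Complex_eq by (intro continuous_intros)

text \<open>If \<open>a\<close> is not on the segment from \<open>s\<close> to \<open>t\<close>, the ratio never meets the negative real axis as
  \<open>t\<close> runs along the segment, so the principal value is the change of argument around \<open>a\<close>.\<close>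

definition angle_change :: "real^2 \<Rightarrow> real^2 \<Rightarrow> real^2 \<Rightarrow> real" where
  "angle_change a s t = Im (Ln ((cpx t - cpx a) / (cpx s - cpx a)))"

text \<open>The values of \<open>g\<close> lie in the discrete set of integer multiples of 2 \<pi>
  i. Applied to a difference of logarithms with equal exponentials, this says that two continuous
  branches on a connected set differ by a constant.\<close>

lemma continuous_log_1_constant:
  fixes g :: "'a::topological_space \<Rightarrow> complex"
  assumes "connected S" "continuous_on S g" "\<And>x. x \<in> S \<Longrightarrow> exp (g x) = 1" "s \<in> S" "t \<in> S"
  shows "g s = g t"
proof -
  have "g constant_on S"
  proof (rule continuous_discrete_range_constant[OF assms(1,2)])
    fix x assume x: "x \<in> S"
    have "2 * pi \<le> norm (g y - g x)" if y: "y \<in> S" "g y \<noteq> g x" for y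
    proof -
      have "exp (g y - g x) = 1" using assms(3) x y by (simp add: exp_diff)
      then obtain n :: int where n: "Re (g y - g x) = 0" "Im (g y - g x) = of_int (2 * n) * pi"
        unfolding exp_eq_1 by blast
      have "n \<noteq> 0"
      proof
        assume "n = 0"
        then have "g y - g x = 0" using n by (simp add: complex_eq_iff)
        then show False using y(2) by simp
      qed
      then have "1 \<le> \<bar>real_of_int n\<bar>" by linarith
      then have "2 * pi \<le> \<bar>Im (g y - g x)\<bar>" unfolding n(2) by (simp add: abs_mult)
      then show ?thesis using abs_Im_le_cmod order_trans by blast
    qed
    then show "\<exists>e>0. \<forall>y. y \<in> S \<and> g y \<noteq> g x \<longrightarrow> e \<le> norm (g y - g x)"
      by (intro exI[of _ "2 * pi"]) auto
  qed
  then show ?thesis using assms(4,5) unfolding constant_on_def by metis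
qed

text \<open>A ratio r \<le> 0 would make \<open>a\<close> the convex combination of \<open>x\<close>
  and \<open>s\<close> with weights 1/(1-r) and -r/(1-r).\<close>

lemma ratio_not_nonpos:
  assumes "a \<notin> closed_segment x s"
  shows "(cpx x - cpx a) / (cpx s - cpx a) \<notin> \<real>\<^sub>\<le>\<^sub>0"
proof
  assume "(cpx x - cpx a) / (cpx s - cpx a) \<in> \<real>\<^sub>\<le>\<^sub>0"
  then obtain r where r: "r \<le> 0" "(cpx x - cpx a) / (cpx s - cpx a) = of_real r"
    by (auto elim: nonpos_Reals_cases)
  have "s \<noteq> a" using assms by auto
  then have "cpx s - cpx a \<noteq> 0" by (simp add: cpx_simps)
  then have "cpx x - cpx a = r *\<^sub>R (cpx s - cpx a)"
    using r(2) by (simp add: divide_eq_eq scaleR_conv_of_real)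
  then have "cpx (x - a) = cpx (r *\<^sub>R (s - a))" by (simp add: cpx_simps)
  then have "x - a = r *\<^sub>R (s - a)" using cpx_simps(6) by blast
  then have "(1 - r) *\<^sub>R a = x - r *\<^sub>R s" by (simp add: algebra_simps)
  then have "(1 / (1 - r)) *\<^sub>R ((1 - r) *\<^sub>R a) = (1 / (1 - r)) *\<^sub>R (x - r *\<^sub>R s)" by simp
  then have "a = (1 - (- r / (1 - r))) *\<^sub>R x + (- r / (1 - r)) *\<^sub>R s"
    using r(1) by (simp add: scaleR_diff_right divide_simps)
  moreover have "0 \<le> - r / (1 - r)" "- r / (1 - r) \<le> 1" using r(1) by (auto simp: divide_simps)
  ultimately have "a \<in> closed_segment x s" unfolding in_segment by blast
  then show False using assms by blast
qed

lemma segment_not_nonpos: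
  assumes "a \<notin> closed_segment s t" "x \<in> closed_segment s t"
  shows "(cpx x - cpx a) / (cpx s - cpx a) \<notin> \<real>\<^sub>\<le>\<^sub>0"
  using assms by (intro ratio_not_nonpos) (meson closed_segment_subset convex_closed_segment
      ends_in_segment(1) subsetD)

lemma continuous_on_ratio_log:
  assumes a: "a \<notin> closed_segment s t"
  shows "continuous_on (closed_segment s t) (\<lambda>x. Ln ((cpx x - cpx a) / (cpx s - cpx a)))"
proof -
  have "cpx s - cpx a \<noteq> 0" using a by (auto simp: cpx_simps)
  then show ?thesis
    using segment_not_nonpos[OF a] by (intro continuous_intros) auto
qed

lemma exp_ratio_log:
  assumes a: "a \<notin> closed_segment s t" and x: "x \<in> closed_segment s t"
  shows "exp (Ln ((cpx x - cpx a) / (cpx s - cpx a))) = (cpx x - cpx a) / (cpx s - cpx a)"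
proof -
  have "x \<noteq> a" "s \<noteq> a" using a x by auto
  then show ?thesis by (simp add: cpx_simps)
qed

text \<open>Along the segment \<open>P x - P s\<close> and the principal logarithm of the ratio are
  continuous, have the same exponential and both vanish at \<open>s\<close>. So any continuous
  branch of the logarithm measures the change of argument.\<close>

lemma angle_change_eq_log:
  assumes P: "continuous_on (closed_segment s t) P"
    and e: "\<And>x. x \<in> closed_segment s t \<Longrightarrow> exp (P x) = cpx x - cpx a"
  shows "angle_change a s t = Im (P t) - Im (P s)"
proof -
  have a: "a \<notin> closed_segment s t" using e[of a] by auto
  have sa: "s \<noteq> a" using a by auto
  define g where "g x = P x - P s - Ln ((cpx x - cpx a) / (cpx s - cpx a))" for x
  have "g s = g t"
  proof (rule continuous_log_1_constant[of "closed_segment s t"])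
    show "continuous_on (closed_segment s t) g"
      unfolding g_def by (intro continuous_intros P continuous_on_ratio_log a)
    fix x assume x: "x \<in> closed_segment s t"
    have "x \<noteq> a" using x a by auto
    then show "exp (g x) = 1"
      using e[OF x] e[of s] sa unfolding g_def
      by (simp add: exp_diff exp_ratio_log[OF a x] cpx_simps)
  qed (auto)
  then have "P t - P s = Ln ((cpx t - cpx a) / (cpx s - cpx a))"
    using sa by (simp add: g_def cpx_simps)
  then show ?thesis unfolding angle_change_def by (metis minus_complex.simps(2))
qed

text \<open>Continuous off the segment from \<open>a\<close> to \<open>b\<close>, with a jump of \<open>2\<pi>\<close> across it.\<close>

definition seg_arg :: "real^2 \<Rightarrow> real^2 \<Rightarrow> real^2 \<Rightarrow> real" where
  "seg_arg a b x = Im (Ln ((cpx x - cpx b) / (cpx x - cpx a)))"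

text \<open>Away from the cut between \<open>a\<close> and \<open>b\<close>,
  \<open>seg_arg a b\<close> is a continuous choice of arg(x - b) - arg(x - a), so its increment is
  the difference of the two angle changes.\<close>

lemma angle_change_off_segment:
  assumes d: "closed_segment s t \<inter> closed_segment a b = {}"
  shows "angle_change b s t - angle_change a s t = seg_arg a b t - seg_arg a b s"
proof -
  have a: "a \<notin> closed_segment s t" and b: "b \<notin> closed_segment s t" using d by auto
  define Q where "Q x = Ln ((cpx x - cpx b) / (cpx x - cpx a))" for x
  have ne: "x \<noteq> a" "x \<noteq> b" if "x \<in> closed_segment s t" for x using a b that by auto
  have np: "(cpx x - cpx b) / (cpx x - cpx a) \<notin> \<real>\<^sub>\<le>\<^sub>0" if "x \<in> closed_segment s t" for x
  proof -
    have "(cpx b - cpx x) / (cpx a - cpx x) \<notin> \<real>\<^sub>\<le>\<^sub>0"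
      by (rule ratio_not_nonpos) (use d that in \<open>auto simp: closed_segment_commute\<close>)
    then show ?thesis by (metis minus_diff_eq minus_divide_divide)
  qed
  have Q: "continuous_on (closed_segment s t) Q"
    unfolding Q_def using np ne by (intro continuous_intros) (auto simp: cpx_simps)
  define g where "g x = Q x - Q s - Ln ((cpx x - cpx b) / (cpx s - cpx b))
      + Ln ((cpx x - cpx a) / (cpx s - cpx a))" for x
  have sab: "s \<noteq> a" "s \<noteq> b" using a b by auto
  have "g s = g t"
  proof (rule continuous_log_1_constant[of "closed_segment s t"])
    show "continuous_on (closed_segment s t) g"
      unfolding g_def by (intro continuous_intros Q continuous_on_ratio_log a b)
    fix x assume x: "x \<in> closed_segment s t"
    have "exp (Q y) = (cpx y - cpx b) / (cpx y - cpx a)" if "y \<in> closed_segment s t" for y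
      unfolding Q_def using ne[OF that] by (simp add: cpx_simps)
    then show "exp (g x) = 1"
      using x ne[OF x] sab unfolding g_def
      by (simp add: exp_diff exp_add exp_ratio_log[OF a x] exp_ratio_log[OF b x] cpx_simps)
  qed auto
  then have "Q t - Q s = Ln ((cpx t - cpx b) / (cpx s - cpx b)) - Ln ((cpx t - cpx a) / (cpx s - cpx a))"
    using sab by (simp add: g_def cpx_simps algebra_simps)
  then have "Im (Q t) - Im (Q s) = Im (Ln ((cpx t - cpx b) / (cpx s - cpx b)))
      - Im (Ln ((cpx t - cpx a) / (cpx s - cpx a)))" by (metis minus_complex.simps(2))
  then show ?thesis by (simp add: angle_change_def seg_arg_def Q_def)
qed

lemma Im_divide_pos: "Im (z * cnj w) > 0 \<Longrightarrow> Im (z / w) > 0"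
proof -
  assume *: "Im (z * cnj w) > 0"
  then have "w \<noteq> 0" by auto
  then have "(cmod w)\<^sup>2 > 0" by simp
  then have "Im (z * cnj w) / (cmod w)\<^sup>2 > 0" using * by simp
  then show ?thesis unfolding complex_div_cnj[of z w] by (simp add: Im_divide_of_real flip: of_real_power)
qed

text \<open>A dual segment towards the edge itself ends on the cut, where the argument for segments
  off the cut breaks down. Instead the three angles involved are compared directly: the quotients
  \<open>p\<close>, \<open>q\<close>, \<open>h\<close> lie in the upper half plane and have product
  -1.\<close>

lemma angle_change_midpoint_left:
  assumes c: "cross2 (b - a) (c - a) > 0"
  shows "angle_change b c (midpoint a b) - angle_change a c (midpoint a b) = pi - seg_arg a b c"
proof -
  let ?m = "midpoint a b"
  define p q h where "p = (cpx ?m - cpx b) / (cpx c - cpx b)" and "q = (cpx c - cpx a) / (cpx ?m - cpx a)"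
    and "h = (cpx c - cpx b) / (cpx c - cpx a)"
  have m: "?m$1 = (a$1 + b$1)/2" "?m$2 = (a$2 + b$2)/2" by (simp_all add: midpoint_def)
  have p: "Im p > 0" unfolding p_def
    by (rule Im_divide_pos) (use c in \<open>simp add: cpx_def m cross2_def field_simps\<close>)
  have q: "Im q > 0" unfolding q_def
    by (rule Im_divide_pos) (use c in \<open>simp add: cpx_def m cross2_def field_simps\<close>)
  have h: "Im h > 0" unfolding h_def
    by (rule Im_divide_pos) (use c in \<open>simp add: cpx_def m cross2_def field_simps\<close>)
  have ne: "c \<noteq> a" "c \<noteq> b" "a \<noteq> b" using c by (auto simp: cross2_def)
  then have ne': "cpx ?m - cpx a \<noteq> 0" "cpx c - cpx a \<noteq> 0" "cpx c - cpx b \<noteq> 0"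
    by (auto simp: cpx_simps)
  have mm: "cpx ?m - cpx b = - (cpx ?m - cpx a)"
    by (simp add: complex_eq_iff cpx_simps m field_simps)
  have "- M / B * (C / M) * (B / C) = -1" if "M \<noteq> 0" "C \<noteq> 0" "B \<noteq> 0" for M B C :: complex
    using that by simp
  from this[OF ne'] have pqh: "p * q * h = -1" unfolding p_def q_def h_def mm .
  have nz: "p \<noteq> 0" "q \<noteq> 0" "h \<noteq> 0" using p q h by auto
  have "exp (Ln p + Ln q + Ln h) = -1" using nz pqh by (simp add: exp_add)
  then have e: "exp (Ln p + Ln q + Ln h) = exp (\<i> * pi)" by simp
  then obtain n :: int where n: "Ln p + Ln q + Ln h = \<i> * complex_of_real pi + complex_of_real (real_of_int (2 * n) * pi) * \<i>"
    unfolding exp_eq by blast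
  from arg_cong[OF n, of Im] have im: "Im (Ln p) + Im (Ln q) + Im (Ln h) = pi + 2 * n * pi" by simp
  have bd: "0 < Im (Ln p)" "Im (Ln p) < pi" "0 < Im (Ln q)" "Im (Ln q) < pi" "0 < Im (Ln h)" "Im (Ln h) < pi"
    using Im_Ln_pos_lt_imp p q h by auto
  \<comment> \<open>Three angles strictly between 0 and \<pi> add up to an odd multiple of \<pi>
    below 3 \<pi>, which can only be \<pi>.\<close>
  have "n = 0"
  proof -
    have "(1 + 2 * real_of_int n) * pi = Im (Ln p) + Im (Ln q) + Im (Ln h)"
      using im by (simp add: algebra_simps)
    then have "0 * pi < (1 + 2 * real_of_int n) * pi" "(1 + 2 * real_of_int n) * pi < 3 * pi"
      using bd by linarith+
    then have "1 + 2 * real_of_int n > 0" "1 + 2 * real_of_int n < 3"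
      using pi_gt_zero by (simp_all only: mult_less_cancel_right_pos)
    then show ?thesis by linarith
  qed
  then have im': "Im (Ln p) + Im (Ln q) + Im (Ln h) = pi" using im by simp
  have "angle_change b c ?m = Im (Ln p)" by (simp add: angle_change_def p_def)
  moreover have "angle_change a c ?m = Im (Ln (inverse q))"
    by (simp add: angle_change_def q_def)
  moreover have "Ln (inverse q) = - Ln q"
    by (rule Ln_inverse) (use q in \<open>auto simp: complex_nonpos_Reals_iff\<close>)
  moreover have "seg_arg a b c = Im (Ln h)" by (simp add: seg_arg_def h_def)
  ultimately show ?thesis using im' by simp
qed

text \<open>Exchanging \<open>a\<close> and \<open>b\<close> turns right into left and changes the
  sign of \<open>seg_arg\<close>. Compared with the left side the result is short by a full turn;
  this is the jump that the potential picks up.\<close>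

lemma angle_change_midpoint_right:
  assumes c: "cross2 (b - a) (c - a) < 0"
  shows "angle_change b c (midpoint a b) - angle_change a c (midpoint a b) = - pi - seg_arg a b c"
proof -
  have c': "cross2 (a - b) (c - b) > 0" using c by (simp add: cross2_def algebra_simps)
  have "seg_arg b a c = - seg_arg a b c"
  proof -
    let ?z = "(cpx c - cpx a) / (cpx c - cpx b)"
    have "Im ?z > 0"
      by (rule Im_divide_pos) (use c in \<open>simp add: cpx_def cross2_def field_simps\<close>)
    then have "Ln (inverse ?z) = - Ln ?z"
      by (intro Ln_inverse) (auto simp: complex_nonpos_Reals_iff)
    then show ?thesis by (simp add: seg_arg_def)
  qed
  then show ?thesis using angle_change_midpoint_left[OF c'] by (simp add: midpoint_sym)
qed

text \<open>On the cut the quotient is negative real, here -1, and the principal branch assigns it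
  the limit from the left side. So the whole jump of 2 \<pi> is charged to the cell on the right of
  the edge.\<close>

lemma seg_arg_midpoint: "a \<noteq> b \<Longrightarrow> seg_arg a b (midpoint a b) = pi"
proof -
  assume ab: "a \<noteq> b"
  have "cpx (midpoint a b) - cpx b = - (cpx (midpoint a b) - cpx a)"
    by (simp add: complex_eq_iff cpx_simps midpoint_def field_simps)
  moreover have "cpx (midpoint a b) - cpx a \<noteq> 0" using ab by (simp add: cpx_simps)
  ultimately have "(cpx (midpoint a b) - cpx b) / (cpx (midpoint a b) - cpx a) = -1"
    by (metis divide_self minus_divide_left)
  then show ?thesis by (simp add: seg_arg_def)
qed

section \<open>Circulations and the winding potential\<close>

lemma edge_eq_iff: "edge K i = edge K' j \<longleftrightarrow> {K i, K (i+1)} = {K' j, K' (j+1)}"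
  by (simp add: edge_def)

lemma edge_mid_cong: "edge K i = edge K' j \<Longrightarrow> edge_mid K i = edge_mid K' j"
  unfolding edge_eq_iff edge_mid_def by (auto simp: doubleton_eq_iff midpoint_sym)

lemma edge_subset_open: "open_segment (V i) (V (i+1)) \<subseteq> edge V i"
  by (simp add: edge_def open_segment_def)

lemma edge_inj: "convex_quad K \<Longrightarrow> edge K i = edge K j \<Longrightarrow> i = j"
  using open_edge_unique edge_mid_in_open_edge edge_subset_open by blast

text \<open>\<open>f K i\<close> is the flux out of the cell \<open>K\<close> through its \<open>i\<close>-th edge.\<close>

definition circulation :: "quad set \<Rightarrow> (quad \<Rightarrow> 4 \<Rightarrow> real) \<Rightarrow> bool" where
  "circulation T f \<longleftrightarrow> (\<forall>K\<in>T. (\<Sum>i\<in>UNIV. f K i) = 0) \<and>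
     (\<forall>E\<in>mesh_edges T. (\<Sum>(K, i) | K \<in> T \<and> edge K i = E. f K i) = 0)"

text \<open>Grouping the double sum by edges leaves, for each edge, the value of \<open>h\<close> at
  its midpoint times a balanced sum. The midpoint depends only on the edge as a set, so neighbouring
  cells agree on it.\<close>

lemma sum_balanced_edges:
  assumes fin: "finite T"
    and bal: "\<forall>E\<in>mesh_edges T. (\<Sum>(K, i) | K \<in> T \<and> edge K i = E. f K i) = (0::real)"
  shows "(\<Sum>K\<in>T. \<Sum>i\<in>UNIV. f K i * h (edge_mid K i)) = 0"
proof -
  let ?D = "T \<times> (UNIV :: 4 set)" and ?e = "\<lambda>(K, i). edge K i"
  have fD: "finite ?D" using fin by simp
  have "(\<Sum>K\<in>T. \<Sum>i\<in>UNIV. f K i * h (edge_mid K i)) = (\<Sum>(K, i)\<in>?D. f K i * h (edge_mid K i))"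
    by (simp add: sum.cartesian_product)
  also have "\<dots> = (\<Sum>E\<in>?e ` ?D. \<Sum>(K, i)\<in>{d \<in> ?D. ?e d = E}. f K i * h (edge_mid K i))"
    by (rule sum.image_gen[OF fD])
  also have "\<dots> = 0"
  proof (rule sum.neutral, rule ballI)
    fix E assume "E \<in> ?e ` ?D"
    then obtain K0 i0 where K0: "K0 \<in> T" "edge K0 i0 = E" by auto
    then have E: "E \<in> mesh_edges T" by (auto simp: mesh_edges_def)
    have "(\<Sum>(K, i)\<in>{d \<in> ?D. ?e d = E}. f K i * h (edge_mid K i))
        = (\<Sum>(K, i)\<in>{d \<in> ?D. ?e d = E}. f K i * h (edge_mid K0 i0))"
      using K0(2) by (intro sum.cong) (auto dest: edge_mid_cong)
    also have "\<dots> = (\<Sum>(K, i)\<in>{d \<in> ?D. ?e d = E}. f K i) * h (edge_mid K0 i0)"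
      by (simp add: sum_distrib_right case_prod_unfold)
    also have "(\<Sum>(K, i)\<in>{d \<in> ?D. ?e d = E}. f K i) = (\<Sum>(K, i) | K \<in> T \<and> edge K i = E. f K i)"
      by (rule sum.cong) auto
    also have "\<dots> = 0" using bal E by blast
    finally show "(\<Sum>(K, i)\<in>{d \<in> ?D. ?e d = E}. f K i * h (edge_mid K i)) = 0" by simp
  qed
  finally show ?thesis .
qed

text \<open>A circulation annihilates differences along the paths from centres to midpoints: the
  part with \<open>h\<close> cancels edge by edge, the part with \<open>g\<close> cell by
  cell.\<close>

lemma circulation_sum_zero:
  assumes fin: "finite T" and f: "circulation T f"
  shows "(\<Sum>K\<in>T. \<Sum>i\<in>UNIV. f K i * (h (edge_mid K i) - g K)) = 0"
proof -
  have "(\<Sum>K\<in>T. \<Sum>i\<in>UNIV. f K i * (h (edge_mid K i) - g K))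
      = (\<Sum>K\<in>T. \<Sum>i\<in>UNIV. f K i * h (edge_mid K i)) - (\<Sum>K\<in>T. (\<Sum>i\<in>UNIV. f K i) * g K)"
    by (simp add: algebra_simps sum_subtractf sum_distrib_left sum_distrib_right)
  also have "\<dots> = 0"
    using sum_balanced_edges[OF fin, of f h] f by (simp add: circulation_def)
  finally show ?thesis .
qed

text \<open>The total winding around \<open>a\<close> of the dual paths from cell centres through edge midpoints,
  weighted by the fluxes.\<close>

definition winding_potential :: "quad set \<Rightarrow> (quad \<Rightarrow> 4 \<Rightarrow> real) \<Rightarrow> real^2 \<Rightarrow> real" where
  "winding_potential T f a =
     (\<Sum>K\<in>T. \<Sum>i\<in>UNIV. f K i * angle_change a (centre K) (edge_mid K i)) / (2 * pi)"

text \<open>Moving the base point from \<open>K i\<close> to \<open>K (i+1)\<close> changes each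
  angle by the increment of \<open>seg_arg\<close> along the dual segment, up to full turns. The
  increments sum to zero by \<open>circulation_sum_zero\<close>; what survives is one full turn for
  a neighbour across the edge, whose flux is minus that of \<open>K\<close>.\<close>

lemma winding_potential_edge:
  assumes fin: "finite T" and f: "circulation T f" and K: "K \<in> T" "convex_quad K"
    and off: "\<And>K' j. K' \<in> T \<Longrightarrow> edge K' j \<noteq> edge K i \<Longrightarrow>
        closed_segment (centre K') (edge_mid K' j) \<inter> edge K i = {}"
    and opp: "\<And>K' j. K' \<in> T \<Longrightarrow> K' \<noteq> K \<Longrightarrow> edge K' j = edge K i \<Longrightarrow> side K i (centre K') < 0"
  shows "winding_potential T f (K (i+1)) - winding_potential T f (K i) = f K i"
proof -
  let ?a = "K i" and ?b = "K (i+1)" and ?D = "T \<times> (UNIV :: 4 set)"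
  let ?h = "seg_arg ?a ?b"
  \<comment> \<open>The correction by a full turn for dual segments that reach the cut from the
    right, against the convention of the principal branch.\<close>
  let ?c = "\<lambda>K' j. if edge K' j = edge K i \<and> K' \<noteq> K then 2 * pi else 0"
  have ab: "?a \<noteq> ?b" using dist_pos[OF K(2), of i] by auto
  have *: "angle_change ?b (centre K') (edge_mid K' j) - angle_change ?a (centre K') (edge_mid K' j)
      = ?h (edge_mid K' j) - ?h (centre K') - ?c K' j" if K': "K' \<in> T" for K' j
  proof (cases "edge K' j = edge K i")
    case True
    then have m: "edge_mid K' j = midpoint ?a ?b" using edge_mid_cong[OF True] by (simp add: edge_mid_def)
    show ?thesis
    proof (cases "K' = K")
      case True
      have "side K i (centre K) > 0"
      proof -
        have "centre K \<in> interior (cell K)" by (rule centre_in_interior[OF K(2)])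
        moreover have "interior (cell K) \<subseteq> {x. side K i x > 0}"
          by (rule interior_cell_side[OF K(2)])
        ultimately show ?thesis by auto
      qed
      then show ?thesis using True m seg_arg_midpoint[OF ab]
          angle_change_midpoint_left[of ?b ?a "centre K"] by (simp add: side_def)
    next
      case False
      then show ?thesis using opp[OF K' False True] m seg_arg_midpoint[OF ab] True
          angle_change_midpoint_right[of ?b ?a "centre K'"] by (simp add: side_def)
    qed
  next
    case False
    then show ?thesis using off[OF K' False] by (simp add: angle_change_off_segment edge_def)
  qed
  have "2 * pi * (winding_potential T f ?b - winding_potential T f ?a)
      = (\<Sum>K'\<in>T. \<Sum>j\<in>UNIV. f K' j * (angle_change ?b (centre K') (edge_mid K' j)
           - angle_change ?a (centre K') (edge_mid K' j)))"
  proof -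
    have *: "2 * pi * (x / (2 * pi) - y / (2 * pi)) = x - y" for x y :: real
      by (simp add: right_diff_distrib)
    show ?thesis unfolding winding_potential_def * by (simp add: sum_subtractf right_diff_distrib)
  qed
  also have "\<dots> = (\<Sum>K'\<in>T. \<Sum>j\<in>UNIV. f K' j * (?h (edge_mid K' j) - ?h (centre K')))
      - (\<Sum>K'\<in>T. \<Sum>j\<in>UNIV. f K' j * ?c K' j)"
    using * by (simp add: sum_subtractf right_diff_distrib)
  also have "\<dots> = - (\<Sum>K'\<in>T. \<Sum>j\<in>UNIV. f K' j * ?c K' j)"
    using circulation_sum_zero[OF fin f, of ?h "\<lambda>K'. ?h (centre K')"] by simp
  also have "(\<Sum>K'\<in>T. \<Sum>j\<in>UNIV. f K' j * ?c K' j) = (\<Sum>(K', j)\<in>?D. f K' j * ?c K' j)"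
    by (simp add: sum.cartesian_product)
  also have "\<dots> = (\<Sum>(K', j)\<in>{(K', j). K' \<in> T \<and> edge K' j = edge K i} - {(K, i)}. f K' j * (2 * pi))"
  proof (rule sum.mono_neutral_cong_right)
    show "finite ?D" using fin by simp
    show "{(K', j). K' \<in> T \<and> edge K' j = edge K i} - {(K, i)} \<subseteq> ?D" by auto
    have u: "j = i" if "edge K j = edge K i" for j
      using edge_inj[OF K(2) that] .
    show "\<forall>d\<in>?D - ({(K', j). K' \<in> T \<and> edge K' j = edge K i} - {(K, i)}). (case d of (K', j) \<Rightarrow> f K' j * ?c K' j) = 0"
      by (auto split: if_splits)
    fix d assume "d \<in> {(K', j). K' \<in> T \<and> edge K' j = edge K i} - {(K, i)}"
    then show "(case d of (K', j) \<Rightarrow> f K' j * ?c K' j) = (case d of (K', j) \<Rightarrow> f K' j * (2 * pi))"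
      using u by (auto split: if_splits)
  qed
  also have "\<dots> = 2 * pi * (\<Sum>(K', j)\<in>{(K', j). K' \<in> T \<and> edge K' j = edge K i} - {(K, i)}. f K' j)"
    by (simp add: sum_distrib_left case_prod_unfold mult_ac)
  \<comment> \<open>By balance on this edge the remaining fluxes are minus the flux of
    \<open>K\<close>. On a boundary edge nothing remains and the flux of \<open>K\<close> is itself
    0.\<close>
  also have "(\<Sum>(K', j)\<in>{(K', j). K' \<in> T \<and> edge K' j = edge K i} - {(K, i)}. f K' j) = - f K i"
  proof -
    have fi: "finite {(K', j). K' \<in> T \<and> edge K' j = edge K i}"
      by (rule finite_subset[of _ ?D]) (use fin in auto)
    have "(\<Sum>(K', j)\<in>{(K', j). K' \<in> T \<and> edge K' j = edge K i}. f K' j) = 0"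
      using f K(1) by (auto simp: circulation_def mesh_edges_def)
    then show ?thesis
      using sum.remove[OF fi, of "(K, i)" "\<lambda>(K', j). f K' j"] K(1) by auto
  qed
  finally show ?thesis by simp
qed

text \<open>With one continuous logarithm of x - a on all of \<Omega>, every angle change becomes a
  difference of values of Im P, and a circulation annihilates such differences. Only segments that
  carry flux have to lie in \<Omega>: those towards boundary edges end outside it, but carry
  none.\<close>

lemma winding_potential_outside:
  assumes fin: "finite T" and f: "circulation T f" and \<Omega>: "open \<Omega>" "simply_connected \<Omega>" and a: "a \<notin> \<Omega>"
    and sub: "\<And>K i. K \<in> T \<Longrightarrow> f K i \<noteq> 0 \<Longrightarrow> closed_segment (centre K) (edge_mid K i) \<subseteq> \<Omega>"
  shows "winding_potential T f a = 0"
proof -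
  obtain P where P: "continuous_on \<Omega> P" "\<And>x. x \<in> \<Omega> \<Longrightarrow> cpx x - cpx a = exp (P x)"
  proof (rule continuous_logarithm_on_simply_connected[of \<Omega> "\<lambda>x. cpx x - cpx a"])
    show "continuous_on \<Omega> (\<lambda>x. cpx x - cpx a)" by (intro continuous_intros)
    show "locally path_connected \<Omega>" using \<Omega>(1) by (rule open_imp_locally_path_connected)
  qed (use \<Omega> a in \<open>auto simp: cpx_simps\<close>)
  have "f K i * angle_change a (centre K) (edge_mid K i)
      = f K i * (Im (P (edge_mid K i)) - Im (P (centre K)))" if "K \<in> T" for K i
  proof (cases "f K i = 0")
    case False
    have s: "closed_segment (centre K) (edge_mid K i) \<subseteq> \<Omega>" by (rule sub[OF that False])
    have "angle_change a (centre K) (edge_mid K i) = Im (P (edge_mid K i)) - Im (P (centre K))"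
    proof (rule angle_change_eq_log)
      show "continuous_on (closed_segment (centre K) (edge_mid K i)) P"
        using P(1) s by (rule continuous_on_subset)
      fix x assume "x \<in> closed_segment (centre K) (edge_mid K i)"
      then have "x \<in> \<Omega>" using s by blast
      then show "exp (P x) = cpx x - cpx a" using P(2) by simp
    qed
    then show ?thesis by simp
  qed simp
  then have "winding_potential T f a
      = (\<Sum>K\<in>T. \<Sum>i\<in>UNIV. f K i * (Im (P (edge_mid K i)) - Im (P (centre K)))) / (2 * pi)"
    unfolding winding_potential_def by (intro arg_cong2[where f="(/)"] sum.cong refl) auto
  also have "\<dots> = 0"
    using circulation_sum_zero[OF fin f, of "\<lambda>x. Im (P x)" "\<lambda>K. Im (P (centre K))"] by simp
  finally show ?thesis .
qed

section \<open>Topology of the mesh\<close>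

text \<open>Shifting a frontier point across the local graph, in the direction \<open>e'\<close>,
  leads into an open set free of \<Omega>, so no ball around the point is contained in the closure.
  This excludes slits and makes \<Omega> recoverable from the union of the cells.\<close>

lemma interior_closure_lipschitz:
  assumes op: "open \<Omega>" and lip: "lipschitz_boundary \<Omega>"
  shows "interior (closure \<Omega>) = \<Omega>"
proof
  show "\<Omega> \<subseteq> interior (closure \<Omega>)" using op by (intro interior_maximal closure_subset)
  show "interior (closure \<Omega>) \<subseteq> \<Omega>"
  proof
    fix z assume z: "z \<in> interior (closure \<Omega>)"
    show "z \<in> \<Omega>"
    proof (rule ccontr)
      assume nz: "z \<notin> \<Omega>"
      then have "z \<in> frontier \<Omega>"
        using z interior_subset op by (auto simp: frontier_def interior_open)
      then obtain r e g C where r: "r > 0" and e: "norm e = 1" and g: "C-lipschitz_on UNIV g"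
        and eq: "\<Omega> \<inter> ball z r = {x \<in> ball z r. vector [- e$2, e$1] \<bullet> x < g (e \<bullet> x)}"
        using lip unfolding lipschitz_boundary_def by blast
      define e' :: "real^2" where "e' = vector [- e$2, e$1]"
      have e2: "e$1 * e$1 + e$2 * e$2 = 1" using e by (rule norm_1_vec2)
      have ee: "e' \<bullet> e' = 1" "e \<bullet> e' = 0"
        using e2 by (simp_all add: e'_def inner_vec_def sum_2)
      then have ne: "norm e' = 1" by (simp add: norm_eq_1)
      have zg: "e' \<bullet> z \<ge> g (e \<bullet> z)"
      proof (rule ccontr)
        assume "\<not> ?thesis"
        then have "z \<in> {x \<in> ball z r. vector [- e$2, e$1] \<bullet> x < g (e \<bullet> x)}"
          using r by (simp add: e'_def)
        then show False using eq nz by blast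
      qed
      obtain d where d: "d > 0" "ball z d \<subseteq> interior (closure \<Omega>)"
        using openE[OF open_interior z] by metis
      define s where "s = min d r / 2"
      have s: "0 < s" "s < d" "s < r" using d r by (auto simp: s_def)
      define y where "y = z + s *\<^sub>R e'"
      have dy: "dist z y = s" using s ne by (simp add: y_def dist_norm)
      have "y \<in> closure \<Omega>" using d(2) dy s interior_subset by (auto simp: subset_iff)
      moreover have "open (ball z r \<inter> {x. g (e \<bullet> x) < e' \<bullet> x})"
      proof -
        have "continuous_on UNIV g" by (rule lipschitz_on_continuous_on[OF g])
        then have "continuous_on UNIV (\<lambda>x. g (e \<bullet> x))"
          by (rule continuous_on_compose2) (auto intro!: continuous_intros)
        then show ?thesis
          by (intro open_Int open_ball open_Collect_less continuous_intros) auto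
      qed
      moreover have "y \<in> ball z r \<inter> {x. g (e \<bullet> x) < e' \<bullet> x}"
        using dy s zg ee by (simp add: y_def inner_add_right)
      ultimately have "\<Omega> \<inter> (ball z r \<inter> {x. g (e \<bullet> x) < e' \<bullet> x}) \<noteq> {}"
        unfolding closure_iff_nhds_not_empty by blast
      then obtain x where x: "x \<in> \<Omega>" "x \<in> ball z r" "g (e \<bullet> x) < e' \<bullet> x" by blast
      then have "x \<in> {x \<in> ball z r. vector [- e$2, e$1] \<bullet> x < g (e \<bullet> x)}" using eq by blast
      then show False using x(3) by (simp add: e'_def)
    qed
  qed
qed

lemma open_edge_cong:
  "edge K i = edge K' j \<Longrightarrow> open_segment (K i) (K (i+1)) = open_segment (K' j) (K' (j+1))"
  unfolding edge_eq_iff by (auto simp: doubleton_eq_iff open_segment_commute)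

locale quad_mesh =
  fixes \<Omega> :: "(real^2) set" and T :: "quad set"
  assumes dom: "lipschitz_polygonal_domain \<Omega>" and part: "quad_partition \<Omega> T"
begin

lemma open_dom: "open \<Omega>" and connected_dom: "connected \<Omega>" and bounded_dom: "bounded \<Omega>"
  and dom_nonempty: "\<Omega> \<noteq> {}"
  and finite_mesh: "finite T" and convex: "K \<in> T \<Longrightarrow> convex_quad K"
  and Union_cells: "(\<Union>K\<in>T. cell K) = closure \<Omega>"
  using dom part by (auto simp: lipschitz_polygonal_domain_def quad_partition_def)

lemma interior_closure_dom: "interior (closure \<Omega>) = \<Omega>"
  using dom by (intro interior_closure_lipschitz) (auto simp: lipschitz_polygonal_domain_def)

text \<open>The frontier is a finite union of segments. Since the cells cover the closure of
  \<Omega>, this is needed to pass between equality almost everywhere on \<Omega> and on the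
  cells.\<close>

lemma negligible_frontier_dom: "negligible (frontier \<Omega>)"
proof -
  obtain S where S: "finite S" "frontier \<Omega> = (\<Union>(a, b) \<in> S. closed_segment a b)"
    using dom by (auto simp: lipschitz_polygonal_domain_def)
  have "negligible (closed_segment a b)" for a b :: "real^2"
    using negligible_convex_interior[of "closed_segment a b"] interior_closed_segment_ge2[of a b] by simp
  then show ?thesis unfolding S(2) using S(1) by (intro negligible_Union) auto
qed

lemma cell_subset: "K \<in> T \<Longrightarrow> cell K \<subseteq> closure \<Omega>"
  using Union_cells by blast

lemma interior_cell_subset: "K \<in> T \<Longrightarrow> interior (cell K) \<subseteq> \<Omega>"
  using interior_mono[OF cell_subset] interior_closure_dom by blast

lemma mesh_nonempty: "T \<noteq> {}"
  using Union_cells dom_nonempty closure_subset[of \<Omega>] by auto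

lemma intersection_cases:
  assumes "K \<in> T" "K' \<in> T" "K \<noteq> K'" "x \<in> cell K" "x \<in> cell K'"
  obtains i where "x = K i"
    | i j where "cell K \<inter> cell K' = edge K i" "edge K i = edge K' j" "x \<in> edge K i"
proof -
  have "cell K \<inter> cell K' = {} \<or> (\<exists>i j. cell K \<inter> cell K' = {K i} \<and> K i = K' j) \<or>
        (\<exists>i j. cell K \<inter> cell K' = edge K i \<and> edge K i = edge K' j)"
    using part assms(1-3) by (auto simp: quad_partition_def)
  then show thesis using assms(4,5) that by blast
qed

text \<open>Interior points of \<open>K'\<close> are dense in it, so an overlap would contain a
  point interior to both cells. A conforming partition only allows common vertices and edges, where
  a side function of \<open>K\<close> vanishes.\<close>

lemma interior_cell_disjoint:
  assumes K: "K \<in> T" "K' \<in> T" "K \<noteq> K'" shows "interior (cell K) \<inter> cell K' = {}"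
proof (rule ccontr)
  assume "interior (cell K) \<inter> cell K' \<noteq> {}"
  then obtain x where x: "x \<in> interior (cell K)" "x \<in> cell K'" by blast
  have "closure (interior (cell K')) = closure (cell K')"
    using interior_cell_nonempty[OF convex[OF K(2)]] by (intro convex_closure_interior) auto
  then have "x \<in> closure (interior (cell K'))" using x(2) closure_subset by blast
  then have "interior (cell K') \<inter> interior (cell K) \<noteq> {}"
    using x(1) unfolding closure_iff_nhds_not_empty by blast
  then obtain y where y: "y \<in> interior (cell K)" "y \<in> interior (cell K')" by blast
  then have "y \<in> cell K" "y \<in> cell K'" using interior_subset by auto
  then obtain i where "side K i y = 0"
    using intersection_cases[OF K] edge_side0 side_vertex(1) by metis
  moreover have "side K i y > 0" using interior_cell_side[OF convex[OF K(1)]] y(1) by blast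
  ultimately show False by simp
qed

text \<open>An inner point of an edge is no vertex and lies on no other edge of the cell, which
  leaves only the last alternative of a conforming partition.\<close>

lemma open_edge_shared:
  assumes K: "K \<in> T" "K' \<in> T" "K \<noteq> K'" and x: "x \<in> open_segment (K i) (K (i+1))" "x \<in> cell K'"
  shows "cell K \<inter> cell K' = edge K i" "\<exists>j. edge K' j = edge K i"
proof -
  have V: "convex_quad K" by (rule convex[OF K(1)])
  have "x \<in> cell K" using x(1) edge_subset_open edge_subset_cell by blast
  from K this x(2) have "\<exists>j. cell K \<inter> cell K' = edge K i \<and> edge K i = edge K' j"
  proof (cases rule: intersection_cases)
    case (1 k)
    then show ?thesis using open_edge_not_vertex[OF V x(1)] by blast
  next
    case (2 k l)
    then show ?thesis using open_edge_unique[OF V x(1), of k] by auto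
  qed
  then show "cell K \<inter> cell K' = edge K i" "\<exists>j. edge K' j = edge K i" by auto
qed

text \<open>If both cells ran through the edge in the same direction, they would be the same half
  disc near its midpoint and overlap. Being counterclockwise, they traverse it in opposite
  directions, so outward fluxes on the two sides are comparable with a sign.\<close>

lemma shared_edge_reversed:
  assumes K: "K \<in> T" "K' \<in> T" "K \<noteq> K'" and e: "edge K' j = edge K i"
  shows "K' j = K (i+1)" "K' (j+1) = K i" "side K i x = - side K' j x"
proof -
  let ?m = "edge_mid K i"
  have V: "convex_quad K" "convex_quad K'" using convex K by auto
  have m: "?m \<in> open_segment (K i) (K (i+1))" by (rule edge_mid_in_open_edge[OF V(1)])
  have m': "?m \<in> open_segment (K' j) (K' (j+1))" using m unfolding open_edge_cong[OF e] .
  have "?m \<in> cell K'" using m' edge_subset_open edge_subset_cell by blast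
  note sh = open_edge_shared(1)[OF K m this]
  have "\<not> (K' j = K i \<and> K' (j+1) = K (i+1))"
  proof
    assume eq: "K' j = K i \<and> K' (j+1) = K (i+1)"
    then have ss: "side K' j = side K i" by (simp add: side_def fun_eq_iff)
    obtain d where d: "d > 0" "\<forall>y\<in>ball ?m d. side K i y \<ge> 0 \<longrightarrow> y \<in> cell K"
      using near_open_edge[OF V(1) m] by blast
    obtain d' where d': "d' > 0" "\<forall>y\<in>ball ?m d'. side K' j y \<ge> 0 \<longrightarrow> y \<in> cell K'"
      using near_open_edge[OF V(2) m'] by blast
    have "?m \<in> closure (interior (cell K))"
    proof -
      have "closure (interior (cell K)) = closure (cell K)"
        using interior_cell_nonempty[OF V(1)] by (intro convex_closure_interior) auto
      moreover have "?m \<in> cell K" using m edge_subset_open edge_subset_cell by blast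
      ultimately show ?thesis using closure_subset by blast
    qed
    then have "interior (cell K) \<inter> ball ?m d' \<noteq> {}"
      using d'(1) unfolding closure_iff_nhds_not_empty by (metis centre_in_ball open_ball order_refl)
    then obtain y where y: "y \<in> interior (cell K)" "y \<in> ball ?m d'" by blast
    have "side K i y > 0" using interior_cell_side[OF V(1)] y(1) by blast
    then have "y \<in> cell K'" using d'(2) y(2) ss by auto
    then show False using interior_cell_disjoint[OF K] y(1) by blast
  qed
  moreover have "{K' j, K' (j+1)} = {K i, K (i+1)}" using e unfolding edge_eq_iff .
  ultimately show r: "K' j = K (i+1)" "K' (j+1) = K i" by (auto simp: doubleton_eq_iff)
  show "side K i x = - side K' j x" unfolding side_def r by (simp add: cross2_def algebra_simps)
qed

lemma shared_edge_side:
  assumes K: "K \<in> T" "K' \<in> T" "K \<noteq> K'" and e: "edge K' j = edge K i"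
  shows "side K i (centre K') < 0"
proof -
  have "side K' j (centre K') > 0"
    using interior_cell_side[OF convex[OF K(2)]] centre_in_interior[OF convex[OF K(2)]] by blast
  then show ?thesis using shared_edge_reversed(3)[OF assms] by simp
qed

text \<open>Any two cells at an edge traverse it in opposite directions; three cannot do so
  pairwise.\<close>

lemma at_most_two_cells:
  assumes K: "K \<in> T" "K' \<in> T" "K'' \<in> T" "K \<noteq> K'" "K \<noteq> K''"
    and e: "edge K' j = edge K i" "edge K'' l = edge K i"
  shows "K' = K''"
proof (rule ccontr)
  assume ne: "K' \<noteq> K''"
  have "edge K'' l = edge K' j" using e by simp
  from shared_edge_reversed[OF K(2,3) ne this] shared_edge_reversed[OF K(1,2,4) e(1)]
    shared_edge_reversed[OF K(1,3,5) e(2)]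
  have "K i = K (i+1)" by simp
  then show False using dist_pos[OF convex[OF K(1)], of i] by simp
qed

text \<open>The half discs of the two cells form a ball inside the closure of \<Omega>, and the
  interior of that closure is \<Omega>.\<close>

lemma open_edge_in_dom:
  assumes K: "K \<in> T" "K' \<in> T" "K \<noteq> K'" and e: "edge K' j = edge K i"
    and x: "x \<in> open_segment (K i) (K (i+1))"
  shows "x \<in> \<Omega>"
proof -
  have x': "x \<in> open_segment (K' j) (K' (j+1))" using x unfolding open_edge_cong[OF e] .
  obtain d where d: "d > 0" "\<forall>y\<in>ball x d. side K i y \<ge> 0 \<longrightarrow> y \<in> cell K"
    using near_open_edge[OF convex[OF K(1)] x] by blast
  obtain d' where d': "d' > 0" "\<forall>y\<in>ball x d'. side K' j y \<ge> 0 \<longrightarrow> y \<in> cell K'"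
    using near_open_edge[OF convex[OF K(2)] x'] by blast
  have "ball x (min d d') \<subseteq> closure \<Omega>"
  proof
    fix y assume y: "y \<in> ball x (min d d')"
    have "y \<in> cell K \<or> y \<in> cell K'"
      using d(2) d'(2) y shared_edge_reversed(3)[OF K e, of y] by (cases "side K i y \<ge> 0") auto
    then show "y \<in> closure \<Omega>" using cell_subset K by blast
  qed
  moreover have "x \<in> ball x (min d d')" using d d' by simp
  ultimately have "x \<in> interior (closure \<Omega>)" by (meson interiorI open_ball)
  then show ?thesis using interior_closure_dom by simp
qed

lemma vertex_in_closure: "K \<in> T \<Longrightarrow> K i \<in> closure \<Omega>"
  using cell_subset vertex_in_cell by blast

lemma boundary_vertex_iff: "K \<in> T \<Longrightarrow> K i \<in> boundary_vertices \<Omega> T \<longleftrightarrow> K i \<notin> \<Omega>"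
  using vertex_in_closure[of K i] open_dom
  by (auto simp: boundary_vertices_def mesh_vertices_def frontier_def interior_open)

lemma interior_vertex_iff: "K \<in> T \<Longrightarrow> K i \<in> interior_vertices \<Omega> T \<longleftrightarrow> K i \<in> \<Omega>"
  by (auto simp: interior_vertices_def mesh_vertices_def)

text \<open>The other cells are closed and miss an inner point of this edge. Were the point in
  \<Omega>, a neighbourhood would be covered by \<open>K\<close> alone, making it interior to
  \<open>K\<close> although it lies on an edge.\<close>

lemma boundary_edge_open:
  assumes K: "K \<in> T" and b: "\<And>K' j. K' \<in> T \<Longrightarrow> edge K' j = edge K i \<Longrightarrow> K' = K"
  shows "open_segment (K i) (K (i+1)) \<inter> \<Omega> = {}"
proof (rule ccontr)
  assume "open_segment (K i) (K (i+1)) \<inter> \<Omega> \<noteq> {}"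
  then obtain x where x: "x \<in> open_segment (K i) (K (i+1))" "x \<in> \<Omega>" by blast
  have V: "convex_quad K" by (rule convex[OF K])
  have "closed (\<Union>K'\<in>T - {K}. cell K')" using finite_mesh by (intro closed_UN) auto
  moreover have "x \<notin> (\<Union>K'\<in>T - {K}. cell K')"
  proof
    assume "x \<in> (\<Union>K'\<in>T - {K}. cell K')"
    then obtain K' where K': "K' \<in> T" "K' \<noteq> K" "x \<in> cell K'" by blast
    then have "\<exists>j. edge K' j = edge K i" using open_edge_shared(2)[OF K _ _ x(1)] by blast
    then show False using b K' by blast
  qed
  ultimately have "open (\<Omega> - (\<Union>K'\<in>T - {K}. cell K'))" "x \<in> \<Omega> - (\<Union>K'\<in>T - {K}. cell K')"
    using open_dom x(2) by auto
  moreover have "\<Omega> - (\<Union>K'\<in>T - {K}. cell K') \<subseteq> cell K"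
    using Union_cells closure_subset[of \<Omega>] by blast
  ultimately have "x \<in> interior (cell K)" by (meson interiorI)
  then have "side K i x > 0" using interior_cell_side[OF V] by blast
  moreover have "side K i x = 0" using x(1) edge_subset_open edge_side0 by blast
  ultimately show False by simp
qed

text \<open>The complement of \<Omega> is closed, so with the open edge it contains the endpoints.
  Vertex values that vanish off \<Omega> thus have difference 0 along a boundary edge.\<close>

lemma boundary_edge_vertices:
  assumes K: "K \<in> T" and b: "\<And>K' j. K' \<in> T \<Longrightarrow> edge K' j = edge K i \<Longrightarrow> K' = K"
  shows "K i \<notin> \<Omega>" "K (i+1) \<notin> \<Omega>"
proof -
  have ne: "K i \<noteq> K (i+1)" using dist_pos[OF convex[OF K], of i] by auto
  have "edge K i \<subseteq> - \<Omega>"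
  proof -
    have "open_segment (K i) (K (i+1)) \<inter> \<Omega> = {}"
      by (rule boundary_edge_open[OF K]) (rule b)
    then have "open_segment (K i) (K (i+1)) \<subseteq> - \<Omega>" by blast
    then have "closure (open_segment (K i) (K (i+1))) \<subseteq> - \<Omega>"
      using open_dom by (intro closure_minimal) auto
    then show ?thesis using ne by (simp add: edge_def)
  qed
  then show "K i \<notin> \<Omega>" "K (i+1) \<notin> \<Omega>" by (auto simp: edge_def)
qed

section \<open>Dual segments and sums over the cells at an edge\<close>

lemma centre_mid_segment:
  assumes V: "convex_quad K"
  shows "closed_segment (centre K) (edge_mid K i) \<subseteq> insert (edge_mid K i) (interior (cell K))"
proof -
  have "edge_mid K i \<in> cell K"
    using edge_mid_in_open_edge[OF V] edge_subset_open edge_subset_cell by blast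
  then have "open_segment (centre K) (edge_mid K i) \<subseteq> interior (cell K)"
    using closure_subset by (intro in_interior_closure_convex_segment centre_in_interior[OF V]) auto
  then show ?thesis using centre_in_interior[OF V] by (auto simp: closed_segment_eq_open)
qed

text \<open>The segment stays in the interior of \<open>K'\<close> except for its last point, and
  that point is inner to an edge other than the given one.\<close>

lemma dual_segment_off_edge:
  assumes K: "K \<in> T" "K' \<in> T" and ne: "edge K' j \<noteq> edge K i"
  shows "closed_segment (centre K') (edge_mid K' j) \<inter> edge K i = {}"
proof (rule ccontr)
  have V: "convex_quad K" "convex_quad K'" using convex K by auto
  assume "closed_segment (centre K') (edge_mid K' j) \<inter> edge K i \<noteq> {}"
  then obtain x where x: "x \<in> closed_segment (centre K') (edge_mid K' j)" "x \<in> edge K i" by blast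
  have xK: "x \<in> cell K" using x(2) edge_subset_cell by blast
  consider "x \<in> interior (cell K')" | "x = edge_mid K' j"
    using x(1) centre_mid_segment[OF V(2)] by blast
  then show False
  proof cases
    case 1
    then have "K = K'" using interior_cell_disjoint[OF K(2,1)] xK by blast
    then have "side K i x > 0" using 1 interior_cell_side[OF V(2)] by blast
    then show False using edge_side0[OF x(2)] by simp
  next
    case 2
    then have xo: "x \<in> open_segment (K' j) (K' (j+1))" using edge_mid_in_open_edge[OF V(2)] by simp
    show False
    proof (cases "K = K'")
      case True
      then show False using open_edge_unique[OF V(2) xo, of i] x(2) ne by simp
    next
      case False
      then obtain i' where i': "edge K i' = edge K' j"
        using open_edge_shared(2)[OF K(2,1) _ xo xK] by blast
      then have "x \<in> open_segment (K i') (K (i'+1))" using xo open_edge_cong[OF i'] by (simp only:)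
      then have "i = i'" using open_edge_unique[OF V(1) _ x(2)] by blast
      then show False using i' ne by simp
    qed
  qed
qed

lemma dual_segment_in_dom:
  assumes K: "K \<in> T" "K' \<in> T" "K \<noteq> K'" "edge K' j = edge K i"
  shows "closed_segment (centre K) (edge_mid K i) \<subseteq> \<Omega>"
  using centre_mid_segment[OF convex[OF K(1)], of i] interior_cell_subset[OF K(1)]
    open_edge_in_dom[OF K edge_mid_in_open_edge[OF convex[OF K(1)]]] by blast

lemma edge_sum_boundary:
  assumes K: "K \<in> T" and b: "\<And>K' j. K' \<in> T \<Longrightarrow> edge K' j = edge K i \<Longrightarrow> K' = K"
  shows "(\<Sum>(K', j) | K' \<in> T \<and> edge K' j = edge K i. f K' j) = (f K i :: real)"
proof -
  have "{(K', j). K' \<in> T \<and> edge K' j = edge K i} = {(K, i)}"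
    using K b edge_inj[OF convex[OF K]] by blast
  then show ?thesis by simp
qed

lemma edge_sum_interior:
  assumes K: "K \<in> T" "K' \<in> T" "K \<noteq> K'" "edge K' j = edge K i"
  shows "(\<Sum>(K', j) | K' \<in> T \<and> edge K' j = edge K i. f K' j) = (f K i + f K' j :: real)"
proof -
  have "{(K', j). K' \<in> T \<and> edge K' j = edge K i} = {(K, i), (K', j)}"
  proof (intro equalityI subsetI, goal_cases)
    case (1 d)
    then obtain L l where d: "d = (L, l)" "L \<in> T" "edge L l = edge K i" by blast
    show ?case
    proof (cases "L = K")
      case True
      then show ?thesis using d edge_inj[OF convex[OF K(1)], of l i] by simp
    next
      case False
      then have "L = K'" using at_most_two_cells[OF K(1,2) d(2) K(3) _ K(4) d(3)] by simp
      then show ?thesis using d K edge_inj[OF convex[OF K(2)], of l j] by simp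
    qed
  qed (use K in auto)
  then show ?thesis using K(3) by simp
qed

lemma edge_cases:
  assumes "K \<in> T"
  obtains (boundary) "\<And>K' j. K' \<in> T \<Longrightarrow> edge K' j = edge K i \<Longrightarrow> K' = K"
    | (interior) K' j where "K' \<in> T" "K \<noteq> K'" "edge K' j = edge K i"
  by metis

lemma balanced_edges_iff:
  "(\<forall>E\<in>mesh_edges T. (\<Sum>(K, i) | K \<in> T \<and> edge K i = E. f K i) = (0::real)) \<longleftrightarrow>
   (\<forall>K\<in>T. \<forall>i. (\<forall>K'\<in>T. \<forall>j. K' \<noteq> K \<longrightarrow> edge K' j = edge K i \<longrightarrow> f K i + f K' j = 0) \<and>
      ((\<forall>K'\<in>T. \<forall>j. edge K' j = edge K i \<longrightarrow> K' = K) \<longrightarrow> f K i = 0))" (is "?L \<longleftrightarrow> ?R")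
proof
  assume L: ?L
  then have s: "(\<Sum>(K', j) | K' \<in> T \<and> edge K' j = edge K i. f K' j) = 0" if "K \<in> T" for K i
    using that by (auto simp: mesh_edges_def)
  show ?R
  proof (intro ballI allI conjI impI)
    fix K i assume K: "K \<in> T"
    { fix K' j assume "K' \<in> T" "K' \<noteq> K" "edge K' j = edge K i"
      then have "(\<Sum>(K', j) | K' \<in> T \<and> edge K' j = edge K i. f K' j) = f K i + f K' j"
        by (intro edge_sum_interior[OF K]) auto
      then show "f K i + f K' j = 0" using s[OF K, of i] by argo }
    assume "\<forall>K'\<in>T. \<forall>j. edge K' j = edge K i \<longrightarrow> K' = K"
    then have "(\<Sum>(K', j) | K' \<in> T \<and> edge K' j = edge K i. f K' j) = f K i"
      by (intro edge_sum_boundary[OF K]) blast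
    then show "f K i = 0" using s[OF K, of i] by argo
  qed
next
  assume R: ?R
  show ?L
  proof
    fix E assume "E \<in> mesh_edges T"
    then obtain K i where K: "K \<in> T" and E: "E = edge K i" by (auto simp: mesh_edges_def)
    show "(\<Sum>(K, i) | K \<in> T \<and> edge K i = E. f K i) = 0" using K
    proof (cases rule: edge_cases[of K i])
      case boundary
      have "f K i = 0"
        by (rule R[THEN bspec[OF _ K], THEN spec[of _ i], THEN conjunct2, rule_format])
          (rule boundary)
      moreover have "(\<Sum>(K', j) | K' \<in> T \<and> edge K' j = edge K i. f K' j) = f K i"
        by (rule edge_sum_boundary[OF K]) (rule boundary)
      ultimately show ?thesis unfolding E by argo
    next
      case (interior K' j)
      have "f K i + f K' j = 0"
        by (rule R[THEN bspec[OF _ K], THEN spec[of _ i], THEN conjunct1, rule_format])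
          (use interior in auto)
      then show ?thesis unfolding E using edge_sum_interior[OF K interior, where f = f] by argo
    qed
  qed
qed

text \<open>Removing the finitely many vertices leaves the domain connected.\<close>

lemma mesh_edge_connected:
  assumes A: "A \<subseteq> T" "A \<noteq> {}"
    and cl: "\<And>K K' i j. K \<in> A \<Longrightarrow> K' \<in> T \<Longrightarrow> edge K' j = edge K i \<Longrightarrow> K' \<in> A"
  shows "A = T"
proof (rule ccontr)
  assume "A \<noteq> T"
  then have B: "T - A \<noteq> {}" using A by blast
  let ?O = "\<Omega> - mesh_vertices T"
  have "finite (mesh_vertices T)" using finite_mesh by (simp add: mesh_vertices_def)
  then have con: "connected ?O"
    using open_dom connected_dom by (intro connected_open_delete_finite) auto
  let ?X = "\<Union>K\<in>A. cell K" and ?Y = "\<Union>K\<in>T - A. cell K"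
  have fA: "finite A" using A finite_mesh finite_subset by blast
  have X: "closed ?X" using fA by (intro closed_UN) auto
  have Y: "closed ?Y" using finite_mesh by (intro closed_UN) auto
  have cov: "?O \<subseteq> ?X \<union> ?Y" 
  proof -
    have "A \<union> (T - A) = T" using A(1) by blast
    then have "?X \<union> ?Y = closure \<Omega>" unfolding UN_Un[symmetric] Union_cells[symmetric] by simp
    then show ?thesis using closure_subset[of \<Omega>] by blast
  qed
  have meet: "?O \<inter> cell K \<noteq> {}" if "K \<in> T" for K
  proof -
    have "interior (cell K) \<noteq> {}" by (rule interior_cell_nonempty[OF convex[OF that]])
    then have "infinite (interior (cell K))"
      using finite_imp_not_open[of "interior (cell K)"] open_interior[of "cell K"] by metis
    then have "interior (cell K) - mesh_vertices T \<noteq> {}"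
      using \<open>finite (mesh_vertices T)\<close> by (metis Diff_eq_empty_iff finite_subset)
    then show ?thesis using interior_cell_subset[OF that] interior_subset[of "cell K"] by blast
  qed
  \<comment> \<open>Two closed sets that cover a connected set and both meet it have a common point
    in it. Here that point is not a vertex, so the two cells through it share an edge, which
    contradicts the closure of \<open>A\<close> under neighbours.\<close>
  have "?X \<inter> ?Y \<inter> ?O \<noteq> {}"
  proof
    assume "?X \<inter> ?Y \<inter> ?O = {}"
    then have "?X \<inter> ?O = {} \<or> ?Y \<inter> ?O = {}"
      by (rule connected_closedD[OF con _ cov X Y])
    then show False
    proof
      assume e: "?X \<inter> ?O = {}"
      obtain K where K: "K \<in> A" using A(2) by blast
      then have "?O \<inter> cell K \<noteq> {}" using meet[of K] A(1) by blast
      moreover have "cell K \<subseteq> ?X" using K by blast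
      ultimately show False using e by blast
    next
      assume e: "?Y \<inter> ?O = {}"
      obtain K where K: "K \<in> T - A" using B by blast
      then have "?O \<inter> cell K \<noteq> {}" using meet[of K] by blast
      moreover have "cell K \<subseteq> ?Y" using K by blast
      ultimately show False using e by blast
    qed
  qed
  then obtain x K K' where x: "x \<in> \<Omega>" "x \<notin> mesh_vertices T" and K: "K \<in> A" "x \<in> cell K"
    and K': "K' \<in> T" "K' \<notin> A" "x \<in> cell K'" by blast
  have "K \<in> T" "K \<noteq> K'" using K K' A by auto
  from this(1) K'(1) this(2) K(2) K'(3) have "\<exists>i j. edge K' j = edge K i"
  proof (cases rule: intersection_cases)
    case (1 i)
    then show ?thesis using x(2) \<open>K \<in> T\<close> by (auto simp: mesh_vertices_def)
  next
    case (2 i j)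
    then show ?thesis by metis
  qed
  then show False using cl K(1) K' by blast
qed

text \<open>A vertex at which a linear functional is maximal over the domain lies on the boundary.\<close>

lemma boundary_vertex_exists: "\<exists>K\<in>T. \<exists>i. K i \<notin> \<Omega>"
proof -
  let ?P = "(\<lambda>(K, i). K i $ 1) ` (T \<times> (UNIV :: 4 set))"
  have fP: "finite ?P" "?P \<noteq> {}" using finite_mesh mesh_nonempty by auto
  obtain d where d: "d \<in> T \<times> (UNIV :: 4 set)" "Max ?P = (\<lambda>(K, i). K i $ 1) d"
    using imageE[OF Max_in[OF fP]] by metis
  obtain K i where "d = (K, i)" by fastforce
  with d have Ki: "K \<in> T" "K i $ 1 = Max ?P" by auto
  have le: "x $ 1 \<le> K i $ 1" if "x \<in> closure \<Omega>" for x
  proof -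
    obtain K' where K': "K' \<in> T" "x \<in> cell K'" using \<open>x \<in> closure \<Omega>\<close> Union_cells by blast
    have "cell K' \<subseteq> {y. y $ 1 \<le> K i $ 1}" unfolding cell_def
    proof (rule hull_minimal)
      show "range K' \<subseteq> {y. y $ 1 \<le> K i $ 1}"
        unfolding Ki(2) using K'(1) by (auto intro!: Max_ge[OF fP(1)])
      have "{y::real^2. y $ 1 \<le> K i $ 1} = {y. axis 1 1 \<bullet> y \<le> K i $ 1}"
        by (simp add: inner_axis')
      then show "convex {y::real^2. y $ 1 \<le> K i $ 1}" by (simp only: convex_halfspace_le)
    qed
    then show ?thesis using K'(2) by blast
  qed
  have "K i \<notin> \<Omega>"
  proof
    assume "K i \<in> \<Omega>"
    then obtain d where d: "d > 0" "ball (K i) d \<subseteq> \<Omega>"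
      using open_dom unfolding open_contains_ball by blast
    let ?y = "K i + (d/2) *\<^sub>R axis 1 1"
    have "?y \<in> ball (K i) d" using d(1) by (simp add: dist_norm)
    then have "?y $ 1 \<le> K i $ 1" using d(2) closure_subset by (intro le) blast
    then show False using d(1) by (simp add: axis_def)
  qed
  then show ?thesis using Ki(1) by blast
qed

text \<open>The winding potential is a function on the whole plane, so agreement of the cells at a
  common vertex is automatic and only its increments along edges and its zeros need proof.\<close>

lemma potential_exists:
  assumes sc: "simply_connected \<Omega>" and f: "circulation T f"
  shows "\<exists>u. (\<forall>K\<in>T. \<forall>i. u (K (i+1)) - u (K i) = f K i) \<and> (\<forall>a. a \<notin> \<Omega> \<longrightarrow> u a = (0::real))"
proof (intro exI conjI ballI allI impI)
  fix K i assume K: "K \<in> T"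
  show "winding_potential T f (K (i+1)) - winding_potential T f (K i) = f K i"
    by (rule winding_potential_edge[OF finite_mesh f K convex[OF K]])
      (auto intro: dual_segment_off_edge[OF K, THEN equalityD1, THEN subsetD]
        simp: shared_edge_side[OF K])
next
  fix a assume a: "a \<notin> \<Omega>"
  show "winding_potential T f a = 0"
  proof (rule winding_potential_outside[OF finite_mesh f open_dom sc a])
    fix K i assume K: "K \<in> T" and nz: "f K i \<noteq> 0"
    from K show "closed_segment (centre K) (edge_mid K i) \<subseteq> \<Omega>"
    proof (cases rule: edge_cases[of K i])
      case boundary
      have "f K i = 0"
        by (rule f[unfolded circulation_def balanced_edges_iff, THEN conjunct2, THEN bspec[OF _ K],
            THEN spec[of _ i], THEN conjunct2, rule_format]) (rule boundary)
      then show ?thesis using nz by simp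
    next
      case (interior K' j)
      then show ?thesis using dual_segment_in_dom[OF K] by blast
    qed
  qed
qed

end

section \<open>Interpolation on a quadrilateral\<close>

lemma Pk_mult:
  assumes p: "p \<in> Pk k" and q: "q \<in> Pk l" shows "(\<lambda>x. p x * q x) \<in> Pk (k + l)"
proof -
  have S: "fun_subspace (Pk n)" for n by (rule fun_subspace_Pk)
  obtain c where c: "p = (\<lambda>x. \<Sum>i\<le>k. \<Sum>j\<le>k - i. c i j * (x$1) ^ i * (x$2) ^ j)" using p unfolding Pk_def by blast
  obtain d where d: "q = (\<lambda>x. \<Sum>i\<le>l. \<Sum>j\<le>l - i. d i j * (x$1) ^ i * (x$2) ^ j)" using q unfolding Pk_def by blast
  show ?thesis unfolding c d sum_product
  proof (intro fun_subspace_sum[OF S])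
    fix i i' j j' assume "i \<in> {..k}" "i' \<in> {..l}" "j \<in> {..k - i}" "j' \<in> {..l - i'}"
    then have "(i + i') + (j + j') \<le> k + l" by auto
    from fun_subspace_scale[OF S Pk_monomial[OF this], of "c i j * d i' j'"]
    show "(\<lambda>x. c i j * (x$1)^i * (x$2)^j * (d i' j' * (x$1)^i' * (x$2)^j')) \<in> Pk (k + l)"
      by (simp add: power_add mult_ac)
  qed auto
qed

definition affine_fun :: "(real^2 \<Rightarrow> real) \<Rightarrow> bool" where
  "affine_fun p \<longleftrightarrow> (\<exists>a b c. p = (\<lambda>x. a + b * x$1 + c * x$2))"

lemma affine_fun_Pk: "affine_fun p \<longleftrightarrow> p \<in> Pk 1"
  unfolding affine_fun_def Pk_1_iff ..

lemma affine_fun_segment: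
  "affine_fun p \<Longrightarrow> p ((1 - t) *\<^sub>R x + t *\<^sub>R y) = (1 - t) * p x + t * p y"
  by (auto simp: affine_fun_def algebra_simps)

text \<open>The four points satisfy one affine relation, with the areas of the triangles as weights;
  \<open>alt_area\<close> measures how far four values are from those of an affine function.\<close>

definition alt_area :: "quad \<Rightarrow> (4 \<Rightarrow> real) \<Rightarrow> real" where
  "alt_area G \<tau> = cross2 (G 3 - G 2) (G 4 - G 2) * \<tau> 1 - cross2 (G 3 - G 1) (G 4 - G 1) * \<tau> 2
     + cross2 (G 2 - G 1) (G 4 - G 1) * \<tau> 3 - cross2 (G 2 - G 1) (G 3 - G 1) * \<tau> 4"

lemma alt_area_affine: "affine_fun p \<Longrightarrow> alt_area G (\<lambda>i. p (G i)) = 0"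
  by (auto simp: affine_fun_def alt_area_def cross2_def algebra_simps)

lemma affine_fun_cross2: "affine_fun (\<lambda>x. cross2 u (x - v))"
  unfolding affine_fun_def
  by (intro exI[of _ "- u$1 * v$2 + u$2 * v$1"] exI[of _ "- u$2"] exI[of _ "u$1"])
     (simp add: cross2_def fun_eq_iff algebra_simps)

text \<open>The interpolant in barycentric coordinates, written as quotients of signed
  areas.\<close>

lemma affine_interpolation:
  assumes D: "cross2 (b - a) (c - a) \<noteq> 0"
  shows "\<exists>p. affine_fun p \<and> p a = \<alpha> \<and> p b = \<beta> \<and> p c = \<gamma>"
proof -
  let ?D = "cross2 (b - a) (c - a)"
  let ?p = "\<lambda>x. (\<alpha> * cross2 (c - b) (x - b) + \<beta> * cross2 (a - c) (x - c) + \<gamma> * cross2 (b - a) (x - a)) / ?D"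
  have "(\<lambda>x. cross2 u (x - v)) \<in> Pk 1" for u v using affine_fun_cross2 by (simp add: affine_fun_Pk)
  then have "(\<lambda>x. (\<alpha>/?D) *\<^sub>R cross2 (c - b) (x - b) + 1 *\<^sub>R ((\<beta>/?D) *\<^sub>R cross2 (a - c) (x - c)
      + (\<gamma>/?D) *\<^sub>R cross2 (b - a) (x - a))) \<in> Pk 1"
    by (intro fun_subspace_lincomb[OF fun_subspace_Pk])
  then have "?p \<in> Pk 1" by (simp add: add_divide_distrib add.assoc)
  moreover have "cross2 (c - b) (a - b) = ?D" "cross2 (a - c) (b - c) = ?D"
    by (simp_all add: cross2_def algebra_simps)
  then have "?p a = \<alpha>" "?p b = \<beta>" "?p c = \<gamma>"
    using D by (simp_all add: cross2_def)
  ultimately show ?thesis unfolding affine_fun_Pk by blast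
qed

lemma convex_quad_triangles:
  assumes "convex_quad V"
  shows "cross2 (V 3 - V 2) (V 4 - V 2) > 0" "cross2 (V 3 - V 1) (V 4 - V 1) > 0"
    "cross2 (V 2 - V 1) (V 4 - V 1) > 0" "cross2 (V 2 - V 1) (V 3 - V 1) > 0"
  using side_pos(1)[OF assms, of 2] side_pos(1)[OF assms, of 3] side_pos(1)[OF assms, of 4] side_pos(1)[OF assms, of 1]
  by (simp_all add: side_def cross2_def algebra_simps)

text \<open>The coefficient \<open>k\<close> is chosen so that the data minus k \<tau> satisfy the
  affine relation of the four points; the affine function through three of the corrected values then
  fits the fourth by itself.\<close>

lemma quad_interpolation:
  assumes G: "convex_quad G" and \<tau>: "alt_area G \<tau> \<noteq> 0"
  shows "\<exists>p k. affine_fun p \<and> (\<forall>i. p (G i) + k * \<tau> i = t i)"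
proof -
  define k where "k = alt_area G t / alt_area G \<tau>"
  define t' where "t' i = t i - k * \<tau> i" for i
  have "alt_area G t' = alt_area G t - k * alt_area G \<tau>"
    by (simp add: alt_area_def t'_def algebra_simps)
  then have t'0: "alt_area G t' = 0" using \<tau> by (simp add: k_def)
  have D: "cross2 (G 2 - G 1) (G 3 - G 1) \<noteq> 0" using convex_quad_triangles(4)[OF G] by simp
  obtain p where p: "affine_fun p" "p (G 1) = t' 1" "p (G 2) = t' 2" "p (G 3) = t' 3"
    using affine_interpolation[OF D] by metis
  have "cross2 (G 2 - G 1) (G 3 - G 1) * (p (G 4) - t' 4) = 0"
    using alt_area_affine[OF p(1), of G] t'0 unfolding alt_area_def p(2-4) by algebra
  then have "p (G 4) = t' 4" using D by simp
  then have "\<forall>i. p (G i) = t' i" using p(2-4) by (simp add: forall_4)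
  then have "\<forall>i. p (G i) + k * \<tau> i = t i" by (simp add: t'_def)
  with p(1) show ?thesis by blast
qed

section \<open>Edge functions, diagonals and the frame of a quadrilateral\<close>

lemma affine_fun_side: "affine_fun (side V i)"
  unfolding affine_fun_def side_eq[abs_def]
  by (intro exI[of _ "(V (i+1) - V i)$2 * V i$1 - (V (i+1) - V i)$1 * V i$2"]
      exI[of _ "- (V (i+1) - V i)$2"] exI[of _ "(V (i+1) - V i)$1"])
     (simp add: fun_eq_iff inner_vec_def sum_2)

lemma affine_fun_divide: "affine_fun p \<Longrightarrow> affine_fun (\<lambda>x. p x / c)"
  using fun_subspace_scale[OF fun_subspace_Pk, of p 1 "1/c"] by (simp add: affine_fun_Pk)

lemma affine_fun_polynomial: "affine_fun p \<Longrightarrow> real_polynomial_function p"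
  unfolding affine_fun_Pk by (rule real_polynomial_function_Pk)

lemma affine_fun_differentiable: "affine_fun p \<Longrightarrow> p differentiable (at x)"
  by (simp add: affine_fun_polynomial)

lemma lE_eq:
  assumes V: "convex_quad V"
  shows "side V i (edge_mid V (i+2)) > 0" "lE V i = (\<lambda>x. side V i x / side V i (edge_mid V (i+2)))"
proof -
  show p: "side V i (edge_mid V (i+2)) > 0"
    by (rule open_edge_side_pos[OF V edge_mid_in_open_edge[OF V]]) (metis index4_shift(9))
  show "lE V i = (\<lambda>x. side V i x / side V i (edge_mid V (i+2)))"
    unfolding lE_def side_def using p by (intro line_fun_eq) (simp add: side_def)
qed

lemma affine_fun_lE: "convex_quad V \<Longrightarrow> affine_fun (lE V i)"
  by (simp add: lE_eq(2) affine_fun_divide affine_fun_side)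

lemma
  assumes V: "convex_quad V"
  shows l13_eq: "l13 V = (\<lambda>x. cross2 (V 3 - V 1) (x - V 1) / cross2 (V 3 - V 1) (V 4 - V 1))"
    and l24_eq: "l24 V = (\<lambda>x. cross2 (V 4 - V 2) (x - V 2) / cross2 (V 4 - V 2) (V 3 - V 2))"
  unfolding l13_def l24_def using convex_quad_triangles[OF V]
  by (intro line_fun_eq; simp add: cross2_def algebra_simps)+

lemma affine_fun_l13: "convex_quad V \<Longrightarrow> affine_fun (l13 V)"
  and affine_fun_l24: "convex_quad V \<Longrightarrow> affine_fun (l24 V)"
  by (simp_all add: l13_eq l24_eq affine_fun_divide affine_fun_cross2)

lemma l13_vertex:
  assumes V: "convex_quad V"
  shows "l13 V (V 1) = 0" "l13 V (V 3) = 0" "l13 V (V 4) = 1" "l13 V (V 2) < 0"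
proof -
  note p = convex_quad_triangles[OF V]
  show "l13 V (V 1) = 0" "l13 V (V 3) = 0" "l13 V (V 4) = 1" using p by (simp_all add: l13_eq[OF V])
  have "cross2 (V 3 - V 1) (V 2 - V 1) < 0" using p by (simp add: cross2_def algebra_simps)
  then show "l13 V (V 2) < 0" using p by (simp add: l13_eq[OF V] divide_neg_pos)
qed

lemma l24_vertex:
  assumes V: "convex_quad V"
  shows "l24 V (V 2) = 0" "l24 V (V 4) = 0" "l24 V (V 3) = 1" "l24 V (V 1) < 0"
proof -
  note p = convex_quad_triangles[OF V]
  have n: "cross2 (V 4 - V 2) (V 3 - V 2) < 0" using p by (simp add: cross2_def algebra_simps)
  show "l24 V (V 2) = 0" "l24 V (V 4) = 0" "l24 V (V 3) = 1" using n by (simp_all add: l24_eq[OF V])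
  have "cross2 (V 4 - V 2) (V 1 - V 2) > 0" using p by (simp add: cross2_def algebra_simps)
  then show "l24 V (V 1) < 0" using n by (simp add: l24_eq[OF V] divide_pos_neg)
qed

text \<open>The edge midpoints are c \<plusminus> p and c \<plusminus> q, so \<open>c\<close>,
  \<open>p\<close>, \<open>q\<close> is the frame of their parallelogram. The vertices are its
  points c \<plusminus> p \<plusminus> q shifted by d or -d with alternating sign, and
  \<open>s1\<close>, \<open>s2\<close> are the coordinates of d. In these terms strict convexity is
  exactly |s1 + s2| < 1 and |s1 - s2| < 1.\<close>

lemma quad_frame:
  assumes V: "convex_quad V"
  defines "p \<equiv> (1/4) *\<^sub>R (V 3 - V 4 - V 1 + V 2)" and "q \<equiv> (1/4) *\<^sub>R (V 3 + V 4 - V 1 - V 2)"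
    and "c \<equiv> (1/4) *\<^sub>R (V 1 + V 2 + V 3 + V 4)" and "s1 \<equiv> svec V $ 1" and "s2 \<equiv> svec V $ 2"
  shows "cross2 p q > 0" "\<bar>s1 + s2\<bar> < 1" "\<bar>s1 - s2\<bar> < 1"
    "V 1 = c + (s1 - 1) *\<^sub>R p + (s2 - 1) *\<^sub>R q" "V 2 = c + (1 - s1) *\<^sub>R p + (- 1 - s2) *\<^sub>R q"
    "V 3 = c + (1 + s1) *\<^sub>R p + (1 + s2) *\<^sub>R q" "V 4 = c + (- 1 - s1) *\<^sub>R p + (1 - s2) *\<^sub>R q"
    "cross2 (V 3 - V 2) (V 4 - V 2) = cross2 p q * (4 * (1 + (s1 + s2)))"
    "cross2 (V 3 - V 1) (V 4 - V 1) = cross2 p q * (4 * (1 + (s1 - s2)))"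
    "cross2 (V 2 - V 1) (V 4 - V 1) = cross2 p q * (4 * (1 - (s1 + s2)))"
    "cross2 (V 2 - V 1) (V 3 - V 1) = cross2 p q * (4 * (1 - (s1 - s2)))"
proof -
  note tr = convex_quad_triangles[OF V]
  have D8: "cross2 p q * 8 = cross2 (V 3 - V 2) (V 4 - V 2) + cross2 (V 2 - V 1) (V 4 - V 1)"
    by (simp add: p_def q_def cross2_def field_simps)
  then show D: "cross2 p q > 0" using tr by linarith
  have A: "matA V = transpose (vector [p, q])" by (simp add: matA_def p_def q_def)
  have Av: "matA V *v v = v$1 *\<^sub>R p + v$2 *\<^sub>R q" for v
    by (simp add: A vec2_eq_iff matrix_vector_mult_def transpose_def sum_2)
  have "det (matA V) = cross2 p q"
    by (simp add: A det_2 transpose_def cross2_def)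
  then have "invertible (matA V)" using D by (simp add: invertible_det_nz)
  then have "matA V ** matrix_inv (matA V) = mat 1"
    unfolding invertible_def matrix_inv_def by (rule someI2_ex) simp
  then have "matA V *v svec V = vecd V"
    by (simp add: svec_def matrix_vector_mul_assoc)
  then have d: "vecd V = s1 *\<^sub>R p + s2 *\<^sub>R q" by (simp add: Av s1_def s2_def)
  have v: "V 1 = c - p - q + vecd V" "V 2 = c + p - q - vecd V"
    "V 3 = c + p + q + vecd V" "V 4 = c - p + q - vecd V"
    by (simp_all add: c_def p_def q_def vecd_def vec2_eq_iff field_simps)
  show v1: "V 1 = c + (s1 - 1) *\<^sub>R p + (s2 - 1) *\<^sub>R q"
    and v2: "V 2 = c + (1 - s1) *\<^sub>R p + (- 1 - s2) *\<^sub>R q"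
    and v3: "V 3 = c + (1 + s1) *\<^sub>R p + (1 + s2) *\<^sub>R q"
    and v4: "V 4 = c + (- 1 - s1) *\<^sub>R p + (1 - s2) *\<^sub>R q"
    unfolding v d by (simp_all add: algebra_simps)
  show c1: "cross2 (V 3 - V 2) (V 4 - V 2) = cross2 p q * (4 * (1 + (s1 + s2)))"
    and c2: "cross2 (V 3 - V 1) (V 4 - V 1) = cross2 p q * (4 * (1 + (s1 - s2)))"
    and c3: "cross2 (V 2 - V 1) (V 4 - V 1) = cross2 p q * (4 * (1 - (s1 + s2)))"
    and c4: "cross2 (V 2 - V 1) (V 3 - V 1) = cross2 p q * (4 * (1 - (s1 - s2)))"
    unfolding v1 v2 v3 v4 by (simp_all add: cross2_def algebra_simps)
  have "1 + (s1 + s2) > 0" "1 + (s1 - s2) > 0" "1 - (s1 + s2) > 0" "1 - (s1 - s2) > 0"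
    using tr D unfolding c1 c2 c3 c4 by (auto simp: zero_less_mult_iff)
  then show "\<bar>s1 + s2\<bar> < 1" "\<bar>s1 - s2\<bar> < 1" by linarith+
qed

text \<open>In the frame of \<open>quad_frame\<close> the functions \<open>m13\<close> and
  \<open>m24\<close> are the coordinates along \<open>p\<close> and \<open>q\<close>, so their
  vertex values can be read off.\<close>

lemma m13_m24_vertex:
  assumes V: "convex_quad V"
  defines "s1 \<equiv> svec V $ 1" and "s2 \<equiv> svec V $ 2"
  shows "m13 V (V 1) = s1 - 1" "m13 V (V 2) = 1 - s1" "m13 V (V 3) = 1 + s1" "m13 V (V 4) = - 1 - s1"
    "m24 V (V 1) = s2 - 1" "m24 V (V 2) = - 1 - s2" "m24 V (V 3) = 1 + s2" "m24 V (V 4) = 1 - s2"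
    and affine_fun_m13: "affine_fun (m13 V)" and affine_fun_m24: "affine_fun (m24 V)"
proof -
  define p q c where "p = (1/4) *\<^sub>R (V 3 - V 4 - V 1 + V 2)" and "q = (1/4) *\<^sub>R (V 3 + V 4 - V 1 - V 2)"
    and "c = (1/4) *\<^sub>R (V 1 + V 2 + V 3 + V 4)"
  note f = quad_frame[OF V, folded p_def q_def c_def s1_def s2_def]
  have D: "cross2 p q > 0" by (rule f(1))
  have M: "edge_mid V 1 = c - q" "edge_mid V 2 = c + p" "edge_mid V 3 = c + q" "edge_mid V 4 = c - p"
    unfolding edge_mid_def index4 f(4-7) by (simp_all add: midpoint_def vec2_eq_iff algebra_simps)
  have "m13 V = (\<lambda>x. cross2 ((c + q) - (c - q)) (x - (c - q)) / cross2 ((c + q) - (c - q)) ((c + p) - (c - q)))"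
    unfolding m13_def M using D by (intro line_fun_eq) (simp add: cross2_def algebra_simps)
  also have "\<dots> = (\<lambda>x. cross2 (- q) (x - c) / cross2 p q)"
    using D by (simp add: fun_eq_iff cross2_def field_simps)
  finally have m13: "m13 V = (\<lambda>x. cross2 (- q) (x - c) / cross2 p q)" .
  have "m24 V = (\<lambda>x. cross2 ((c - p) - (c + p)) (x - (c + p)) / cross2 ((c - p) - (c + p)) ((c + q) - (c + p)))"
    unfolding m24_def M using D by (intro line_fun_eq) (simp add: cross2_def algebra_simps)
  also have "\<dots> = (\<lambda>x. cross2 p (x - c) / cross2 p q)"
    using D by (simp add: fun_eq_iff cross2_def field_simps)
  finally have m24: "m24 V = (\<lambda>x. cross2 p (x - c) / cross2 p q)" .
  show "affine_fun (m13 V)" "affine_fun (m24 V)"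
    unfolding m13 m24 by (intro affine_fun_divide affine_fun_cross2)+
  have a: "m13 V (c + x *\<^sub>R p + y *\<^sub>R q) = x" "m24 V (c + x *\<^sub>R p + y *\<^sub>R q) = y" for x y
  proof -
    have "cross2 (- q) (c + x *\<^sub>R p + y *\<^sub>R q - c) = x * cross2 p q"
      "cross2 p (c + x *\<^sub>R p + y *\<^sub>R q - c) = y * cross2 p q"
      by (simp_all add: cross2_def algebra_simps)
    then show "m13 V (c + x *\<^sub>R p + y *\<^sub>R q) = x" "m24 V (c + x *\<^sub>R p + y *\<^sub>R q) = y"
      unfolding m13 m24 using D by simp_all
  qed
  show "m13 V (V 1) = s1 - 1" "m13 V (V 2) = 1 - s1" "m13 V (V 3) = 1 + s1" "m13 V (V 4) = - 1 - s1"
    "m24 V (V 1) = s2 - 1" "m24 V (V 2) = - 1 - s2" "m24 V (V 3) = 1 + s2" "m24 V (V 4) = 1 - s2"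
    unfolding f(4-7) by (rule a)+
qed

text \<open>What remains of \<open>phi1\<close> after splitting off
  \<open>lE V 1 x * lE V 3 x\<close>. Since that product vanishes at the vertices, only the vertex
  values of this factor enter the gradients there.\<close>

definition psi1 :: "quad \<Rightarrow> real^2 \<Rightarrow> real" where
  "psi1 V x = (let s1 = svec V $ 1; s2 = svec V $ 2 in
     (s2 - 1) * (s2 + 1) * m13 V x * m24 V x - s1 * s2 * (m24 V x)\<^sup>2 + s1 * (m24 V x)\<^sup>2 * m13 V x)"

definition psi2 :: "quad \<Rightarrow> real^2 \<Rightarrow> real" where
  "psi2 V x = (let s1 = svec V $ 1; s2 = svec V $ 2 in
     (s1 - 1) * (s1 + 1) * m13 V x * m24 V x - s1 * s2 * (m13 V x)\<^sup>2 + s2 * (m13 V x)\<^sup>2 * m24 V x)"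

lemma phi_psi: "phi1 V = (\<lambda>x. lE V 1 x * lE V 3 x * psi1 V x)" "phi2 V = (\<lambda>x. lE V 2 x * lE V 4 x * psi2 V x)"
  by (simp_all add: phi1_def phi2_def psi1_def psi2_def Let_def fun_eq_iff algebra_simps)

lemma polynomial_psi: 
  assumes V: "convex_quad V"
  shows "real_polynomial_function (psi1 V)" "real_polynomial_function (psi2 V)"
  using affine_fun_polynomial[OF affine_fun_m13[OF V]] affine_fun_polynomial[OF affine_fun_m24[OF V]]
  unfolding psi1_def[abs_def] psi2_def[abs_def] Let_def
  by (auto intro!: real_polynomial_function.intros(2-) real_polynomial_function_diff real_polynomial_function_power)

text \<open>With all vertex values expressed by \<open>s1\<close> and \<open>s2\<close> the affine
  relation evaluates to a product. Its factors are nonzero because s1^2 + s2^2 is the mean of (s1 +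
  s2)^2 and (s1 - s2)^2, both below 1 by convexity.\<close>

lemma alt_area_psi:
  assumes V: "convex_quad V"
  shows "alt_area V (\<lambda>i. psi1 V (V i)) \<noteq> 0" "alt_area V (\<lambda>i. psi2 V (V i)) \<noteq> 0"
proof -
  define p q c s1 s2 where "p = (1/4) *\<^sub>R (V 3 - V 4 - V 1 + V 2)" and "q = (1/4) *\<^sub>R (V 3 + V 4 - V 1 - V 2)"
    and "c = (1/4) *\<^sub>R (V 1 + V 2 + V 3 + V 4)" and s: "s1 = svec V $ 1" "s2 = svec V $ 2"
  note f = quad_frame[OF V, folded p_def q_def c_def s]
  note m = m13_m24_vertex(1-8)[OF V, folded s]
  have D: "cross2 p q > 0" by (rule f(1))
  have sq: "(s1 + s2)\<^sup>2 < 1" "(s1 - s2)\<^sup>2 < 1" using f(2,3) by (simp_all add: abs_square_less_1)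
  have "(s1 + s2)\<^sup>2 + (s1 - s2)\<^sup>2 = 2 * (s1\<^sup>2 + s2\<^sup>2)" by (simp add: power2_eq_square algebra_simps)
  then have lt: "s1\<^sup>2 + s2\<^sup>2 < 1" using sq by argo
  then have lt': "s1\<^sup>2 < 1" "s2\<^sup>2 < 1" using zero_le_power2[of s1] zero_le_power2[of s2] by linarith+
  have "alt_area V (\<lambda>i. psi1 V (V i)) = - 16 * cross2 p q * (1 - s2\<^sup>2) * (1 - s1\<^sup>2 - s2\<^sup>2)"
    unfolding alt_area_def f(8-11) psi1_def Let_def m s[symmetric] by algebra
  then show "alt_area V (\<lambda>i. psi1 V (V i)) \<noteq> 0" using D lt lt' by simp
  have "alt_area V (\<lambda>i. psi2 V (V i)) = - 16 * cross2 p q * (1 - s1\<^sup>2) * (1 - s1\<^sup>2 - s2\<^sup>2)"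
    unfolding alt_area_def f(8-11) psi2_def Let_def m s[symmetric] by algebra
  then show "alt_area V (\<lambda>i. psi2 V (V i)) \<noteq> 0" using D lt lt' by simp
qed

text \<open>Each turn of the inscribed quadrilateral expands into a combination of the areas of the
  four triangles of \<open>V\<close> with positive coefficients.\<close>

lemma convex_quad_edge_points:
  assumes V: "convex_quad V" and t: "\<And>i. 0 < t i" "\<And>i. t i < 1"
  shows "convex_quad (\<lambda>i. (1 - t i) *\<^sub>R V i + t i *\<^sub>R V (i+1))" (is "convex_quad ?G")
  unfolding convex_quad_def
proof
  fix i
  define a b c where "a = t i" and "b = t (i+1)" and "c = t (i+2)"
  define A B C D where "A = V i" and "B = V (i+1)" and "C = V (i+2)" and "D = V (i+3)"
  define ar1 ar2 ar3 ar4 where "ar1 = cross2 (B - A) (C - A)" and "ar2 = cross2 (B - A) (D - A)"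
    and "ar3 = cross2 (C - A) (D - A)" and "ar4 = cross2 (C - B) (D - B)"
  have o: "ar1 > 0" "ar2 > 0" "ar3 > 0" "ar4 > 0"
    using side_pos[OF V, of i] side_pos[OF V, of "i+1"] side_pos(2)[OF V, of "i+2"] side_pos(1)[OF V, of "i+2"]
    by (auto simp: ar1_def ar2_def ar3_def ar4_def A_def B_def C_def D_def side_def cross2_def index4_shift algebra_simps)
  have abc: "0 < a" "0 < b" "0 < c" "0 < 1 - a" "0 < 1 - b" "0 < 1 - c"
    using t by (auto simp: a_def b_def c_def)
  have "cross2 (?G (i+1) - ?G i) (?G (i+2) - ?G (i+1))
      = (1-a)*(1-b)*(1-c)*ar1 + (1-a)*(1-b)*c*ar2 + (1-a)*b*c*ar3 + a*b*c*ar4"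
    unfolding ar1_def ar2_def ar3_def ar4_def
    by (simp add: index4_shift cross2_def flip: a_def b_def c_def A_def B_def C_def D_def) algebra
  also have "\<dots> > 0" using o abc by (intro add_pos_pos mult_pos_pos)
  finally show "0 < cross2 (?G (i+1) - ?G i) (?G (i+2) - ?G (i+1))" .
qed

section \<open>Hermite data\<close>

lemma differentiable_lE: "convex_quad V \<Longrightarrow> lE V i differentiable (at x)"
  by (simp add: affine_fun_differentiable affine_fun_lE)

lemma pderiv2_lE:
  assumes V: "convex_quad V"
  shows "pderiv2 1 (lE V i) x = - (V (i+1) - V i) $ 2 / side V i (edge_mid V (i+2))"
    and "pderiv2 2 (lE V i) x = (V (i+1) - V i) $ 1 / side V i (edge_mid V (i+2))"
proof -
  let ?c = "side V i (edge_mid V (i+2))" and ?n = "vector [- (V (i+1) - V i)$2, (V (i+1) - V i)$1] :: real^2"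
  have "((\<lambda>x. (?n \<bullet> x + ((V (i+1) - V i)$2 * V i$1 - (V (i+1) - V i)$1 * V i$2)) / ?c)
      has_derivative (\<lambda>h. ?n \<bullet> h / ?c)) (at x)"
    using lE_eq(1)[OF V, of i] by (auto intro!: derivative_eq_intros)
  then have d: "(lE V i has_derivative (\<lambda>h. ?n \<bullet> h / ?c)) (at x)"
    unfolding lE_eq(2)[OF V] side_eq .
  show "pderiv2 1 (lE V i) x = - (V (i+1) - V i) $ 2 / ?c"
    and "pderiv2 2 (lE V i) x = (V (i+1) - V i) $ 1 / ?c"
    unfolding pderiv2_eqI[OF d] by (simp_all add: inner_axis)
qed

lemma lE_vertex:
  assumes V: "convex_quad V"
  shows "lE V i (V i) = 0" "lE V i (V (i+1)) = 0" "lE V i (V (i+2)) > 0" "lE V i (V (i+3)) > 0"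
  unfolding lE_eq(2)[OF V] using lE_eq(1)[OF V, of i] side_pos[OF V, of i] by simp_all

lemma lE_vertices:
  assumes V: "convex_quad V"
  shows "lE V 1 (V 1) = 0" "lE V 1 (V 2) = 0" "lE V 1 (V 3) > 0" "lE V 1 (V 4) > 0"
    "lE V 2 (V 2) = 0" "lE V 2 (V 3) = 0" "lE V 2 (V 4) > 0" "lE V 2 (V 1) > 0"
    "lE V 3 (V 3) = 0" "lE V 3 (V 4) = 0" "lE V 3 (V 1) > 0" "lE V 3 (V 2) > 0"
    "lE V 4 (V 4) = 0" "lE V 4 (V 1) = 0" "lE V 4 (V 2) > 0" "lE V 4 (V 3) > 0"
  using lE_vertex[OF V, of 1] lE_vertex[OF V, of 2] lE_vertex[OF V, of 3] lE_vertex[OF V, of 4]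
  by simp_all

text \<open>Up to a nonzero normalization the determinant is the turn of the polygon at
  \<open>V i\<close>.\<close>

lemma adjacent_gradients_independent:
  assumes V: "convex_quad V"
  shows "pderiv2 1 (lE V i) x * pderiv2 2 (lE V (i+3)) x - pderiv2 2 (lE V i) x * pderiv2 1 (lE V (i+3)) x \<noteq> 0"
proof -
  let ?c = "side V i (edge_mid V (i+2))" and ?d = "side V (i+3) (edge_mid V (i+3+2))"
  have "cross2 (V (i+3+1) - V (i+3)) (V (i+3+2) - V (i+3+1)) > 0"
    using V unfolding convex_quad_def by blast
  then have p: "cross2 (V i - V (i+3)) (V (i+1) - V i) > 0" by (simp add: index4_shift)
  have "pderiv2 1 (lE V i) x * pderiv2 2 (lE V (i+3)) x - pderiv2 2 (lE V i) x * pderiv2 1 (lE V (i+3)) x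
      = - (cross2 (V i - V (i+3)) (V (i+1) - V i) / (?c * ?d))"
  proof -
    have "(- u2 / c) * (w1 / d) - (u1 / c) * (- w2 / d) = - ((w1 * u2 - w2 * u1) / (c * d))"
      for u1 u2 w1 w2 c d :: real by (simp add: diff_divide_distrib mult_ac)
    then show ?thesis unfolding pderiv2_lE[OF V] index4_shift cross2_def .
  qed
  then show ?thesis using p lE_eq(1)[OF V, of i] lE_eq(1)[OF V, of "i+3"] by simp
qed

lemma WKminus_cubic: "p \<in> Pk 3 \<Longrightarrow> p \<in> WKminus V"
  unfolding WKminus_def using fun_sumI[OF _ fun_span_0, of p "Pk 3"] by simp

lemma fun_subspace_WKminus: "fun_subspace (WKminus V)" and fun_subspace_WKb: "fun_subspace (WKb V)"
  unfolding WKminus_def WKb_def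
  by (intro fun_subspace_fun_sum fun_subspace_fun_span fun_subspace_Pk)+

lemma real_polynomial_fun_span:
  assumes "f \<in> fun_span B" "\<And>b. b \<in> B \<Longrightarrow> real_polynomial_function b"
  shows "real_polynomial_function f"
  using assms(1)
proof (induction rule: fun_span_induct)
  case (add b c g)
  then show ?case
    by (auto intro!: real_polynomial_function.intros(2-) intro: assms(2))
qed (rule real_polynomial_function.intros(2))

lemma polynomial_lE: "convex_quad V \<Longrightarrow> real_polynomial_function (lE V i)"
  by (simp add: affine_fun_polynomial affine_fun_lE)

lemma polynomial_phi:
  assumes V: "convex_quad V"
  shows "real_polynomial_function (phi1 V)" "real_polynomial_function (phi2 V)"
  unfolding phi_psi using polynomial_lE[OF V] polynomial_psi[OF V]
  by (auto intro!: real_polynomial_function.intros(4))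

lemma polynomial_b0: "convex_quad V \<Longrightarrow> real_polynomial_function (b0 V)"
  unfolding b0_def[abs_def] by (intro real_polynomial_function.intros(4) polynomial_lE)

lemma polynomial_WKminus:
  assumes V: "convex_quad V" and w: "w \<in> WKminus V" shows "real_polynomial_function w"
proof -
  obtain f g where fg: "f \<in> Pk 3" "g \<in> fun_span {phi1 V, phi2 V}" "w = (\<lambda>x. f x + g x)"
    using w unfolding WKminus_def by (rule fun_sumE)
  have "real_polynomial_function g"
    by (rule real_polynomial_fun_span[OF fg(2)]) (use polynomial_phi[OF V] in auto)
  then show ?thesis
    unfolding fg(3) by (intro real_polynomial_function.intros(3) real_polynomial_function_Pk[OF fg(1)])
qed

lemma polynomial_WKb:
  assumes V: "convex_quad V" and w: "w \<in> WKb V" shows "real_polynomial_function w"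
proof -
  note p = polynomial_b0[OF V] affine_fun_polynomial[OF affine_fun_l13[OF V]]
    affine_fun_polynomial[OF affine_fun_l24[OF V]]
  show ?thesis
    using w unfolding WKb_def
    by (rule real_polynomial_fun_span) (auto intro!: real_polynomial_function.intros(4) p)
qed

lemma polynomial_WK_sum:
  assumes V: "convex_quad V" and w: "w \<in> fun_sum (WKminus V) (WKb V)"
  shows "real_polynomial_function w"
proof -
  obtain f g where fg: "f \<in> WKminus V" "g \<in> WKb V" "w = (\<lambda>x. f x + g x)"
    using w by (rule fun_sumE)
  show ?thesis unfolding fg(3)
    by (intro real_polynomial_function.intros(3) polynomial_WKminus[OF V] polynomial_WKb[OF V] fg)
qed

text \<open>At a vertex the gradient of \<open>l\<^sub>1 l\<^sub>3 q + l\<^sub>2 l\<^sub>4 r\<close> is a combination of two independent vectors with the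
  values of \<open>q\<close> and \<open>r\<close> as coefficients, so it suffices to interpolate vertex values with
  \<open>q \<in> P\<^sub>1 + span \<psi>\<^sub>1\<close> and \<open>r \<in> P\<^sub>1 + span \<psi>\<^sub>2\<close>.\<close>

lemma hermite_gradient:
  fixes g :: "4 \<Rightarrow> real^2"
  assumes V: "convex_quad V"
  shows "\<exists>w\<in>WKminus V. \<forall>k. w (V k) = 0 \<and> pderiv2 1 w (V k) = g k $ 1 \<and> pderiv2 2 w (V k) = g k $ 2"
proof -
  define A B where "A x = lE V 1 x * lE V 3 x" and "B x = lE V 2 x * lE V 4 x" for x
  note dl = differentiable_lE[OF V]
  have dA: "A differentiable (at x)" "B differentiable (at x)" for x
    unfolding A_def[abs_def] B_def[abs_def] by (intro differentiable_mult dl)+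
  have pA: "pderiv2 j A x = lE V 1 x * pderiv2 j (lE V 3) x + pderiv2 j (lE V 1) x * lE V 3 x"
    and pB: "pderiv2 j B x = lE V 2 x * pderiv2 j (lE V 4) x + pderiv2 j (lE V 2) x * lE V 4 x" for j x
    unfolding A_def[abs_def] B_def[abs_def] by (intro pderiv2_mult dl)+
  note lv = lE_vertices[OF V]
  have AB0: "A (V k) = 0 \<and> B (V k) = 0" for k
    using exhaust_4[of k] lv by (auto simp: A_def B_def)
  \<comment> \<open>At a vertex one factor of \<open>A\<close> and one of \<open>B\<close> vanish,
    those of the two adjacent edges. The gradients of \<open>A\<close> and \<open>B\<close> are
    therefore multiples of the gradients of these two factors, with the nonzero values of the other
    two as coefficients.\<close>
  have det: "pderiv2 1 A (V k) * pderiv2 2 B (V k) - pderiv2 2 A (V k) * pderiv2 1 B (V k) \<noteq> 0" for k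
  proof -
    note adj = adjacent_gradients_independent[OF V, of k "V k"]
    consider "k = 1" | "k = 2" | "k = 3" | "k = 4" using exhaust_4[of k] by blast
    then show ?thesis
    proof cases
      case 1
      have "pderiv2 1 A (V k) * pderiv2 2 B (V k) - pderiv2 2 A (V k) * pderiv2 1 B (V k)
        = lE V 3 (V k) * lE V 2 (V k) * (pderiv2 1 (lE V k) (V k) * pderiv2 2 (lE V (k+3)) (V k)
            - pderiv2 2 (lE V k) (V k) * pderiv2 1 (lE V (k+3)) (V k))"
        unfolding 1 pA pB by (simp add: lv algebra_simps)
      then show ?thesis using adj 1 lv by simp
    next
      case 2
      have "pderiv2 1 A (V k) * pderiv2 2 B (V k) - pderiv2 2 A (V k) * pderiv2 1 B (V k)
        = - (lE V 3 (V k) * lE V 4 (V k)) * (pderiv2 1 (lE V k) (V k) * pderiv2 2 (lE V (k+3)) (V k)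
            - pderiv2 2 (lE V k) (V k) * pderiv2 1 (lE V (k+3)) (V k))"
        unfolding 2 pA pB by (simp add: lv algebra_simps)
      then show ?thesis using adj 2 lv by simp
    next
      case 3
      have "pderiv2 1 A (V k) * pderiv2 2 B (V k) - pderiv2 2 A (V k) * pderiv2 1 B (V k)
        = lE V 1 (V k) * lE V 4 (V k) * (pderiv2 1 (lE V k) (V k) * pderiv2 2 (lE V (k+3)) (V k)
            - pderiv2 2 (lE V k) (V k) * pderiv2 1 (lE V (k+3)) (V k))"
        unfolding 3 pA pB by (simp add: lv algebra_simps)
      then show ?thesis using adj 3 lv by simp
    next
      case 4
      have "pderiv2 1 A (V k) * pderiv2 2 B (V k) - pderiv2 2 A (V k) * pderiv2 1 B (V k)
        = - (lE V 1 (V k) * lE V 2 (V k)) * (pderiv2 1 (lE V k) (V k) * pderiv2 2 (lE V (k+3)) (V k)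
            - pderiv2 2 (lE V k) (V k) * pderiv2 1 (lE V (k+3)) (V k))"
        unfolding 4 pA pB by (simp add: lv algebra_simps)
      then show ?thesis using adj 4 lv by simp
    qed
  qed
  define D where "D k = pderiv2 1 A (V k) * pderiv2 2 B (V k) - pderiv2 2 A (V k) * pderiv2 1 B (V k)" for k
  \<comment> \<open>Cramer's rule for the 2 by 2 system that expresses \<open>g k\<close> by the
    gradients of \<open>A\<close> and \<open>B\<close>.\<close>
  define \<alpha> \<beta> where "\<alpha> k = (g k $ 1 * pderiv2 2 B (V k) - g k $ 2 * pderiv2 1 B (V k)) / D k"
    and "\<beta> k = (pderiv2 1 A (V k) * g k $ 2 - pderiv2 2 A (V k) * g k $ 1) / D k" for k
  have D: "D k \<noteq> 0" for k using det by (simp add: D_def)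
  have sol: "pderiv2 1 A (V k) * \<alpha> k + pderiv2 1 B (V k) * \<beta> k = g k $ 1"
    "pderiv2 2 A (V k) * \<alpha> k + pderiv2 2 B (V k) * \<beta> k = g k $ 2" for k
  proof -
    let ?n = "g k $ 1 * pderiv2 2 B (V k) - g k $ 2 * pderiv2 1 B (V k)"
      and ?m = "pderiv2 1 A (V k) * g k $ 2 - pderiv2 2 A (V k) * g k $ 1"
    have "pderiv2 1 A (V k) * ?n + pderiv2 1 B (V k) * ?m = g k $ 1 * D k"
      "pderiv2 2 A (V k) * ?n + pderiv2 2 B (V k) * ?m = g k $ 2 * D k"
      unfolding D_def by algebra+
    moreover have "x * (?n / D k) + y * (?m / D k) = (x * ?n + y * ?m) / D k" for x y
      by (simp add: add_divide_distrib)
    ultimately show "pderiv2 1 A (V k) * \<alpha> k + pderiv2 1 B (V k) * \<beta> k = g k $ 1"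
      "pderiv2 2 A (V k) * \<alpha> k + pderiv2 2 B (V k) * \<beta> k = g k $ 2"
      unfolding \<alpha>_def \<beta>_def using D[of k] by simp_all
  qed
  obtain q c where q: "affine_fun q" "\<And>k. q (V k) + c * psi1 V (V k) = \<alpha> k"
    using quad_interpolation[OF V alt_area_psi(1)[OF V]] by metis
  obtain r d where r: "affine_fun r" "\<And>k. r (V k) + d * psi2 V (V k) = \<beta> k"
    using quad_interpolation[OF V alt_area_psi(2)[OF V]] by metis
  define Q R where "Q x = q x + c * psi1 V x" and "R x = r x + d * psi2 V x" for x
  have polQ: "real_polynomial_function Q" "real_polynomial_function R"
    unfolding Q_def[abs_def] R_def[abs_def]
    by (intro real_polynomial_function.intros(2-) affine_fun_polynomial q r polynomial_psi V)+
  then have dQ: "Q differentiable (at x)" "R differentiable (at x)" for x by auto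
  define w where "w x = A x * Q x + B x * R x" for x
  have AP: "A \<in> Pk 2" "B \<in> Pk 2"
    unfolding A_def[abs_def] B_def[abs_def]
    using Pk_mult[of _ 1 _ 1] affine_fun_lE[OF V] unfolding affine_fun_Pk by (simp_all add: numeral_2_eq_2)
  have "(\<lambda>x. A x * q x) \<in> Pk 3" "(\<lambda>x. B x * r x) \<in> Pk 3"
    using Pk_mult[OF AP(1), of q 1] Pk_mult[OF AP(2), of r 1] q(1) r(1) unfolding affine_fun_Pk by simp_all
  then have "(\<lambda>x. A x * q x + B x * r x) \<in> Pk 3" by (intro fun_subspace_add[OF fun_subspace_Pk])
  moreover have "(\<lambda>x. c *\<^sub>R phi1 V x + d *\<^sub>R phi2 V x) \<in> fun_span {phi1 V, phi2 V}"
    by (intro fun_subspace_lincomb[OF fun_subspace_fun_span] fun_span_base) auto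
  ultimately have "(\<lambda>x. (A x * q x + B x * r x) + (c *\<^sub>R phi1 V x + d *\<^sub>R phi2 V x)) \<in> WKminus V"
    unfolding WKminus_def by (rule fun_sumI)
  then have "w \<in> WKminus V"
    by (simp add: w_def[abs_def] Q_def R_def phi_psi A_def B_def algebra_simps)
  moreover have "w (V k) = 0" for k using AB0[of k] by (simp add: w_def)
  moreover have "pderiv2 j w (V k) = pderiv2 j A (V k) * \<alpha> k + pderiv2 j B (V k) * \<beta> k" for j k
  proof -
    have "pderiv2 j w (V k) = (A (V k) * pderiv2 j Q (V k) + pderiv2 j A (V k) * Q (V k))
        + (B (V k) * pderiv2 j R (V k) + pderiv2 j B (V k) * R (V k))"
      unfolding w_def[abs_def] by (simp add: pderiv2_add pderiv2_mult dA dQ differentiable_mult)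
    then show ?thesis using AB0[of k] q(2)[of k] r(2)[of k] by (simp add: Q_def R_def)
  qed
  ultimately show ?thesis using sol by (metis (no_types, lifting))
qed

text \<open>The values come first, from P_1 plus the square of \<open>l13\<close>: it vanishes at
  \<open>V 1\<close> and \<open>V 3\<close> and is positive at \<open>V 2\<close> and
  \<open>V 4\<close>, which have equal signs in the affine relation. The gradients are then
  corrected by a function that is zero at the vertices.\<close>

lemma hermite_WKminus:
  fixes g :: "4 \<Rightarrow> real^2"
  assumes V: "convex_quad V"
  shows "\<exists>w\<in>WKminus V. \<forall>k. w (V k) = a k \<and> pderiv2 1 w (V k) = g k $ 1 \<and> pderiv2 2 w (V k) = g k $ 2"
proof -
  note l = l13_vertex[OF V]
  note tr = convex_quad_triangles[OF V]
  have "alt_area V (\<lambda>i. (l13 V (V i))\<^sup>2) < 0"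
  proof -
    have "(l13 V (V 2))\<^sup>2 > 0" using l(4) by simp
    then have "cross2 (V 3 - V 1) (V 4 - V 1) * (l13 V (V 2))\<^sup>2 > 0" using tr by simp
    then show ?thesis using tr l(1-3) by (simp add: alt_area_def)
  qed
  then obtain p c where p: "affine_fun p" "\<And>k. p (V k) + c * (l13 V (V k))\<^sup>2 = a k"
    using quad_interpolation[OF V, of "\<lambda>i. (l13 V (V i))\<^sup>2" a] by auto
  define w0 where "w0 x = p x + c * (l13 V x)\<^sup>2" for x
  have "(\<lambda>x. l13 V x * l13 V x) \<in> Pk 2"
    using Pk_mult[of "l13 V" 1 "l13 V" 1] affine_fun_l13[OF V] unfolding affine_fun_Pk by (simp add: numeral_2_eq_2)
  then have l3: "(\<lambda>x. l13 V x * l13 V x) \<in> Pk 3" using Pk_mono[of 2 3] by auto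
  have "p \<in> Pk 3" using p(1) Pk_mono[of 1 3] unfolding affine_fun_Pk by auto
  from fun_subspace_lincomb[OF fun_subspace_Pk this l3, of 1 c] have w0P: "w0 \<in> Pk 3"
    by (simp add: w0_def[abs_def] power2_eq_square)
  obtain w1 where w1: "w1 \<in> WKminus V" "\<And>k. w1 (V k) = 0"
      "\<And>k. pderiv2 1 w1 (V k) = g k $ 1 - pderiv2 1 w0 (V k)"
      "\<And>k. pderiv2 2 w1 (V k) = g k $ 2 - pderiv2 2 w0 (V k)"
    using hermite_gradient[OF V, of "\<lambda>k. vector [g k $ 1 - pderiv2 1 w0 (V k), g k $ 2 - pderiv2 2 w0 (V k)]"]
    by auto
  have d: "w0 differentiable (at x)" "w1 differentiable (at x)" for x
    using real_polynomial_function_Pk[OF w0P] polynomial_WKminus[OF V w1(1)] by auto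
  have "(\<lambda>x. w0 x + w1 x) \<in> WKminus V"
    by (intro fun_subspace_add[OF fun_subspace_WKminus] WKminus_cubic w0P w1(1))
  moreover have "\<forall>k. w0 (V k) + w1 (V k) = a k" using p(2) w1(2) by (simp add: w0_def)
  ultimately show ?thesis using w1(3,4) d by (intro bexI[of _ "\<lambda>x. w0 x + w1 x"]) (auto simp: pderiv2_add)
qed

text \<open>One functional serves both local spaces: as the tangential component of curl w is minus
  the normal derivative of w, the edge constraint of W_K on w is the constraint of V_K on curl
  w.\<close>

definition tangential_defect :: "quad \<Rightarrow> (real^2 \<Rightarrow> real^2) \<Rightarrow> 4 \<Rightarrow> real" where
  "tangential_defect V v i = integral {0..1} (\<lambda>t. v (linepath (V i) (V (i+1)) t) \<bullet> edge_tangent V i)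
     - 1/2 * ((v (V i) + v (V (i+1))) \<bullet> edge_tangent V i)"

lemma VK_iff:
  assumes V: "convex_quad V"
  shows "v \<in> VK V \<longleftrightarrow> v \<in> fun_sum (VKminus V) (VKb V) \<and> (\<forall>i. tangential_defect V v i = 0)"
  using dist_pos[OF V] by (auto simp: VK_def tangential_defect_def seg_integral_def less_imp_neq[symmetric])

lemma curl_tangent:
  assumes "w differentiable (at x)"
  shows "curl w x \<bullet> edge_tangent V i = - dir_deriv w (edge_normal V i) x"
  by (simp add: dir_deriv_eq[OF assms] curl_def edge_normal_def inner_vec_def sum_2)

lemma WK_iff:
  assumes V: "convex_quad V"
  shows "w \<in> WK V \<longleftrightarrow> w \<in> fun_sum (WKminus V) (WKb V) \<and> (\<forall>i. tangential_defect V (curl w) i = 0)"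
proof -
  have "1 / dist (V i) (V (i+1)) * seg_integral (V i) (V (i+1)) (dir_deriv w (edge_normal V i))
     = 1/2 * (dir_deriv w (edge_normal V i) (V i) + dir_deriv w (edge_normal V i) (V (i+1)))
     \<longleftrightarrow> tangential_defect V (curl w) i = 0" if "w \<in> fun_sum (WKminus V) (WKb V)" for i
  proof -
    have "real_polynomial_function w" by (rule polynomial_WK_sum[OF V that])
    then have d: "w differentiable (at x)" for x by simp
    show ?thesis using dist_pos[OF V, of i]
      by (simp add: tangential_defect_def seg_integral_def inner_add_left curl_tangent[OF d] less_imp_neq[symmetric])
         argo
  qed
  then show ?thesis unfolding WK_def by auto
qed

lemma tangential_defect_lincomb:
  assumes "polynomial_function f" "polynomial_function g"
  shows "tangential_defect V (\<lambda>x. a *\<^sub>R f x + b *\<^sub>R g x) i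
    = a * tangential_defect V f i + b * tangential_defect V g i"
proof -
  have c: "(\<lambda>t. f (linepath (V i) (V (i+1)) t) \<bullet> edge_tangent V i) integrable_on {0..1}"
    if "polynomial_function f" for f
    by (intro integrable_continuous_real continuous_on_inner continuous_on_const
        continuous_on_compose2[OF continuous_on_polymonial_function[OF that, of UNIV]]
        continuous_on_linepath) auto
  show ?thesis unfolding tangential_defect_def
    using integral_unique[OF has_integral_add[OF
          has_integral_mult_right[OF integrable_integral[OF c[OF assms(1)]], of a]
          has_integral_mult_right[OF integrable_integral[OF c[OF assms(2)]], of b]]]
    by (simp add: inner_add_left algebra_simps)
qed

text \<open>The inequalities place the mean of t under the weight \<omega> strictly between 0 and 1.
  Positivity is only asked inside the interval, because the bubble weights vanish at the ends of an
  edge.\<close>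

lemma weighted_mean:
  fixes \<omega> :: "real \<Rightarrow> real"
  assumes c: "continuous_on {0..1} \<omega>" and pos: "\<And>t. 0 < t \<Longrightarrow> t < 1 \<Longrightarrow> \<omega> t > 0"
  shows "integral {0..1} \<omega> > 0" "integral {0..1} (\<lambda>t. \<omega> t * t) > 0"
    "integral {0..1} (\<lambda>t. \<omega> t * t) < integral {0..1} \<omega>"
proof -
  have gen: "integral {0..1} f > 0" if f: "continuous_on {0..1} f" and p: "\<And>t. 0 < t \<Longrightarrow> t < 1 \<Longrightarrow> f t > 0"
    for f :: "real \<Rightarrow> real"
  proof -
    have n: "f t \<ge> 0" if "t \<in> {0..1}" for t
    proof (rule continuous_ge_on_closure[of "{0<..<1}" f])
      show "continuous_on (closure {0<..<1}) f" using f by simp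
    qed (use that p in \<open>auto simp: less_imp_le\<close>)
    have "integral {0..1} f \<ge> 0" by (rule integral_nonneg) (use n f in \<open>auto intro: integrable_continuous_real\<close>)
    moreover have "integral {0..1} f \<noteq> 0"
      using integral_eq_0_iff[OF f _ n] p[of "1/2"] by force
    ultimately show ?thesis by simp
  qed
  show "integral {0..1} \<omega> > 0" by (rule gen[OF c pos])
  show "integral {0..1} (\<lambda>t. \<omega> t * t) > 0"
    by (rule gen) (use c pos in \<open>auto intro!: continuous_intros\<close>)
  have "integral {0..1} (\<lambda>t. \<omega> t * (1 - t)) > 0"
    by (rule gen) (use c pos in \<open>auto intro!: continuous_intros\<close>)
  moreover have "integral {0..1} (\<lambda>t. \<omega> t * (1 - t)) = integral {0..1} \<omega> - integral {0..1} (\<lambda>t. \<omega> t * t)"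
  proof -
    have "(\<lambda>t. \<omega> t * t) integrable_on {0..1}" "\<omega> integrable_on {0..1}"
      using c by (auto intro!: integrable_continuous_real continuous_intros)
    then show ?thesis by (simp add: right_diff_distrib integral_diff)
  qed
  ultimately show "integral {0..1} (\<lambda>t. \<omega> t * t) < integral {0..1} \<omega>" by simp
qed

section \<open>Bubble functions and the local complex\<close>

lemma b0_factor: "b0 V x = lE V i x * (lE V (i+1) x * lE V (i+2) x * lE V (i+3) x)"
  using exhaust_4[of i] by (auto simp: b0_def)

lemma lE_pos_open_edge:
  assumes V: "convex_quad V" and x: "x \<in> open_segment (V i) (V (i+1))" and j: "j \<noteq> i"
  shows "lE V j x > 0"
  unfolding lE_eq(2)[OF V] using open_edge_side_pos[OF V x j] lE_eq(1)[OF V, of j] by simp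

lemma lE_edge_0: "convex_quad V \<Longrightarrow> lE V i ((1 - t) *\<^sub>R V i + t *\<^sub>R V (i+1)) = 0"
  using affine_fun_segment[OF affine_fun_lE, of V i t "V i" "V (i+1)"] lE_vertex[of V i] by simp

text \<open>The defect of \<open>curl (b\<^sub>0 p)\<close> on the \<open>i\<close>-th edge is a positive multiple of a weighted mean of \<open>p\<close> there,
  which for affine \<open>p\<close> is the value at a point \<open>G i\<close> of the edge. The sign of \<open>l\<^sub>1\<^sub>3 l\<^sub>2\<^sub>4\<close> alternates from edge
  to edge, so its means do not satisfy the affine relation of the points \<open>G i\<close>.\<close>

lemma bubble_WKb:
  assumes V: "convex_quad V"
  shows "\<exists>w\<in>WKb V. (\<forall>k. w (V k) = 0 \<and> pderiv2 1 w (V k) = 0 \<and> pderiv2 2 w (V k) = 0) \<and>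
     (\<forall>i. tangential_defect V (curl w) i = t i)"
proof -
  define \<gamma> where "\<gamma> i s = (1 - s) *\<^sub>R V i + s *\<^sub>R V (i+1)" for i s
  define R where "R i x = lE V (i+1) x * lE V (i+2) x * lE V (i+3) x" for i x
  define \<omega> where "\<omega> i s = R i (\<gamma> i s)" for i s
  have \<gamma>_seg: "\<gamma> i s \<in> open_segment (V i) (V (i+1))" if "0 < s" "s < 1" for i s
    using that dist_pos[OF V, of i] unfolding in_segment \<gamma>_def by auto
  have cont: "continuous_on S (\<lambda>s. f (\<gamma> i s))" if "real_polynomial_function f" for f i S
    using that unfolding real_polynomial_function_eq \<gamma>_def
    by (intro continuous_on_compose2[OF continuous_on_polymonial_function[of f UNIV]] continuous_intros) auto
  have pR: "real_polynomial_function (R i)" for i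
    unfolding R_def[abs_def] by (intro real_polynomial_function.intros(4) polynomial_lE V)
  have c\<omega>: "continuous_on {0..1} (\<omega> i)" for i unfolding \<omega>_def by (rule cont[OF pR])
  have pos\<omega>: "\<omega> i s > 0" if "0 < s" "s < 1" for i s
    unfolding \<omega>_def R_def using lE_pos_open_edge[OF V \<gamma>_seg[OF that], of _ i]
    by (intro mult_pos_pos) (metis index4_shift(8-10))+
  define m where "m i = integral {0..1} (\<omega> i)" for i
  \<comment> \<open>The barycentre of the weight on the edge: integrating an affine function against
    the weight amounts to evaluating it at parameter \<theta>, that is at the point
    \<open>G i\<close>.\<close>
  define \<theta> where "\<theta> i = integral {0..1} (\<lambda>s. \<omega> i s * s) / m i" for i
  have m: "m i > 0" for i unfolding m_def by (rule weighted_mean(1)[OF c\<omega> pos\<omega>])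
  have \<theta>: "0 < \<theta> i" "\<theta> i < 1" for i
    using weighted_mean(2,3)[OF c\<omega>[of i] pos\<omega>] m[of i] by (simp_all add: \<theta>_def m_def)
  define G where "G i = (1 - \<theta> i) *\<^sub>R V i + \<theta> i *\<^sub>R V (i+1)" for i
  have G: "convex_quad G" unfolding G_def[abs_def] by (rule convex_quad_edge_points[OF V \<theta>])
  have mean: "integral {0..1} (\<lambda>s. \<omega> i s * p (\<gamma> i s)) = m i * p (G i)" if p: "affine_fun p" for p i
  proof -
    have i1: "\<omega> i integrable_on {0..1}" "(\<lambda>s. \<omega> i s * s) integrable_on {0..1}"
      by (auto intro!: integrable_continuous_real continuous_intros c\<omega>)
    have "((\<lambda>s. p (V i) * \<omega> i s + (p (V (i+1)) - p (V i)) * (\<omega> i s * s)) has_integral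
        p (V i) * m i + (p (V (i+1)) - p (V i)) * integral {0..1} (\<lambda>s. \<omega> i s * s)) {0..1}"
      unfolding m_def by (intro has_integral_add has_integral_mult_right integrable_integral i1)
    moreover have "p (V i) * \<omega> i s + (p (V (i+1)) - p (V i)) * (\<omega> i s * s) = \<omega> i s * p (\<gamma> i s)" for s
      unfolding \<gamma>_def affine_fun_segment[OF p] by (simp add: algebra_simps)
    ultimately have "integral {0..1} (\<lambda>s. \<omega> i s * p (\<gamma> i s))
        = p (V i) * m i + (p (V (i+1)) - p (V i)) * integral {0..1} (\<lambda>s. \<omega> i s * s)"
      by (simp add: integral_unique)
    also have "integral {0..1} (\<lambda>s. \<omega> i s * s) = \<theta> i * m i" using m[of i] by (simp add: \<theta>_def)
    finally show ?thesis unfolding G_def affine_fun_segment[OF p] by (simp add: algebra_simps)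
  qed
  define L where "L x = l13 V x * l24 V x" for x
  have pL: "real_polynomial_function L"
    unfolding L_def[abs_def]
    by (intro real_polynomial_function.intros(4) affine_fun_polynomial affine_fun_l13 affine_fun_l24 V)
  define \<tau> where "\<tau> i = integral {0..1} (\<lambda>s. \<omega> i s * L (\<gamma> i s)) / m i" for i
  note ls = affine_fun_segment[OF affine_fun_l13[OF V]] affine_fun_segment[OF affine_fun_l24[OF V]]
  note lv = l13_vertex[OF V] l24_vertex[OF V]
  have c\<omega>L: "continuous_on {0..1} (\<lambda>s. \<omega> i s * L (\<gamma> i s))" for i
    by (intro continuous_intros c\<omega> cont pL)
  \<comment> \<open>Inside edge 1 both diagonal functions are negative and inside edge 3 both are
    positive, while on edges 2 and 4 their signs differ. Together with the alternating signs in
    \<open>alt_area\<close>, all four terms become positive.\<close>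
  have L13: "L (\<gamma> i s) > 0" if "0 < s" "s < 1" "i = 1 \<or> i = 3" for i s
    using that lv by (auto simp: L_def \<gamma>_def ls zero_less_mult_iff mult_less_0_iff)
  have L24: "L (\<gamma> i s) < 0" if "0 < s" "s < 1" "i = 2 \<or> i = 4" for i s
    using that lv by (auto simp: L_def \<gamma>_def ls zero_less_mult_iff mult_less_0_iff)
  have t13: "\<tau> i > 0" if "i = 1 \<or> i = 3" for i
  proof -
    have "integral {0..1} (\<lambda>s. \<omega> i s * L (\<gamma> i s)) > 0"
      by (rule weighted_mean(1)[OF c\<omega>L]) (use pos\<omega> L13 that in auto)
    then show ?thesis using m[of i] by (simp add: \<tau>_def)
  qed
  have t24: "\<tau> i < 0" if "i = 2 \<or> i = 4" for i
  proof -
    have "integral {0..1} (\<lambda>s. - (\<omega> i s * L (\<gamma> i s))) > 0"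
      by (rule weighted_mean(1)[OF continuous_on_minus[OF c\<omega>L]]) (use pos\<omega> L24 that in \<open>auto simp: mult_pos_neg\<close>)
    then show ?thesis using m[of i] by (simp add: \<tau>_def divide_neg_pos)
  qed
  note tr = convex_quad_triangles[OF G]
  have "alt_area G \<tau> > 0"
  proof -
    have "cross2 (G 3 - G 2) (G 4 - G 2) * \<tau> 1 > 0" "cross2 (G 3 - G 1) (G 4 - G 1) * \<tau> 2 < 0"
      "cross2 (G 2 - G 1) (G 4 - G 1) * \<tau> 3 > 0" "cross2 (G 2 - G 1) (G 3 - G 1) * \<tau> 4 < 0"
      using tr t13 t24 by (simp_all add: mult_pos_neg)
    then show ?thesis unfolding alt_area_def by linarith
  qed
  then have alt: "alt_area G \<tau> \<noteq> 0" by simp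
  define c where "c i = side V i (edge_mid V (i+2))" for i
  define d where "d i = dist (V i) (V (i+1))" for i
  have cd: "c i > 0" "d i > 0" for i using lE_eq(1)[OF V] dist_pos[OF V] by (auto simp: c_def d_def)
  \<comment> \<open>On the edge the tangential component of \<open>curl w\<close> will be d/c times
    the weight times \<open>P\<close>, whose integral is m d/c times the left-hand side. The
    quotient on the right undoes these factors.\<close>
  obtain p k where p: "affine_fun p" and pk: "\<And>i. p (G i) + k * \<tau> i = t i * c i / (d i * m i)"
    using quad_interpolation[OF G alt, of "\<lambda>i. t i * c i / (d i * m i)"] by metis
  define P where "P x = p x + k * L x" for x
  have pP: "real_polynomial_function P"
    unfolding P_def[abs_def] by (intro real_polynomial_function.intros(2-) affine_fun_polynomial p pL)
  define w where "w x = b0 V x * P x" for x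
  have "w \<in> WKb V"
  proof -
    obtain a1 a2 a3 where pe: "p = (\<lambda>x. a1 + a2 * x$1 + a3 * x$2)" using p unfolding affine_fun_def by blast
    note S = fun_subspace_lincomb[OF fun_subspace_fun_span]
    have "(\<lambda>x. 1 *\<^sub>R (a1 *\<^sub>R b0 V x + a2 *\<^sub>R (b0 V x * x$1))
        + 1 *\<^sub>R (a3 *\<^sub>R (b0 V x * x$2) + k *\<^sub>R (b0 V x * l13 V x * l24 V x))) \<in> WKb V"
      unfolding WKb_def by (intro S fun_span_base) auto
    then show ?thesis by (simp add: w_def[abs_def] P_def pe L_def algebra_simps)
  qed
  have dw: "pderiv2 j w x = pderiv2 j (lE V i) x * (R i x * P x)" if "lE V i x = 0" for i j x
  proof -
    have we: "w = (\<lambda>x. lE V i x * (R i x * P x))"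
      by (simp add: w_def[abs_def] b0_factor[of V _ i] R_def fun_eq_iff)
    have "(\<lambda>x. R i x * P x) differentiable (at x)"
      using real_polynomial_function_differentiable[OF pR] real_polynomial_function_differentiable[OF pP]
      by (rule differentiable_mult)
    then show ?thesis unfolding we by (simp add: pderiv2_mult differentiable_lE[OF V] that)
  qed
  \<comment> \<open>A vertex lies on a second edge, so \<open>b0\<close> vanishes there to second
    order and the correction leaves vertex values and gradients untouched.\<close>
  have R0: "R k (V k) = 0" for k
    using lE_vertex(2)[OF V, of "k+3"] by (simp add: R_def index4_shift)
  have w0: "w (V k) = 0" "pderiv2 j w (V k) = 0" for k j
    using lE_vertex(1)[OF V, of k] dw[of k "V k" j] R0[of k] by (simp_all add: w_def b0_factor[of V _ k])
  have def_eq: "tangential_defect V (curl w) i = t i" for i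
  proof -
    have lin: "linepath (V i) (V (i+1)) s = \<gamma> i s" for s by (simp add: linepath_def \<gamma>_def)
    have v0: "curl w (V j) = 0" for j by (simp add: curl_def w0 vec2_eq_iff)
    have int: "curl w (\<gamma> i s) \<bullet> edge_tangent V i = (d i / c i) * (\<omega> i s * P (\<gamma> i s))" for s
    proof -
      let ?u = "V (i+1) - V i"
      have "lE V i (\<gamma> i s) = 0" unfolding \<gamma>_def by (rule lE_edge_0[OF V])
      note dw = dw[OF this]
      have "(d i)\<^sup>2 = ?u$1 * ?u$1 + ?u$2 * ?u$2"
        unfolding d_def dist_norm norm_minus_commute[of "V i"] power2_norm_eq_inner
        by (simp add: inner_vec_def sum_2)
      then have dd: "?u$1 * ?u$1 + ?u$2 * ?u$2 = d i * d i" by (simp add: power2_eq_square)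
      have "curl w (\<gamma> i s) \<bullet> edge_tangent V i
          = pderiv2 2 w (\<gamma> i s) * (?u$1 / d i) - pderiv2 1 w (\<gamma> i s) * (?u$2 / d i)"
        by (simp add: curl_def edge_tangent_def inner_vec_def sum_2 d_def)
      also have "\<dots> = (R i (\<gamma> i s) * P (\<gamma> i s)) * (?u$1 * ?u$1 + ?u$2 * ?u$2) / (c i * d i)"
        unfolding dw pderiv2_lE[OF V] c_def by (simp add: add_divide_distrib diff_divide_distrib algebra_simps)
      also have "\<dots> = (d i / c i) * (\<omega> i s * P (\<gamma> i s))"
        unfolding dd \<omega>_def using cd[of i] by simp
      finally show ?thesis .
    qed
    have "integral {0..1} (\<lambda>s. \<omega> i s * P (\<gamma> i s))
        = integral {0..1} (\<lambda>s. \<omega> i s * p (\<gamma> i s)) + k * integral {0..1} (\<lambda>s. \<omega> i s * L (\<gamma> i s))"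
    proof -
      have "(\<lambda>s. \<omega> i s * p (\<gamma> i s)) integrable_on {0..1}" "(\<lambda>s. \<omega> i s * L (\<gamma> i s)) integrable_on {0..1}"
        using affine_fun_polynomial[OF p]
        by (auto intro!: integrable_continuous_real continuous_on_mult c\<omega> cont pL)
      from has_integral_add[OF integrable_integral[OF this(1)]
          has_integral_mult_right[OF integrable_integral[OF this(2)], of k]]
      show ?thesis by (simp add: P_def distrib_left mult.left_commute integral_unique)
    qed
    also have "\<dots> = m i * (p (G i) + k * \<tau> i)"
      using m[of i] by (simp add: mean[OF p] \<tau>_def distrib_left)
    also have "\<dots> = t i * c i / d i" using m[of i] by (simp add: pk)
    finally have "integral {0..1} (\<lambda>s. curl w (\<gamma> i s) \<bullet> edge_tangent V i) = t i"
      unfolding int using cd[of i] by simp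
    then show ?thesis by (simp add: tangential_defect_def lin v0)
  qed
  show ?thesis using \<open>w \<in> WKb V\<close> w0 def_eq by blast
qed

text \<open>The edge defects of a Hermite interpolant from \<open>hermite_WKminus\<close> are
  removed by a bubble function, which does not disturb the Hermite data.\<close>

lemma hermite_WK:
  fixes g :: "4 \<Rightarrow> real^2"
  assumes V: "convex_quad V"
  shows "\<exists>w\<in>WK V. \<forall>k. w (V k) = a k \<and> pderiv2 1 w (V k) = g k $ 1 \<and> pderiv2 2 w (V k) = g k $ 2"
proof -
  obtain w1 where w1: "w1 \<in> WKminus V" "\<And>k. w1 (V k) = a k" "\<And>k. pderiv2 1 w1 (V k) = g k $ 1"
      "\<And>k. pderiv2 2 w1 (V k) = g k $ 2"
    using hermite_WKminus[OF V, of a g] by blast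
  obtain w2 where w2: "w2 \<in> WKb V" "\<And>k. w2 (V k) = 0" "\<And>k. pderiv2 1 w2 (V k) = 0"
      "\<And>k. pderiv2 2 w2 (V k) = 0" "\<And>i. tangential_defect V (curl w2) i = - tangential_defect V (curl w1) i"
    using bubble_WKb[OF V, of "\<lambda>i. - tangential_defect V (curl w1) i"] by blast
  note p = polynomial_WKminus[OF V w1(1)] polynomial_WKb[OF V w2(1)]
  let ?w = "\<lambda>x. w1 x + w2 x"
  have "?w \<in> fun_sum (WKminus V) (WKb V)" by (rule fun_sumI[OF w1(1) w2(1)])
  moreover have "tangential_defect V (curl ?w) i = 0" for i
    using tangential_defect_lincomb[OF polynomial_function_curl[OF p(1)] polynomial_function_curl[OF p(2)], of V 1 1 i]
      curl_lincomb[OF p, of 1 1] w2(5)[of i] by simp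
  ultimately have "?w \<in> WK V" by (simp add: WK_iff[OF V])
  then show ?thesis using w1 w2 p by (intro bexI[of _ ?w]) (auto simp: pderiv2_add)
qed

section \<open>The curl between the local spaces\<close>

definition affine_field :: "(real^2 \<Rightarrow> real^2) \<Rightarrow> bool" where
  "affine_field v \<longleftrightarrow> affine_fun (\<lambda>x. v x $ 1) \<and> affine_fun (\<lambda>x. v x $ 2)"

lemma polynomial_affine_field: "affine_field v \<Longrightarrow> polynomial_function v"
  by (simp add: affine_field_def polynomial_function_vec2_iff affine_fun_polynomial)

lemma curl_quadratic:
  "curl (\<lambda>x. a + b * x$1 + c * x$2 + d * (x$1)^2 + e * (x$1 * x$2) + f * (x$2)^2) x
    = vector [c + e * x$1 + 2 * f * x$2, - (b + 2 * d * x$1 + e * x$2)]"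
proof -
  have "((\<lambda>x::real^2. a + b * x$1 + c * x$2 + d * (x$1)^2 + e * (x$1 * x$2) + f * (x$2)^2) has_derivative
     (\<lambda>h. b * h$1 + c * h$2 + d * (2 * x$1 * h$1) + e * (x$1 * h$2 + h$1 * x$2) + f * (2 * x$2 * h$2))) (at x)"
    by (auto intro!: derivative_eq_intros simp: algebra_simps)
  from pderiv2_eqI[OF this] show ?thesis
    unfolding curl_def by (simp add: vec2_eq_iff axis_def algebra_simps)
qed

text \<open>The quadratic part is separated because its curl is an affine field; the curls of the
  cubic monomials are generators of \<open>VKminus\<close>.\<close>

lemma Pk_3_decompose:
  assumes "p \<in> Pk 3"
  shows "\<exists>a b c d e f r. r \<in> fun_span {\<lambda>x. (x$1)^3, \<lambda>x. (x$1)^2 * x$2, \<lambda>x. x$1 * (x$2)^2, \<lambda>x. (x$2)^3} \<and>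
    p = (\<lambda>x. (a + b * x$1 + c * x$2 + d * (x$1)^2 + e * (x$1 * x$2) + f * (x$2)^2) + r x)"
proof -
  obtain C where C: "p = (\<lambda>x. \<Sum>i\<le>3. \<Sum>j\<le>3 - i. C i j * (x$1) ^ i * (x$2) ^ j)" using assms unfolding Pk_def by blast
  have "p = (\<lambda>x. (C 0 0 + C 1 0 * x$1 + C 0 1 * x$2 + C 2 0 * (x$1)^2 + C 1 1 * (x$1 * x$2) + C 0 2 * (x$2)^2)
     + (1 *\<^sub>R (C 3 0 *\<^sub>R (x$1)^3 + C 2 1 *\<^sub>R ((x$1)^2 * x$2))
        + 1 *\<^sub>R (C 1 2 *\<^sub>R (x$1 * (x$2)^2) + C 0 3 *\<^sub>R (x$2)^3)))"
    unfolding C by (simp add: fun_eq_iff numeral_3_eq_3 numeral_2_eq_2 algebra_simps)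
  moreover have "(\<lambda>x. 1 *\<^sub>R (C 3 0 *\<^sub>R (x$1)^3 + C 2 1 *\<^sub>R ((x$1)^2 * x$2))
        + 1 *\<^sub>R (C 1 2 *\<^sub>R (x$1 * (x$2)^2) + C 0 3 *\<^sub>R (x$2)^3)) \<in>
      fun_span {\<lambda>x::real^2. (x$1)^3, \<lambda>x. (x$1)^2 * x$2, \<lambda>x. x$1 * (x$2)^2, \<lambda>x. (x$2)^3}"
    by (intro fun_subspace_lincomb[OF fun_subspace_fun_span] fun_span_base) auto
  ultimately show ?thesis by blast
qed

lemma fun_span_mono: "A \<subseteq> B \<Longrightarrow> fun_span A \<subseteq> fun_span B"
  unfolding fun_span_def by blast

lemma curl_fun_span:
  assumes "f \<in> fun_span B" "\<And>b. b \<in> B \<Longrightarrow> real_polynomial_function b"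
  shows "curl f \<in> fun_span (curl ` B)"
  using assms(1)
proof (induction rule: fun_span_induct)
  case zero
  show ?case by (simp add: curl_const fun_span_0)
next
  case (add b c g)
  have "real_polynomial_function g" by (rule real_polynomial_fun_span[OF add(2) assms(2)])
  from curl_lincomb[OF assms(2)[OF add(1)] this, of c 1]
  have "curl (\<lambda>x. c *\<^sub>R b x + g x) = (\<lambda>x. c *\<^sub>R curl b x + 1 *\<^sub>R curl g x)" by simp
  then show ?case
    using fun_subspace_lincomb[OF fun_subspace_fun_span fun_span_base[of "curl b" "curl ` B"] add(3), of c 1]
    by (simp add: add(1))
qed

lemma fun_span_curl:
  assumes "v \<in> fun_span (curl ` B)" "\<And>b. b \<in> B \<Longrightarrow> real_polynomial_function b"
  shows "\<exists>w\<in>fun_span B. v = curl w"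
  using assms(1)
proof (induction rule: fun_span_induct)
  case zero
  show ?case using fun_span_0 curl_const by metis
next
  case (add b c g)
  then obtain w b' where w: "w \<in> fun_span B" "g = curl w" and b': "b' \<in> B" "b = curl b'" by blast
  have "real_polynomial_function w" by (rule real_polynomial_fun_span[OF w(1) assms(2)])
  from curl_lincomb[OF assms(2)[OF b'(1)] this, of c 1]
  have "(\<lambda>x. c *\<^sub>R b x + g x) = curl (\<lambda>x. c * b' x + 1 * w x)" by (simp add: w b')
  moreover have "(\<lambda>x. c * b' x + 1 * w x) \<in> fun_span B"
    using fun_subspace_lincomb[OF fun_subspace_fun_span fun_span_base[OF b'(1)] w(1), of c 1] by simp
  ultimately show ?case by blast
qed

definition cubic_phi :: "quad \<Rightarrow> (real^2 \<Rightarrow> real) set" where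
  "cubic_phi V = {\<lambda>x. (x$1)^3, \<lambda>x. (x$1)^2 * x$2, \<lambda>x. x$1 * (x$2)^2, \<lambda>x. (x$2)^3, phi1 V, phi2 V}"

lemma VKminus_eq: "VKminus V = fun_sum {v. affine_field v} (fun_span (curl ` cubic_phi V))"
  by (simp add: VKminus_def affine_field_def affine_fun_Pk cubic_phi_def)

lemma polynomial_cubic_phi: "convex_quad V \<Longrightarrow> b \<in> cubic_phi V \<Longrightarrow> real_polynomial_function b"
  unfolding cubic_phi_def
  by (auto simp: polynomial_phi intro!: real_polynomial_function.intros(4) real_polynomial_function_power)

lemma cubic_phi_WKminus: "cubic_phi V \<subseteq> WKminus V"
proof -
  have "(\<lambda>x. (x$1)^3) \<in> Pk 3" "(\<lambda>x. (x$1)^2 * x$2) \<in> Pk 3" "(\<lambda>x. x$1 * (x$2)^2) \<in> Pk 3" "(\<lambda>x. (x$2)^3) \<in> Pk 3"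
    using Pk_monomial[of 3 0 3] Pk_monomial[of 2 1 3] Pk_monomial[of 1 2 3] Pk_monomial[of 0 3 3] by simp_all
  moreover have "phi1 V \<in> WKminus V" "phi2 V \<in> WKminus V"
    using fun_sumI[of "\<lambda>x. 0" "Pk 3" _ "fun_span {phi1 V, phi2 V}"] fun_subspace_Pk[of 3]
      fun_span_base[of _ "{phi1 V, phi2 V}"]
    by (auto simp: WKminus_def fun_subspace_def)
  ultimately show ?thesis using WKminus_cubic unfolding cubic_phi_def by auto
qed

lemma curl_WKminus:
  assumes V: "convex_quad V" and w: "w \<in> WKminus V" shows "curl w \<in> VKminus V"
proof -
  obtain f g where fg: "f \<in> Pk 3" "g \<in> fun_span {phi1 V, phi2 V}" "w = (\<lambda>x. f x + g x)"
    using w unfolding WKminus_def by (rule fun_sumE)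
  obtain a b c d e k r where r: "r \<in> fun_span {\<lambda>x. (x$1)^3, \<lambda>x. (x$1)^2 * x$2, \<lambda>x. x$1 * (x$2)^2, \<lambda>x. (x$2)^3}"
    and f: "f = (\<lambda>x. (a + b * x$1 + c * x$2 + d * (x$1)^2 + e * (x$1 * x$2) + k * (x$2)^2) + r x)"
    using Pk_3_decompose[OF fg(1)] by blast
  define q where "q x = a + b * x$1 + c * x$2 + d * (x$1)^2 + e * (x$1 * x$2) + k * (x$2)^2" for x :: "real^2"
  have pq: "real_polynomial_function q"
    unfolding q_def[abs_def]
    by (auto intro!: real_polynomial_function.intros(2-) real_polynomial_function_power)
  have "r \<in> fun_span (cubic_phi V)"
    by (rule subsetD[OF fun_span_mono r]) (auto simp: cubic_phi_def)
  moreover have "g \<in> fun_span (cubic_phi V)"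
    by (rule subsetD[OF fun_span_mono fg(2)]) (auto simp: cubic_phi_def)
  ultimately have h: "(\<lambda>x. r x + g x) \<in> fun_span (cubic_phi V)" by (rule fun_span_add)
  have ph: "real_polynomial_function (\<lambda>x. r x + g x)"
    by (rule real_polynomial_fun_span[OF h polynomial_cubic_phi[OF V]])
  have "w = (\<lambda>x. 1 * q x + 1 * (r x + g x))" by (simp add: fg(3) f q_def add.assoc)
  then have "curl w = (\<lambda>x. curl q x + curl (\<lambda>x. r x + g x) x)"
    using curl_lincomb[OF pq ph, of 1 1] by simp
  moreover have "affine_field (curl q)"
  proof -
    have q1: "(\<lambda>x. curl q x $ 1) = (\<lambda>x. c + e * x$1 + 2 * k * x$2)"
      and q2: "(\<lambda>x. curl q x $ 2) = (\<lambda>x. - b + (- 2 * d) * x$1 + (- e) * x$2)"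
      unfolding q_def[abs_def] curl_quadratic by auto
    have "affine_fun (\<lambda>x. curl q x $ 1)" unfolding affine_fun_def by (intro exI) (rule q1)
    moreover have "affine_fun (\<lambda>x. curl q x $ 2)" unfolding affine_fun_def by (intro exI) (rule q2)
    ultimately show ?thesis by (simp add: affine_field_def)
  qed
  moreover have "curl (\<lambda>x. r x + g x) \<in> fun_span (curl ` cubic_phi V)"
    by (rule curl_fun_span[OF h polynomial_cubic_phi[OF V]])
  ultimately show ?thesis unfolding VKminus_eq by (simp add: fun_sumI)
qed

lemma affine_field_VKminus: "affine_field v \<Longrightarrow> v \<in> VKminus V"
  unfolding VKminus_eq using fun_sumI[OF _ fun_span_0, of v "{v. affine_field v}"] by simp

lemma fun_subspace_affine_field: "fun_subspace {v. affine_field v}"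
proof -
  have "affine_fun (\<lambda>x. a * f x + b * g x)" if "affine_fun f" "affine_fun g" for f g a b
    using fun_subspace_lincomb[OF fun_subspace_Pk[of 1]] that by (simp add: affine_fun_Pk)
  moreover have "affine_fun (\<lambda>x. 0)" unfolding affine_fun_def by (intro exI[of _ 0]) simp
  ultimately show ?thesis unfolding fun_subspace_def affine_field_def by auto
qed

lemma fun_subspace_VKminus: "fun_subspace (VKminus V)"
  unfolding VKminus_eq by (intro fun_subspace_fun_sum fun_subspace_affine_field fun_subspace_fun_span)

lemma fun_subspace_VKb:
  assumes V: "convex_quad V" shows "fun_subspace (VKb V)"
  unfolding fun_subspace_def
proof (intro conjI ballI allI)
  show "(\<lambda>x. 0) \<in> VKb V"
    using fun_subspace_WKb[of V] curl_const unfolding VKb_def fun_subspace_def by (metis imageI)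
  fix f g a b assume "f \<in> VKb V" "g \<in> VKb V"
  then obtain p q where p: "p \<in> WKb V" "f = curl p" and q: "q \<in> WKb V" "g = curl q"
    unfolding VKb_def by blast
  have "(\<lambda>x. a *\<^sub>R f x + b *\<^sub>R g x) = curl (\<lambda>x. a * p x + b * q x)"
    using curl_lincomb[OF polynomial_WKb[OF V p(1)] polynomial_WKb[OF V q(1)], of a b] by (simp add: p q)
  moreover have "(\<lambda>x. a * p x + b * q x) \<in> WKb V"
    using fun_subspace_lincomb[OF fun_subspace_WKb p(1) q(1), of a b] by simp
  ultimately show "(\<lambda>x. a *\<^sub>R f x + b *\<^sub>R g x) \<in> VKb V" unfolding VKb_def by simp
qed

text \<open>Collecting all curls into a single one gives the form in which V_K is used: only the
  affine part can have divergence. The splitting is not unique, since the curl of a quadratic is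
  affine as well.\<close>

lemma VK_sum_iff:
  assumes V: "convex_quad V"
  shows "v \<in> fun_sum (VKminus V) (VKb V) \<longleftrightarrow>
    (\<exists>A w. affine_field A \<and> w \<in> fun_sum (WKminus V) (WKb V) \<and> v = (\<lambda>x. A x + curl w x))" (is "?L \<longleftrightarrow> ?R")
proof
  assume ?L
  then obtain v1 h where v1: "v1 \<in> VKminus V" "h \<in> VKb V" "v = (\<lambda>x. v1 x + h x)" by (rule fun_sumE)
  obtain A g where A: "affine_field A" and g: "g \<in> fun_span (curl ` cubic_phi V)" "v1 = (\<lambda>x. A x + g x)"
    using v1(1) unfolding VKminus_eq by (auto elim: fun_sumE)
  obtain w1 where w1: "w1 \<in> fun_span (cubic_phi V)" "g = curl w1"
    using fun_span_curl[OF g(1) polynomial_cubic_phi[OF V]] by blast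
  have w1': "w1 \<in> WKminus V" using w1(1)
  proof (induction rule: fun_span_induct)
    case zero
    then show ?case using fun_subspace_WKminus[of V] by (simp add: fun_subspace_def)
  next
    case (add b c g)
    then show ?case using fun_subspace_lincomb[OF fun_subspace_WKminus, of b V g c 1] cubic_phi_WKminus[of V] by auto
  qed
  obtain w2 where w2: "w2 \<in> WKb V" "h = curl w2" using v1(2) unfolding VKb_def by blast
  have "curl (\<lambda>x. w1 x + w2 x) = (\<lambda>x. curl w1 x + curl w2 x)"
    using curl_lincomb[OF polynomial_WKminus[OF V w1'] polynomial_WKb[OF V w2(1)], of 1 1] by simp
  then have "v = (\<lambda>x. A x + curl (\<lambda>x. w1 x + w2 x) x)"
    by (simp add: v1(3) g(2) w1(2) w2(2) add.assoc)
  then show ?R using A fun_sumI[OF w1' w2(1)] by blast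
next
  assume ?R
  then obtain A w where A: "affine_field A" and w: "w \<in> fun_sum (WKminus V) (WKb V)" and v: "v = (\<lambda>x. A x + curl w x)" by blast
  obtain w1 w2 where w12: "w1 \<in> WKminus V" "w2 \<in> WKb V" "w = (\<lambda>x. w1 x + w2 x)" using w by (rule fun_sumE)
  have "curl w = (\<lambda>x. curl w1 x + curl w2 x)"
    using curl_lincomb[OF polynomial_WKminus[OF V w12(1)] polynomial_WKb[OF V w12(2)], of 1 1] by (simp add: w12(3))
  then have "v = (\<lambda>x. (A x + curl w1 x) + curl w2 x)" by (simp add: v add.assoc)
  moreover have "(\<lambda>x. A x + curl w1 x) \<in> VKminus V"
    by (intro fun_subspace_add[OF fun_subspace_VKminus] affine_field_VKminus A curl_WKminus[OF V w12(1)])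
  ultimately show ?L using fun_sumI[of "\<lambda>x. A x + curl w1 x" "VKminus V" "curl w2" "VKb V"] w12(2)
    by (simp add: VKb_def)
qed

lemma polynomial_VK:
  assumes V: "convex_quad V" and v: "v \<in> fun_sum (VKminus V) (VKb V)" shows "polynomial_function v"
proof -
  obtain A w where A: "affine_field A" "w \<in> fun_sum (WKminus V) (WKb V)" "v = (\<lambda>x. A x + curl w x)"
    using v unfolding VK_sum_iff[OF V] by blast
  show ?thesis unfolding A(3)
    by (intro polynomial_function_add polynomial_affine_field A polynomial_function_curl polynomial_WK_sum[OF V])
qed

lemma fun_subspace_VK:
  assumes V: "convex_quad V" shows "fun_subspace (VK V)"
proof -
  have S: "fun_subspace (fun_sum (VKminus V) (VKb V))"
    by (intro fun_subspace_fun_sum fun_subspace_VKminus fun_subspace_VKb V)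
  show ?thesis unfolding fun_subspace_def
  proof (intro conjI ballI allI)
    show "(\<lambda>x. 0) \<in> VK V" using S by (simp add: VK_iff[OF V] fun_subspace_def tangential_defect_def)
    fix f g a b assume f: "f \<in> VK V" and g: "g \<in> VK V"
    then have fg: "f \<in> fun_sum (VKminus V) (VKb V)" "g \<in> fun_sum (VKminus V) (VKb V)"
      by (simp_all add: VK_iff[OF V])
    then show "(\<lambda>x. a *\<^sub>R f x + b *\<^sub>R g x) \<in> VK V"
      using f g fun_subspace_lincomb[OF S fg, of a b]
        tangential_defect_lincomb[OF polynomial_VK[OF V fg(1)] polynomial_VK[OF V fg(2)], of V a b]
      by (simp add: VK_iff[OF V])
  qed
qed

lemma curl_WK_iff:
  assumes V: "convex_quad V" and w: "w \<in> fun_sum (WKminus V) (WKb V)"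
  shows "curl w \<in> VK V \<longleftrightarrow> w \<in> WK V"
proof -
  have "affine_field (\<lambda>x. 0)" using fun_subspace_affine_field by (simp add: fun_subspace_def)
  then have "curl w \<in> fun_sum (VKminus V) (VKb V)"
    unfolding VK_sum_iff[OF V] using w by (intro exI[of _ "\<lambda>x. 0"] exI[of _ w]) simp
  then show ?thesis using w by (simp add: VK_iff[OF V] WK_iff[OF V])
qed

lemma fun_subspace_WK:
  assumes V: "convex_quad V" shows "fun_subspace (WK V)"
proof -
  have S: "fun_subspace (fun_sum (WKminus V) (WKb V))"
    by (intro fun_subspace_fun_sum fun_subspace_WKminus fun_subspace_WKb)
  show ?thesis unfolding fun_subspace_def
  proof (intro conjI ballI allI)
    show "(\<lambda>x. 0) \<in> WK V" using S by (simp add: WK_iff[OF V] fun_subspace_def tangential_defect_def curl_const)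
    fix f g a b assume f: "f \<in> WK V" and g: "g \<in> WK V"
    then have fg: "f \<in> fun_sum (WKminus V) (WKb V)" "g \<in> fun_sum (WKminus V) (WKb V)"
      by (simp_all add: WK_iff[OF V])
    note p = polynomial_WK_sum[OF V fg(1)] polynomial_WK_sum[OF V fg(2)]
    show "(\<lambda>x. a *\<^sub>R f x + b *\<^sub>R g x) \<in> WK V"
      using f g fun_subspace_lincomb[OF S fg, of a b] curl_lincomb[OF p, of a b]
        tangential_defect_lincomb[OF polynomial_function_curl[OF p(1)] polynomial_function_curl[OF p(2)], of V a b]
      by (simp add: WK_iff[OF V])
  qed
qed

section \<open>Fluxes through edges\<close>

text \<open>\<open>cross2 v (V (i+1) - V i)\<close> is the outward normal component of \<open>v\<close> times the length of the edge.\<close>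

definition edge_flux :: "quad \<Rightarrow> (real^2 \<Rightarrow> real^2) \<Rightarrow> 4 \<Rightarrow> real" where
  "edge_flux V v i = integral {0..1} (\<lambda>s. cross2 (v (linepath (V i) (V (i+1)) s)) (V (i+1) - V i))"

lemma edge_flux_integrable:
  assumes "polynomial_function v"
  shows "(\<lambda>s. cross2 (v (linepath a b s)) u) integrable_on {0..1}"
proof -
  have "continuous_on {0..1} (\<lambda>s. v (linepath a b s))"
    by (rule continuous_on_compose2[OF continuous_on_polymonial_function[OF assms, of UNIV] continuous_on_linepath]) auto
  then show ?thesis unfolding cross2_def by (intro integrable_continuous_real continuous_intros)
qed

lemma edge_flux_lincomb:
  assumes "polynomial_function f" "polynomial_function g"
  shows "edge_flux V (\<lambda>x. a *\<^sub>R f x + b *\<^sub>R g x) i = a * edge_flux V f i + b * edge_flux V g i"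
proof -
  let ?c = "\<lambda>v s. cross2 (v (linepath (V i) (V (i+1)) s)) (V (i+1) - V i)"
  have "((\<lambda>s. a * ?c f s + b * ?c g s) has_integral a * edge_flux V f i + b * edge_flux V g i) {0..1}"
    unfolding edge_flux_def
    by (intro has_integral_add has_integral_mult_right integrable_integral edge_flux_integrable assms)
  moreover have "a * ?c f s + b * ?c g s = ?c (\<lambda>x. a *\<^sub>R f x + b *\<^sub>R g x) s" for s
    by (simp add: cross2_def algebra_simps)
  ultimately show ?thesis unfolding edge_flux_def[of V "\<lambda>x. a *\<^sub>R f x + b *\<^sub>R g x"]
    by (simp add: integral_unique)
qed

lemma edge_flux_normal:
  assumes V: "convex_quad V"
  shows "seg_integral (V i) (V (i+1)) (\<lambda>x. v x \<bullet> edge_normal V i) = edge_flux V v i"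
proof -
  let ?d = "dist (V i) (V (i+1))"
  have d: "?d > 0" by (rule dist_pos[OF V])
  have "v x \<bullet> edge_normal V i = cross2 (v x) (V (i+1) - V i) / ?d" for x
    by (simp add: edge_normal_def edge_tangent_def inner_vec_def sum_2 cross2_def diff_divide_distrib
        right_diff_distrib)
  then show ?thesis using d by (simp add: seg_integral_def edge_flux_def)
qed

text \<open>The normal component of a curl is the derivative along the edge, so the fundamental
  theorem of calculus applies. This is what translates between fluxes of fields and vertex values of
  potentials.\<close>

lemma edge_flux_curl:
  assumes w: "real_polynomial_function w" shows "edge_flux V (curl w) i = w (V (i+1)) - w (V i)"
proof -
  let ?u = "V (i+1) - V i" and ?\<gamma> = "linepath (V i) (V (i+1))"
  have "((\<lambda>s. cross2 (curl w (?\<gamma> s)) ?u) has_integral (w (?\<gamma> 1) - w (?\<gamma> 0))) {0..1}"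
  proof (rule fundamental_theorem_of_calculus)
    fix s :: real
    have "(?\<gamma> has_derivative (\<lambda>h. h *\<^sub>R ?u)) (at s within {0..1})"
      unfolding linepath_def by (auto intro!: derivative_eq_intros simp: algebra_simps)
    from has_derivative_compose[OF this has_derivative_pderiv2[of w "?\<gamma> s"]]
    have "((\<lambda>s. w (?\<gamma> s)) has_derivative (\<lambda>h. (h *\<^sub>R ?u)$1 * pderiv2 1 w (?\<gamma> s) + (h *\<^sub>R ?u)$2 * pderiv2 2 w (?\<gamma> s)))
        (at s within {0..1})" using w by simp
    then show "((\<lambda>s. w (?\<gamma> s)) has_vector_derivative cross2 (curl w (?\<gamma> s)) ?u) (at s within {0..1})"
      unfolding has_vector_derivative_def by (rule has_derivative_eq_rhs) (simp add: cross2_def curl_def fun_eq_iff algebra_simps)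
  qed simp
  then show ?thesis unfolding edge_flux_def by (simp add: integral_unique linepath_def)
qed

lemma integral_affine_unit:
  fixes a b :: real
  shows "((\<lambda>s. a + s * b) has_integral a + b / 2) {0..1}"
proof -
  have "((\<lambda>s. a + s * b) has_integral ((1 * a + 1\<^sup>2 / 2 * b) - (0 * a + 0\<^sup>2 / 2 * b))) {0..1}"
    by (rule fundamental_theorem_of_calculus)
       (auto intro!: derivative_eq_intros simp flip: has_real_derivative_iff_has_vector_derivative)
  then show ?thesis by simp
qed

lemma edge_flux_affine:
  assumes A: "affine_field A"
  shows "edge_flux V A i = cross2 (A (V i) + A (V (i+1))) (V (i+1) - V i) / 2"
proof -
  let ?u = "V (i+1) - V i" and ?\<gamma> = "linepath (V i) (V (i+1))"
  let ?a = "cross2 (A (V i)) ?u" and ?b = "cross2 (A (V (i+1))) ?u"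
  have "cross2 (A (?\<gamma> s)) ?u = ?a + s * (?b - ?a)" for s
  proof -
    have "A (?\<gamma> s) $ 1 = (1 - s) * A (V i) $ 1 + s * A (V (i+1)) $ 1"
      "A (?\<gamma> s) $ 2 = (1 - s) * A (V i) $ 2 + s * A (V (i+1)) $ 2"
      using A affine_fun_segment[of "\<lambda>x. A x $ 1" s] affine_fun_segment[of "\<lambda>x. A x $ 2" s]
      by (simp_all add: affine_field_def linepath_def)
    then show ?thesis unfolding cross2_def vector_minus_component by algebra
  qed
  then have "edge_flux V A i = ?a + (?b - ?a) / 2"
    unfolding edge_flux_def by (simp only: integral_unique[OF integral_affine_unit])
  then show ?thesis by (simp add: cross2_def field_simps)
qed

lemma affine_field_coeffs:
  assumes "affine_field A"
  obtains a b c d e f where "\<And>x. A x $ 1 = a + b * x$1 + c * x$2" "\<And>x. A x $ 2 = d + e * x$1 + f * x$2"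
    "divergence A = (\<lambda>x. b + f)"
proof -
  obtain a b c where 1: "(\<lambda>x. A x $ 1) = (\<lambda>x. a + b * x$1 + c * x$2)"
    using assms unfolding affine_field_def affine_fun_def by blast
  obtain d e f where 2: "(\<lambda>x. A x $ 2) = (\<lambda>x. d + e * x$1 + f * x$2)"
    using assms unfolding affine_field_def affine_fun_def by blast
  have "((\<lambda>x::real^2. a + b * x$1 + c * x$2) has_derivative (\<lambda>h. b * h$1 + c * h$2)) (at x)" for a b c x
    by (auto intro!: derivative_eq_intros)
  from pderiv2_eqI[OF this]
  have "pderiv2 1 (\<lambda>x. a + b * x$1 + c * x$2) x = b" "pderiv2 2 (\<lambda>x. a + b * x$1 + c * x$2) x = c" for a b c x
    by (simp_all add: axis_def)
  then have "divergence A = (\<lambda>x. b + f)" unfolding divergence_def[abs_def] 1 2 by simp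
  then show thesis by (rule that[OF fun_cong[OF 1] fun_cong[OF 2]])
qed

text \<open>The divergence theorem on a cell. The curl part is divergence free and its fluxes
  telescope around the cell; for the affine part the trapezoidal values of the fluxes add up to the
  shoelace formula.\<close>

lemma VK_divergence:
  assumes V: "convex_quad V" and v: "v \<in> VK V"
  shows "\<exists>c. divergence v = (\<lambda>x. c) \<and> (\<Sum>i\<in>UNIV. edge_flux V v i) = c * measure lebesgue (cell V)"
proof -
  obtain A w where A: "affine_field A" and w: "w \<in> fun_sum (WKminus V) (WKb V)" and vw: "v = (\<lambda>x. A x + curl w x)"
    using v unfolding VK_iff[OF V] VK_sum_iff[OF V] by blast
  note pw = polynomial_WK_sum[OF V w]
  note pA = polynomial_affine_field[OF A]
  note pc = polynomial_function_curl[OF pw]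
  obtain a b c d e f where AA: "\<And>x. A x $ 1 = a + b * x$1 + c * x$2" "\<And>x. A x $ 2 = d + e * x$1 + f * x$2"
    and dA: "divergence A = (\<lambda>x. b + f)" by (rule affine_field_coeffs[OF A]) blast
  have "divergence v = (\<lambda>x. b + f)"
    using divergence_lincomb[OF pA pc, of 1 1] divergence_curl[OF pw] by (simp add: vw dA)
  moreover have "(\<Sum>i\<in>UNIV. edge_flux V v i) = (b + f) * measure lebesgue (cell V)"
  proof -
    have "edge_flux V v i = edge_flux V A i + (w (V (i+1)) - w (V i))" for i
      using edge_flux_lincomb[OF pA pc, of V 1 1 i] edge_flux_curl[OF pw, of V i] by (simp add: vw)
    then have "(\<Sum>i\<in>UNIV. edge_flux V v i) = (\<Sum>i\<in>UNIV. edge_flux V A i)"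
      by (simp add: sum_4)
    also have "\<dots> = (b + f) * measure lebesgue (cell V)"
      unfolding edge_flux_affine[OF A] measure_cell[OF V]
      by (simp add: sum_4 cross2_def AA algebra_simps add_divide_distrib diff_divide_distrib)
    finally show ?thesis .
  qed
  ultimately show ?thesis by blast
qed

text \<open>An affine field of zero trace is the curl of a quadratic, which lies in P_3 and can be
  absorbed into the potential. The edge constraints carry over by
  \<open>curl_WK_iff\<close>.\<close>

lemma VK_divergence_free:
  assumes V: "convex_quad V" and v: "v \<in> VK V" and 0: "\<And>x. divergence v x = 0"
  shows "\<exists>w\<in>WK V. v = curl w"
proof -
  obtain A w where A: "affine_field A" and w: "w \<in> fun_sum (WKminus V) (WKb V)" and vw: "v = (\<lambda>x. A x + curl w x)"
    using v unfolding VK_iff[OF V] VK_sum_iff[OF V] by blast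
  note pw = polynomial_WK_sum[OF V w]
  obtain a b c d e f where AA: "\<And>x. A x $ 1 = a + b * x$1 + c * x$2" "\<And>x. A x $ 2 = d + e * x$1 + f * x$2"
    and dA: "divergence A = (\<lambda>x. b + f)" by (rule affine_field_coeffs[OF A]) blast
  have "b + f = 0"
    using 0[of 0] divergence_lincomb[OF polynomial_affine_field[OF A] polynomial_function_curl[OF pw], of 1 1]
      divergence_curl[OF pw] by (simp add: vw dA)
  then have f: "f = - b" by simp
  \<comment> \<open>The coefficients solve curl q = A, compared through
    \<open>curl_quadratic\<close>; solvability of the mixed term is the condition f = -b.\<close>
  define q where "q x = 0 + (- d) * x$1 + a * x$2 + (- e/2) * (x$1)^2 + b * (x$1 * x$2) + (c/2) * (x$2)^2" for x :: "real^2"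
  have Aq: "A = curl q"
    unfolding q_def[abs_def] curl_quadratic[abs_def] by (simp add: fun_eq_iff vec2_eq_iff AA f)
  have "q \<in> Pk 3"
  proof -
    note S = fun_subspace_lincomb[OF fun_subspace_Pk]
    note m = Pk_monomial[of 1 0 3] Pk_monomial[of 0 1 3] Pk_monomial[of 2 0 3] Pk_monomial[of 1 1 3] Pk_monomial[of 0 2 3]
    have "(\<lambda>x. 1 *\<^sub>R ((- d) *\<^sub>R (x$1) + a *\<^sub>R (x$2)) + 1 *\<^sub>R (1 *\<^sub>R ((- e/2) *\<^sub>R (x$1)^2 + b *\<^sub>R (x$1 * x$2))
       + (c/2) *\<^sub>R (x$2)^2)) \<in> Pk 3"
      by (intro S) (use m in simp_all)
    then show ?thesis by (simp add: q_def[abs_def] algebra_simps)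
  qed
  then have q: "q \<in> WKminus V" by (rule WKminus_cubic)
  obtain w1 w2 where w12: "w1 \<in> WKminus V" "w2 \<in> WKb V" "w = (\<lambda>x. w1 x + w2 x)" using w by (rule fun_sumE)
  have "(\<lambda>x. (q x + w1 x) + w2 x) \<in> fun_sum (WKminus V) (WKb V)"
    by (intro fun_sumI fun_subspace_add[OF fun_subspace_WKminus] q w12)
  then have qw: "(\<lambda>x. q x + w x) \<in> fun_sum (WKminus V) (WKb V)" by (simp add: w12(3) add.assoc)
  have "v = curl (\<lambda>x. q x + w x)"
    using curl_lincomb[OF polynomial_WKminus[OF V q] pw, of 1 1] by (simp add: vw Aq)
  then show ?thesis using curl_WK_iff[OF V qw] v by blast
qed

lemma WK_add_const:
  assumes V: "convex_quad V" and w: "w \<in> WK V" shows "(\<lambda>x. w x + c) \<in> WK V"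
proof -
  have "(\<lambda>x. c) \<in> Pk 3"
    using fun_subspace_scale[OF fun_subspace_Pk Pk_monomial[of 0 0 3], of c] by simp
  then have "(\<lambda>x. c) \<in> fun_sum (WKminus V) (WKb V)"
    using fun_sumI[OF WKminus_cubic fun_span_0, of "\<lambda>x. c" V] unfolding WKb_def by simp
  then have "(\<lambda>x. c) \<in> WK V" by (simp add: WK_iff[OF V] tangential_defect_def curl_const)
  then show ?thesis by (rule fun_subspace_add[OF fun_subspace_WK[OF V] w])
qed

text \<open>A radial field l x carries the total flux, and a curl redistributes it among the edges.
  Hermite data in W_K allow the curl to have the required vertex differences and, at the same time,
  to cancel the radial field at the vertices.\<close>

lemma VK_flux_exists:
  assumes V: "convex_quad V"
  shows "\<exists>v\<in>VK V. (\<forall>i. v (V i) = 0) \<and> (\<forall>i. edge_flux V v i = \<Phi> i)"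
proof -
  let ?S = "\<Sum>i\<in>UNIV. cross2 (V i) (V (i+1))"
  have S: "?S > 0"
    using convex_quad_triangles[OF V] by (simp add: sum_4 cross2_def algebra_simps)
  \<comment> \<open>The radial field has flux \<open>l * cross2 (V i) (V (i+1))\<close> through edge
    i, so this factor leaves a remainder \<psi> of total 0.\<close>
  define l where "l = (\<Sum>i\<in>UNIV. \<Phi> i) / ?S"
  define \<psi> where "\<psi> i = \<Phi> i - l * cross2 (V i) (V (i+1))" for i
  have "(\<Sum>i\<in>UNIV. \<psi> i) = 0"
    using S unfolding \<psi>_def sum_subtractf sum_distrib_left[symmetric] by (simp add: l_def)
  then have \<psi>0: "\<psi> 1 + \<psi> 2 + \<psi> 3 + \<psi> 4 = 0" by (simp add: sum_4)
  \<comment> \<open>Partial sums of \<psi> around the cell; the step from vertex 4 back to vertex 1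
    fits because \<psi> has total 0.\<close>
  define a :: "4 \<Rightarrow> real" where "a k = (if k = 1 then 0 else if k = 2 then \<psi> 1 else if k = 3 then \<psi> 1 + \<psi> 2 else \<psi> 1 + \<psi> 2 + \<psi> 3)" for k
  have a: "a (i+1) - a i = \<psi> i" for i using exhaust_4[of i] \<psi>0 by (auto simp: a_def)
  \<comment> \<open>The prescribed gradients say that curl w equals -l x at the vertices.\<close>
  obtain w where w: "w \<in> WK V" "\<And>k. w (V k) = a k" "\<And>k. pderiv2 1 w (V k) = l * V k $ 2"
      "\<And>k. pderiv2 2 w (V k) = - l * V k $ 1"
    using hermite_WK[OF V, of a "\<lambda>k. vector [l * V k $ 2, - l * V k $ 1]"] by auto
  have ws: "w \<in> fun_sum (WKminus V) (WKb V)" using w(1) by (simp add: WK_iff[OF V])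
  note pw = polynomial_WK_sum[OF V ws]
  define A :: "real^2 \<Rightarrow> real^2" where "A x = l *\<^sub>R x" for x
  have A: "affine_field A"
  proof -
    have "(\<lambda>x. A x $ 1) = (\<lambda>x. 0 + l * x$1 + 0 * x$2)" "(\<lambda>x. A x $ 2) = (\<lambda>x. 0 + 0 * x$1 + l * x$2)"
      by (simp_all add: A_def)
    then show ?thesis unfolding affine_field_def affine_fun_def by blast
  qed
  have dA: "tangential_defect V A i = 0" for i
  proof -
    let ?t = "edge_tangent V i" and ?\<gamma> = "linepath (V i) (V (i+1))"
    let ?p = "A (V i) \<bullet> ?t" and ?q = "A (V (i+1)) \<bullet> ?t"
    have "A (?\<gamma> s) \<bullet> ?t = ?p + s * (?q - ?p)" for s
      by (simp add: A_def linepath_def inner_add_left algebra_simps)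
    then have "integral {0..1} (\<lambda>s. A (?\<gamma> s) \<bullet> ?t) = ?p + (?q - ?p) / 2"
      by (simp only: integral_unique[OF integral_affine_unit])
    then show ?thesis by (simp add: tangential_defect_def inner_add_left field_simps)
  qed
  define v where "v x = A x + curl w x" for x
  have "v \<in> fun_sum (VKminus V) (VKb V)" unfolding VK_sum_iff[OF V] v_def[abs_def] using A ws by blast
  moreover have "tangential_defect V v i = 0" for i
    using tangential_defect_lincomb[OF polynomial_affine_field[OF A] polynomial_function_curl[OF pw], of V 1 1 i]
      dA w(1) by (simp add: v_def[abs_def] WK_iff[OF V])
  ultimately have "v \<in> VK V" by (simp add: VK_iff[OF V])
  moreover have "v (V k) = 0" for k by (simp add: v_def A_def curl_def w vec2_eq_iff)
  moreover have "edge_flux V v i = \<Phi> i" for i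
  proof -
    have "edge_flux V v i = edge_flux V A i + (w (V (i+1)) - w (V i))"
      using edge_flux_lincomb[OF polynomial_affine_field[OF A] polynomial_function_curl[OF pw], of V 1 1 i]
        edge_flux_curl[OF pw, of V i] by (simp add: v_def[abs_def])
    also have "edge_flux V A i = l * cross2 (V i) (V (i+1))"
    proof -
      have "cross2 (A (V i) + A (V (i+1))) (V (i+1) - V i) = 2 * (l * cross2 (V i) (V (i+1)))"
        by (simp add: A_def cross2_def algebra_simps)
      then show ?thesis by (simp add: edge_flux_affine[OF A])
    qed
    also have "w (V (i+1)) - w (V i) = \<Phi> i - l * cross2 (V i) (V (i+1))"
      using a[of i] by (simp add: w \<psi>_def)
    finally show ?thesis by simp
  qed
  ultimately show ?thesis by blast
qed

section \<open>Piecewise polynomials\<close>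

lemma ae_eq_iff_negligible:
  assumes S: "S \<in> sets lebesgue"
  shows "ae_eq S f g \<longleftrightarrow> negligible {x \<in> S. f x \<noteq> g x}"
proof -
  have "ae_eq S f g \<longleftrightarrow> (AE x in lebesgue. x \<in> S \<longrightarrow> f x = g x)"
    unfolding ae_eq_def using S by (subst AE_restrict_space_iff) auto
  also have "\<dots> \<longleftrightarrow> negligible {x \<in> S. f x \<noteq> g x}"
    using negligible_subset[unfolded negligible_iff_null_sets]
    unfolding eventually_ae_filter negligible_iff_null_sets by auto
  finally show ?thesis .
qed

lemma cell_lebesgue [simp]: "cell K \<in> sets lebesgue"
  by (simp add: lebesgue_closedin)

lemma ae_eq_refl: "ae_eq S f f"
  by (simp add: ae_eq_def)

lemma ae_eq_sym: "ae_eq S f g \<Longrightarrow> ae_eq S g f"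
  unfolding ae_eq_def by (elim eventually_mono) simp

lemma ae_eq_trans:
  assumes "ae_eq S f g" "ae_eq S g h" shows "ae_eq S f h"
  using assms unfolding ae_eq_def by eventually_elim simp

text \<open>Inside the cell the polynomials differ on an open set, which is empty if it is
  negligible. Hence the description in \<open>restr\<close> is unique.\<close>

lemma ae_eq_polynomial_unique:
  fixes f g :: "real^2 \<Rightarrow> 'b::euclidean_space"
  assumes K: "convex_quad K" and f: "polynomial_function f" and g: "polynomial_function g"
    and ae: "ae_eq (cell K) f g"
  shows "f = g"
proof (rule polynomial_function_eq_on_open[OF f g open_interior interior_cell_nonempty[OF K]])
  fix x assume x: "x \<in> interior (cell K)"
  let ?U = "interior (cell K) \<inter> {x. f x \<noteq> g x}"
  have "open ?U"
    by (intro open_Int open_interior open_Collect_neq continuous_on_polymonial_function f g)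
  moreover have "negligible ?U"
  proof (rule negligible_subset)
    show "negligible {x \<in> cell K. f x \<noteq> g x}" using ae by (simp add: ae_eq_iff_negligible)
    show "?U \<subseteq> {x \<in> cell K. f x \<noteq> g x}" using interior_subset by auto
  qed
  ultimately have "?U = {}" using open_not_negligible by blast
  then show "f x = g x" using x by blast
qed

lemma restr_eqI:
  fixes f :: "real^2 \<Rightarrow> 'b::euclidean_space"
  assumes K: "convex_quad K" and p: "polynomial_function p" and ae: "ae_eq (cell K) f p"
  shows "restr f K = p"
  unfolding restr_def
proof (rule the_equality)
  fix q assume "polynomial_function q \<and> ae_eq (cell K) f q"
  then show "q = p"
    using ae_eq_polynomial_unique[OF K _ p, of q] ae_eq_trans[OF ae_eq_sym ae, of q] by blast
qed (use p ae in auto)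

text \<open>An edge is a set and may be presented with its endpoints in either order; the two cells
  at an edge in fact do so.\<close>

lemma seg_integral_sym: "seg_integral a b f = seg_integral b a f"
proof -
  have "(\<lambda>t. f (linepath b a t)) = (\<lambda>t. (\<lambda>s. f (linepath a b (s + 1))) (- t))"
    by (simp add: linepath_def fun_eq_iff algebra_simps)
  then have "integral {0..1} (\<lambda>t. f (linepath b a t)) = integral {-1..0} (\<lambda>s. f (linepath a b (s + 1)))"
    using Henstock_Kurzweil_Integration.integral_reflect_real[of 0 "-1" "\<lambda>s. f (linepath a b (s + 1))"] by simp
  also have "\<dots> = integral {0..1} (\<lambda>s. f (linepath a b s))"
    using integral_shift_Icc_real[of "-1" 0 "\<lambda>s. f (linepath a b s)" 1]
    by (simp add: add.commute o_def)
  finally show ?thesis by (simp add: seg_integral_def dist_commute)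
qed

lemma seg_integral_cong_ends:
  assumes "{a, b} = {c, d}" shows "seg_integral a b f = seg_integral c d f"
  using assms seg_integral_sym by (auto simp: doubleton_eq_iff)

lemma seg_integral_cmult: "seg_integral a b (\<lambda>x. c * f x) = c * seg_integral a b f"
  by (simp add: seg_integral_def)

lemma seg_integral_add:
  assumes "continuous_on UNIV f" "continuous_on UNIV g"
  shows "seg_integral a b (\<lambda>x. f x + g x) = seg_integral a b f + seg_integral a b g"
proof -
  have "(\<lambda>t. f (linepath a b t)) integrable_on {0..1}" if "continuous_on UNIV f" for f :: "real^2 \<Rightarrow> real"
    by (intro integrable_continuous_real continuous_on_compose2[OF that continuous_on_linepath]) auto
  then show ?thesis using assms by (simp add: seg_integral_def integral_add distrib_left)
qed

section \<open>Gluing of cellwise polynomials, equality almost everywhere and vertex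
  conditions\<close>

lemma L2_lincomb:
  fixes f g :: "real^2 \<Rightarrow> 'b::euclidean_space"
  assumes f: "f \<in> L2 S" and g: "g \<in> L2 S" shows "(\<lambda>x. a *\<^sub>R f x + b *\<^sub>R g x) \<in> L2 S"
proof -
  have m [measurable]: "f \<in> borel_measurable (lebesgue_on S)" "g \<in> borel_measurable (lebesgue_on S)"
    and i: "integrable (lebesgue_on S) (\<lambda>x. (norm (f x))\<^sup>2)" "integrable (lebesgue_on S) (\<lambda>x. (norm (g x))\<^sup>2)"
    using f g by (auto simp: L2_def)
  have bound: "(norm (a *\<^sub>R f x + b *\<^sub>R g x))\<^sup>2 \<le> 2 * a\<^sup>2 * (norm (f x))\<^sup>2 + 2 * b\<^sup>2 * (norm (g x))\<^sup>2" for x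
  proof -
    have "norm (a *\<^sub>R f x + b *\<^sub>R g x) \<le> \<bar>a\<bar> * norm (f x) + \<bar>b\<bar> * norm (g x)"
      using norm_triangle_ineq[of "a *\<^sub>R f x" "b *\<^sub>R g x"] by simp
    then have "(norm (a *\<^sub>R f x + b *\<^sub>R g x))\<^sup>2 \<le> (\<bar>a\<bar> * norm (f x) + \<bar>b\<bar> * norm (g x))\<^sup>2"
      by (rule power_mono) simp
    also have "\<dots> \<le> 2 * (\<bar>a\<bar> * norm (f x))\<^sup>2 + 2 * (\<bar>b\<bar> * norm (g x))\<^sup>2"
      using zero_le_power2[of "\<bar>a\<bar> * norm (f x) - \<bar>b\<bar> * norm (g x)"] by (simp add: power2_sum power2_diff)
    finally show ?thesis by (simp add: power_mult_distrib)
  qed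
  have "integrable (lebesgue_on S) (\<lambda>x. (norm (a *\<^sub>R f x + b *\<^sub>R g x))\<^sup>2)"
  proof (rule Bochner_Integration.integrable_bound)
    show "integrable (lebesgue_on S) (\<lambda>x. 2 * a\<^sup>2 * (norm (f x))\<^sup>2 + 2 * b\<^sup>2 * (norm (g x))\<^sup>2)"
      using i by (intro Bochner_Integration.integrable_add integrable_mult_right)
    show "(\<lambda>x. (norm (a *\<^sub>R f x + b *\<^sub>R g x))\<^sup>2) \<in> borel_measurable (lebesgue_on S)" by measurable
    show "AE x in lebesgue_on S. norm ((norm (a *\<^sub>R f x + b *\<^sub>R g x))\<^sup>2)
        \<le> norm (2 * a\<^sup>2 * (norm (f x))\<^sup>2 + 2 * b\<^sup>2 * (norm (g x))\<^sup>2)"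
      using bound by (intro AE_I2) (simp add: abs_of_nonneg)
  qed
  then show ?thesis by (simp add: L2_def)
qed

lemma L2_zero: "(\<lambda>x. 0) \<in> L2 S"
  by (simp add: L2_def)

text \<open>On the edges of the mesh every term is switched off and the value is 0; this null set
  does not matter for classes modulo equality almost everywhere. \<open>cellwise\<close> is the
  special case of \<open>cellwise_eq_glue\<close>.\<close>

definition glue :: "quad set \<Rightarrow> (quad \<Rightarrow> real^2 \<Rightarrow> 'b::euclidean_space) \<Rightarrow> real^2 \<Rightarrow> 'b" where
  "glue T p x = (\<Sum>K\<in>T. indicator (interior (cell K)) x *\<^sub>R p K x)"

lemma cellwise_eq_glue: "cellwise T D f = glue T (\<lambda>K. D (restr f K))"
  by (simp add: cellwise_def glue_def fun_eq_iff)

definition piecewise :: "quad set \<Rightarrow> (real^2 \<Rightarrow> 'b::euclidean_space) \<Rightarrow> bool" where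
  "piecewise T f \<longleftrightarrow> (\<forall>K\<in>T. polynomial_function (restr f K) \<and> ae_eq (cell K) f (restr f K))"

text \<open>The second half of \<open>circulation\<close>, kept apart because the outward fluxes of
  a general field in V_h need not sum to 0 on a cell.\<close>

definition balanced :: "quad set \<Rightarrow> (quad \<Rightarrow> 4 \<Rightarrow> real) \<Rightarrow> bool" where
  "balanced T f \<longleftrightarrow> (\<forall>E\<in>mesh_edges T. (\<Sum>(K, i) | K \<in> T \<and> edge K i = E. f K i) = 0)"

lemma balanced_lincomb:
  assumes "balanced T f" "balanced T g" shows "balanced T (\<lambda>K i. a * f K i + b * g K i)"
  using assms unfolding balanced_def case_prod_unfold
  by (simp add: sum.distrib flip: sum_distrib_left)

lemma balanced_sum:
  assumes "\<And>L. L \<in> A \<Longrightarrow> balanced T (f L)" shows "balanced T (\<lambda>K i. \<Sum>L\<in>A. c L * f L K i)"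
  unfolding balanced_def case_prod_unfold
proof
  fix E assume E: "E \<in> mesh_edges T"
  have "(\<Sum>d | case d of (K, i) \<Rightarrow> K \<in> T \<and> edge K i = E. \<Sum>L\<in>A. c L * f L (fst d) (snd d))
      = (\<Sum>L\<in>A. c L * (\<Sum>d | case d of (K, i) \<Rightarrow> K \<in> T \<and> edge K i = E. f L (fst d) (snd d)))"
    unfolding sum_distrib_left by (rule sum.swap)
  also have "\<dots> = 0"
    using assms E by (intro sum.neutral) (auto simp: balanced_def case_prod_unfold)
  finally show "(\<Sum>d | fst d \<in> T \<and> edge (fst d) (snd d) = E. \<Sum>L\<in>A. c L * f L (fst d) (snd d)) = 0"
    by (simp add: case_prod_unfold)
qed

lemma grad_eq_iff_curl_eq: "grad f x = grad g y \<longleftrightarrow> curl f x = curl g y"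
  and grad_0_iff_curl_0: "grad f x = 0 \<longleftrightarrow> curl f x = 0"
  by (auto simp: grad_def curl_def vec2_eq_iff)

lemma curl_0_imp_constant:
  assumes w: "real_polynomial_function w" and 0: "curl w = (\<lambda>x. 0)" shows "w x = w y"
proof -
  have "pderiv2 1 w z = 0 \<and> pderiv2 2 w z = 0" for z
    using fun_cong[OF 0, of z] by (simp add: curl_def vec2_eq_iff)
  then have "(w has_derivative (\<lambda>h. 0)) (at z)" for z
    using has_derivative_pderiv2[of w z] w by simp
  then have "\<exists>c. \<forall>z\<in>UNIV. w z = c"
    by (intro has_derivative_zero_constant) auto
  then show ?thesis by auto
qed

context quad_mesh
begin

lemma glue_eq:
  assumes K: "K \<in> T" and x: "x \<in> interior (cell K)" shows "glue T p x = p K x"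
proof -
  have "indicator (interior (cell L)) x *\<^sub>R p L x = (if L = K then p K x else 0)" if "L \<in> T" for L
    using x interior_cell_disjoint[OF K that] interior_subset[of "cell L"] by (auto simp: indicator_def)
  then have "glue T p x = (\<Sum>L\<in>T. if L = K then p K x else 0)" unfolding glue_def by (intro sum.cong) auto
  then show ?thesis using K finite_mesh by simp
qed

lemma ae_eq_glue:
  assumes K: "K \<in> T" shows "ae_eq (cell K) (glue T p) (p K)"
proof -
  have "negligible (frontier (cell K))" by (rule negligible_convex_frontier) simp
  moreover have "{x \<in> cell K. glue T p x \<noteq> p K x} \<subseteq> frontier (cell K)"
    using glue_eq[OF K, of _ p] closure_subset[of "cell K"] by (auto simp: frontier_def)
  ultimately have "negligible {x \<in> cell K. glue T p x \<noteq> p K x}" by (rule negligible_subset)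
  then show ?thesis by (simp add: ae_eq_iff_negligible)
qed

lemma restr_glue:
  assumes "K \<in> T" "polynomial_function (p K)" shows "restr (glue T p) K = p K"
  by (rule restr_eqI[OF convex[OF assms(1)] assms(2) ae_eq_glue[OF assms(1), of p]])

lemma piecewise_glue:
  assumes "\<And>K. K \<in> T \<Longrightarrow> polynomial_function (p K)" shows "piecewise T (glue T p)"
  unfolding piecewise_def using restr_glue[of _ p] ae_eq_glue[of _ p] assms by simp

lemma L2_glue:
  assumes p: "\<And>K. K \<in> T \<Longrightarrow> polynomial_function (p K)" shows "glue T p \<in> L2 \<Omega>"
proof -
  have cp: "continuous_on S (p K)" if "K \<in> T" for K S
    by (rule continuous_on_polymonial_function[OF p[OF that]])
  have "glue T p \<in> borel_measurable borel"
    unfolding glue_def[abs_def]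
    by (intro borel_measurable_sum borel_measurable_scaleR borel_measurable_indicator
        borel_measurable_continuous_onI cp) auto
  then have "glue T p \<in> borel_measurable lebesgue" by (intro measurable_completion) simp
  then have m [measurable]: "glue T p \<in> borel_measurable (lebesgue_on \<Omega>)" by (rule measurable_restrict_space1)
  have "\<exists>B. \<forall>x. norm (indicator (interior (cell K)) x *\<^sub>R p K x) \<le> B" if K: "K \<in> T" for K
  proof -
    have "bounded (p K ` cell K)" by (intro compact_imp_bounded compact_continuous_image cp[OF K]) simp
    then obtain B where B: "B > 0" "\<forall>x\<in>cell K. norm (p K x) \<le> B" unfolding bounded_pos by auto
    then have "norm (indicator (interior (cell K)) x *\<^sub>R p K x) \<le> B" for x
      using interior_subset[of "cell K"] by (auto simp: indicator_def)
    then show ?thesis by blast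
  qed
  then obtain B where B: "\<And>K x. K \<in> T \<Longrightarrow> norm (indicator (interior (cell K)) x *\<^sub>R p K x) \<le> B K" by metis
  have le: "norm (glue T p x) \<le> (\<Sum>K\<in>T. B K)" for x
    unfolding glue_def by (rule sum_norm_le) (rule B)
  have "finite_measure (lebesgue_on \<Omega>)"
    by (intro finite_measure_lebesgue_on lmeasurable_open bounded_dom open_dom)
  then have "integrable (lebesgue_on \<Omega>) (\<lambda>x. (norm (glue T p x))\<^sup>2)"
  proof (rule finite_measure.integrable_const_bound)
    show "AE x in lebesgue_on \<Omega>. norm ((norm (glue T p x))\<^sup>2) \<le> (\<Sum>K\<in>T. B K)\<^sup>2"
      using le by (intro AE_I2) (simp add: power_mono)
  qed measurable
  then show ?thesis by (simp add: L2_def)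
qed

lemma dom_lebesgue [simp]: "\<Omega> \<in> sets lebesgue"
  by (simp add: lebesgue_openin open_dom)

text \<open>Cells may protrude from \<Omega> only into its frontier, which is negligible, and
  finitely many cells cover \<Omega>.\<close>

lemma ae_eq_dom_iff: "ae_eq \<Omega> f g \<longleftrightarrow> (\<forall>K\<in>T. ae_eq (cell K) f g)"
proof
  assume L: "ae_eq \<Omega> f g"
  show "\<forall>K\<in>T. ae_eq (cell K) f g"
  proof
    fix K assume K: "K \<in> T"
    have "cell K \<subseteq> \<Omega> \<union> frontier \<Omega>" using cell_subset[OF K] closure_Un_frontier[of \<Omega>] by blast
    then have "{x \<in> cell K. f x \<noteq> g x} \<subseteq> {x \<in> \<Omega>. f x \<noteq> g x} \<union> frontier \<Omega>" by blast
    moreover have "negligible ({x \<in> \<Omega>. f x \<noteq> g x} \<union> frontier \<Omega>)"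
      using L negligible_frontier_dom by (simp add: ae_eq_iff_negligible)
    ultimately have "negligible {x \<in> cell K. f x \<noteq> g x}" by (rule negligible_subset[rotated])
    then show "ae_eq (cell K) f g" by (simp add: ae_eq_iff_negligible)
  qed
next
  assume R: "\<forall>K\<in>T. ae_eq (cell K) f g"
  have "negligible (\<Union>K\<in>T. {x \<in> cell K. f x \<noteq> g x})"
    using R finite_mesh by (intro negligible_Union) (auto simp: ae_eq_iff_negligible)
  moreover have "{x \<in> \<Omega>. f x \<noteq> g x} \<subseteq> (\<Union>K\<in>T. {x \<in> cell K. f x \<noteq> g x})"
    using Union_cells closure_subset[of \<Omega>] by blast
  ultimately have "negligible {x \<in> \<Omega>. f x \<noteq> g x}" by (rule negligible_subset)
  then show "ae_eq \<Omega> f g" by (simp add: ae_eq_iff_negligible)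
qed

text \<open>This turns every statement modulo equality almost everywhere into identities between
  polynomials on the cells.\<close>

lemma piecewise_ae_eq_iff:
  assumes f: "piecewise T f" and g: "piecewise T g"
  shows "ae_eq \<Omega> f g \<longleftrightarrow> (\<forall>K\<in>T. restr f K = restr g K)"
  unfolding ae_eq_dom_iff
proof (intro ball_cong refl iffI)
  fix K assume K: "K \<in> T"
  have pf: "polynomial_function (restr f K)" "ae_eq (cell K) f (restr f K)"
    and pg: "polynomial_function (restr g K)" "ae_eq (cell K) g (restr g K)"
    using f g K by (auto simp: piecewise_def)
  { assume "ae_eq (cell K) f g"
    then have "ae_eq (cell K) (restr f K) (restr g K)"
      using ae_eq_trans[OF ae_eq_trans[OF ae_eq_sym[OF pf(2)]] pg(2)] by blast
    then show "restr f K = restr g K" by (rule ae_eq_polynomial_unique[OF convex[OF K] pf(1) pg(1)]) }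
  assume "restr f K = restr g K"
  then show "ae_eq (cell K) f g" using ae_eq_trans[OF pf(2)] ae_eq_sym[OF pg(2)] by simp
qed

lemma restr_lincomb:
  assumes f: "piecewise T f" and g: "piecewise T g" and K: "K \<in> T"
  shows "restr (\<lambda>x. a *\<^sub>R f x + b *\<^sub>R g x) K = (\<lambda>x. a *\<^sub>R restr f K x + b *\<^sub>R restr g K x)"
    and "ae_eq (cell K) (\<lambda>x. a *\<^sub>R f x + b *\<^sub>R g x) (\<lambda>x. a *\<^sub>R restr f K x + b *\<^sub>R restr g K x)"
proof -
  have pf: "polynomial_function (restr f K)" "ae_eq (cell K) f (restr f K)"
    and pg: "polynomial_function (restr g K)" "ae_eq (cell K) g (restr g K)"
    using f g K by (auto simp: piecewise_def)
  show ae: "ae_eq (cell K) (\<lambda>x. a *\<^sub>R f x + b *\<^sub>R g x) (\<lambda>x. a *\<^sub>R restr f K x + b *\<^sub>R restr g K x)"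
    using pf(2) pg(2) unfolding ae_eq_def by eventually_elim simp
  show "restr (\<lambda>x. a *\<^sub>R f x + b *\<^sub>R g x) K = (\<lambda>x. a *\<^sub>R restr f K x + b *\<^sub>R restr g K x)"
    by (intro restr_eqI[OF convex[OF K] _ ae] polynomial_function_add polynomial_function_cmul pf pg)
qed

lemma piecewise_lincomb:
  assumes f: "piecewise T f" and g: "piecewise T g"
  shows "piecewise T (\<lambda>x. a *\<^sub>R f x + b *\<^sub>R g x)"
  using restr_lincomb[OF assms] assms
  unfolding piecewise_def by (simp add: polynomial_function_add polynomial_function_cmul)

lemma restr_zero: "K \<in> T \<Longrightarrow> restr (\<lambda>x. 0) K = (\<lambda>x. 0)"
  by (rule restr_eqI[OF convex]) (auto simp: ae_eq_refl)

lemma piecewise_zero: "piecewise T (\<lambda>x. 0)"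
  by (simp add: piecewise_def restr_zero ae_eq_refl)

lemma restr_inner:
  assumes f: "piecewise T f" and K: "K \<in> T"
  shows "restr (\<lambda>x. f x \<bullet> n) K = (\<lambda>x. restr f K x \<bullet> n)"
proof (rule restr_eqI[OF convex[OF K]])
  have pf: "polynomial_function (restr f K)" "ae_eq (cell K) f (restr f K)"
    using f K by (auto simp: piecewise_def)
  show "ae_eq (cell K) (\<lambda>x. f x \<bullet> n) (\<lambda>x. restr f K x \<bullet> n)"
    using pf(2) unfolding ae_eq_def by (elim eventually_mono) simp
  show "polynomial_function (\<lambda>x. restr f K x \<bullet> n)"
    using pf(1)[unfolded polynomial_function_def, rule_format, OF bounded_linear_inner_left[of n]]
    by (simp add: o_def real_polynomial_function_eq)
qed

lemma restricts_into_all_iff: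
  assumes S: "\<And>K p. K \<in> T \<Longrightarrow> p \<in> S K \<Longrightarrow> polynomial_function p"
  shows "(\<forall>K\<in>T. restricts_into f K (S K)) \<longleftrightarrow> piecewise T f \<and> (\<forall>K\<in>T. restr f K \<in> S K)"
proof -
  have "restricts_into f K (S K) \<longleftrightarrow> (polynomial_function (restr f K) \<and> ae_eq (cell K) f (restr f K)) \<and> restr f K \<in> S K"
    if K: "K \<in> T" for K
  proof
    assume "restricts_into f K (S K)"
    then obtain p where p: "p \<in> S K" "ae_eq (cell K) f p" unfolding restricts_into_def by blast
    then have "restr f K = p" by (intro restr_eqI[OF convex[OF K]] S[OF K])
    then show "(polynomial_function (restr f K) \<and> ae_eq (cell K) f (restr f K)) \<and> restr f K \<in> S K"
      using p S[OF K] by simp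
  qed (auto simp: restricts_into_def)
  then show ?thesis unfolding piecewise_def by blast
qed

text \<open>At boundary vertices the first condition follows from the second.\<close>

definition nodal :: "(quad \<Rightarrow> real^2 \<Rightarrow> 'b::real_vector) \<Rightarrow> bool" where
  "nodal g \<longleftrightarrow> (\<forall>K\<in>T. \<forall>K'\<in>T. \<forall>i j. K i = K' j \<longrightarrow> g K (K i) = g K' (K' j)) \<and>
     (\<forall>K\<in>T. \<forall>i. K i \<notin> \<Omega> \<longrightarrow> g K (K i) = 0)"

lemma nodal_iff:
  "(\<forall>a \<in> interior_vertices \<Omega> T. single_valued_at T g a) \<and> (\<forall>a \<in> boundary_vertices \<Omega> T. vanishes_at T g a)
   \<longleftrightarrow> nodal g" (is "?L \<longleftrightarrow> _")
proof
  assume L: ?L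
  have v: "g K (K i) = 0" if "K \<in> T" "K i \<notin> \<Omega>" for K i
  proof -
    have "vanishes_at T g (K i)" using L that boundary_vertex_iff by blast
    then show ?thesis using that unfolding vanishes_at_def by blast
  qed
  moreover have "g K (K i) = g K' (K' j)" if "K \<in> T" "K' \<in> T" "K i = K' j" for K K' i j
  proof (cases "K i \<in> \<Omega>")
    case True
    then have "single_valued_at T g (K i)" using L that interior_vertex_iff by blast
    then have "g K (K i) = g K' (K i)" using that unfolding single_valued_at_def by blast
    then show ?thesis using that(3) by simp
  next
    case False
    then show ?thesis using v[of K i] v[of K' j] that by simp
  qed
  ultimately show "nodal g" unfolding nodal_def by blast
next
  assume R: "nodal g"
  have "single_valued_at T g a" for a
    using R unfolding nodal_def single_valued_at_def by (metis imageE)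
  moreover have "vanishes_at T g a" if a: "a \<in> boundary_vertices \<Omega> T" for a
    unfolding vanishes_at_def
  proof (intro ballI impI)
    fix K assume K: "K \<in> T" "a \<in> range K"
    then obtain i where "a = K i" by blast
    then show "g K a = 0" using R a K boundary_vertex_iff unfolding nodal_def by blast
  qed
  ultimately show ?L by blast
qed

lemma nodal_lincomb:
  "nodal g \<Longrightarrow> nodal h \<Longrightarrow> nodal (\<lambda>K x. a *\<^sub>R g K x + b *\<^sub>R h K x)"
  unfolding nodal_def by (metis (no_types, lifting) add.right_neutral scaleR_zero_right)

lemma nodal_cong: "(\<And>K. K \<in> T \<Longrightarrow> g K = h K) \<Longrightarrow> nodal g \<longleftrightarrow> nodal h"
  unfolding nodal_def by simp

lemma nodal_grad_iff: "nodal (\<lambda>K. grad (p K)) \<longleftrightarrow> nodal (\<lambda>K. curl (p K))"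
  unfolding nodal_def by (simp add: grad_eq_iff_curl_eq grad_0_iff_curl_0)

lemma WK_polynomial: "K \<in> T \<Longrightarrow> p \<in> WK K \<Longrightarrow> real_polynomial_function p"
  using polynomial_WK_sum[OF convex] WK_iff[OF convex] by blast

lemma VK_polynomial: "K \<in> T \<Longrightarrow> p \<in> VK K \<Longrightarrow> polynomial_function p"
  using polynomial_VK[OF convex] VK_iff[OF convex] by blast

lemma Wh_iff:
  "w \<in> Wh \<Omega> T \<longleftrightarrow> w \<in> L2 \<Omega> \<and> piecewise T w \<and> (\<forall>K\<in>T. restr w K \<in> WK K) \<and>
     nodal (restr w) \<and> nodal (\<lambda>K. curl (restr w K))"
proof -
  have "(\<forall>K\<in>T. restricts_into w K (WK K)) \<longleftrightarrow> piecewise T w \<and> (\<forall>K\<in>T. restr w K \<in> WK K)"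
    by (rule restricts_into_all_iff) (simp flip: real_polynomial_function_eq add: WK_polynomial)
  then show ?thesis
    unfolding Wh_def nodal_grad_iff[of "restr w", symmetric] nodal_iff[symmetric] by auto
qed

end

section \<open>The global spaces\<close>

context quad_mesh
begin

lemma cell_behind_unique:
  assumes K: "K \<in> T" "K' \<in> T" "K \<noteq> K'" "edge K' j = edge K i"
  shows "(THE L. L \<in> T \<and> edge K i \<in> range (edge L) \<and> behind (edge_normal K i) (edge K i) L) = K"
    and "edge_normal K' j = - edge_normal K i"
proof -
  note rev = shared_edge_reversed[OF K]
  show n: "edge_normal K' j = - edge_normal K i"
    by (simp add: edge_normal_def edge_tangent_def rev dist_commute vec2_eq_iff diff_divide_distrib)
  show "(THE L. L \<in> T \<and> edge K i \<in> range (edge L) \<and> behind (edge_normal K i) (edge K i) L) = K"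
  proof (rule the_equality)
    show "K \<in> T \<and> edge K i \<in> range (edge K) \<and> behind (edge_normal K i) (edge K i) K"
      using K(1) behind_edge_normal(1)[OF convex[OF K(1)]] by blast
    fix L assume L: "L \<in> T \<and> edge K i \<in> range (edge L) \<and> behind (edge_normal K i) (edge K i) L"
    then obtain l where l: "edge L l = edge K i" by auto
    show "L = K"
    proof (rule ccontr)
      assume "L \<noteq> K"
      then have "L = K'" using at_most_two_cells[OF K(1) _ K(2) _ K(3) l K(4)] L by blast
      then have "behind (- edge_normal K' j) (edge K' j) K'" using L n K(4) by simp
      then show False using behind_edge_normal(2)[OF convex[OF K(2)]] by blast
    qed
  qed
qed

text \<open>The jump of the normal component is the sum of the outward normal components of the
  neighbours, so its integral is the quantity in \<open>balanced\<close>. A sign is left only on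
  boundary edges, where the fixed normal may point inwards.\<close>

lemma jump_flux:
  fixes v :: "real^2 \<Rightarrow> real^2"
  assumes nu: "unit_normals T \<nu>" and pw: "piecewise T v" and K: "K \<in> T" and ab: "closed_segment a b = edge K i"
  shows "\<exists>\<sigma>\<in>{1, -1}. seg_integral a b (jump T \<nu> (\<lambda>x. v x \<bullet> \<nu> (edge K i)) (edge K i))
    = \<sigma> * (\<Sum>(K', j) | K' \<in> T \<and> edge K' j = edge K i. edge_flux K' (restr v K') j)"
proof -
  let ?E = "edge K i" and ?n = "edge_normal K i"
  let ?J = "jump T \<nu> (\<lambda>x. v x \<bullet> \<nu> ?E) ?E"
  have V: "convex_quad K" by (rule convex[OF K])
  have "norm (\<nu> ?E) = 1" "\<nu> ?E \<bullet> (K (i+1) - K i) = 0" using nu K by (auto simp: unit_normals_def)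
  then have \<nu>: "\<nu> ?E = ?n \<or> \<nu> ?E = - ?n" by (rule unit_normal_cases[OF V])
  have "{a, b} = {K i, K (i+1)}" using ab unfolding edge_def closed_segment_eq .
  note ends = seg_integral_cong_ends[OF this]
  have cont: "continuous_on UNIV (\<lambda>x. restr v L x \<bullet> n)" if "L \<in> T" for L n
  proof -
    have "polynomial_function (restr v L)" using pw that by (simp add: piecewise_def)
    then show ?thesis by (intro continuous_on_inner continuous_on_const continuous_on_polymonial_function)
  qed
  from K show ?thesis
  proof (cases rule: edge_cases[of K i])
    case boundary
    have b: "boundary_edge T ?E" unfolding boundary_edge_def
      by (rule ex1I[of _ K]) (use K boundary in auto)
    have "(THE L. L \<in> T \<and> ?E \<in> range (edge L)) = K"
      by (rule the_equality) (use K boundary in auto)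
    then have "?J = (\<lambda>x. restr v K x \<bullet> \<nu> ?E)"
      using b by (simp add: jump_def[abs_def] restr_inner[OF pw K])
    moreover obtain \<sigma> :: real where \<sigma>: "\<sigma> \<in> {1, -1}" "\<nu> ?E = \<sigma> *\<^sub>R ?n"
      using \<nu> by (elim disjE) (auto intro: that[of 1] that[of "-1"])
    ultimately have "?J = (\<lambda>x. \<sigma> * (restr v K x \<bullet> ?n))" by simp
    then have "seg_integral a b ?J = \<sigma> * edge_flux K (restr v K) i"
      by (simp add: ends seg_integral_cmult edge_flux_normal[OF V])
    moreover have "(\<Sum>(K', j) | K' \<in> T \<and> edge K' j = ?E. edge_flux K' (restr v K') j) = edge_flux K (restr v K) i"
      by (rule edge_sum_boundary[OF K]) (rule boundary)
    ultimately have "seg_integral a b ?J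
        = \<sigma> * (\<Sum>(K', j) | K' \<in> T \<and> edge K' j = ?E. edge_flux K' (restr v K') j)" by (simp only:)
    with \<sigma>(1) show ?thesis by blast
  next
    case (interior K' j)
    note KK' = K interior
    have K'K: "K' \<in> T" "K \<in> T" "K' \<noteq> K" "edge K i = edge K' j" using KK' by auto
    note n' = cell_behind_unique(2)[OF KK']
    have nb: "\<not> boundary_edge T ?E" unfolding boundary_edge_def using KK' by (metis rangeI)
    have the1: "(THE L. L \<in> T \<and> ?E \<in> range (edge L) \<and> behind ?n ?E L) = K"
      by (rule cell_behind_unique(1)[OF KK'])
    have the2: "(THE L. L \<in> T \<and> ?E \<in> range (edge L) \<and> behind (- ?n) ?E L) = K'"
      using cell_behind_unique(1)[OF K'K] unfolding n' interior(3) .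
    note rr = restr_inner[OF pw K, of "\<nu> ?E"] restr_inner[OF pw interior(1), of "\<nu> ?E"]
    \<comment> \<open>Reversing the fixed normal also exchanges the two cells in the difference, so
      the jump of the normal component does not depend on the choice.\<close>
    have J: "?J = (\<lambda>x. restr v K x \<bullet> ?n + restr v K' x \<bullet> edge_normal K' j)"
      using \<nu>
    proof
      assume e: "\<nu> ?E = ?n"
      have "(THE L. L \<in> T \<and> ?E \<in> range (edge L) \<and> behind (\<nu> ?E) ?E L) = K"
        and "(THE L. L \<in> T \<and> ?E \<in> range (edge L) \<and> behind (- \<nu> ?E) ?E L) = K'"
        unfolding e by (rule the1 the2)+
      then have "?J = (\<lambda>x. restr v K x \<bullet> \<nu> ?E - restr v K' x \<bullet> \<nu> ?E)"
        by (simp only: jump_def[abs_def] nb if_False rr)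
      then show ?thesis by (simp add: e n')
    next
      assume e: "\<nu> ?E = - ?n"
      have "(THE L. L \<in> T \<and> ?E \<in> range (edge L) \<and> behind (\<nu> ?E) ?E L) = K'"
        and "(THE L. L \<in> T \<and> ?E \<in> range (edge L) \<and> behind (- \<nu> ?E) ?E L) = K"
        unfolding e minus_minus by (rule the1 the2)+
      then have "?J = (\<lambda>x. restr v K' x \<bullet> \<nu> ?E - restr v K x \<bullet> \<nu> ?E)"
        by (simp only: jump_def[abs_def] nb if_False rr)
      then show ?thesis by (simp add: e n')
    qed
    have "{K i, K (i+1)} = {K' j, K' (j+1)}" using interior(3) unfolding edge_eq_iff by simp
    note ends' = seg_integral_cong_ends[OF this]
    have "seg_integral a b ?J = edge_flux K (restr v K) i + edge_flux K' (restr v K') j"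
      unfolding J ends seg_integral_add[OF cont[OF K] cont[OF interior(1)]] edge_flux_normal[OF V]
      unfolding ends' edge_flux_normal[OF convex[OF interior(1)]] ..
    moreover have "(\<Sum>(K', j) | K' \<in> T \<and> edge K' j = ?E. edge_flux K' (restr v K') j)
        = edge_flux K (restr v K) i + edge_flux K' (restr v K') j"
      by (rule edge_sum_interior[OF KK'])
    ultimately have "seg_integral a b ?J
        = 1 * (\<Sum>(K', j) | K' \<in> T \<and> edge K' j = ?E. edge_flux K' (restr v K') j)" by argo
    then show ?thesis by blast
  qed
qed

lemma Vh_iff:
  assumes nu: "unit_normals T \<nu>"
  shows "v \<in> Vh \<Omega> T \<nu> \<longleftrightarrow> v \<in> L2 \<Omega> \<and> piecewise T v \<and> (\<forall>K\<in>T. restr v K \<in> VK K) \<and>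
     balanced T (\<lambda>K. edge_flux K (restr v K)) \<and> nodal (restr v)"
proof -
  have r: "(\<forall>K\<in>T. restricts_into v K (VK K)) \<longleftrightarrow> piecewise T v \<and> (\<forall>K\<in>T. restr v K \<in> VK K)"
    by (rule restricts_into_all_iff) (rule VK_polynomial)
  have "(\<forall>a b. closed_segment a b \<in> mesh_edges T \<longrightarrow>
        (let E = closed_segment a b in seg_integral a b (jump T \<nu> (\<lambda>x. v x \<bullet> \<nu> E) E) = 0)) \<longleftrightarrow>
      balanced T (\<lambda>K. edge_flux K (restr v K))" (is "?L \<longleftrightarrow> ?R") if pw: "piecewise T v"
  proof
    assume L: ?L
    show ?R unfolding balanced_def
    proof
      fix E assume "E \<in> mesh_edges T"
      then obtain K i where K: "K \<in> T" "E = edge K i" by (auto simp: mesh_edges_def)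
      have ab: "closed_segment (K i) (K (i+1)) = edge K i" by (simp add: edge_def)
      obtain \<sigma> :: real where "\<sigma> \<in> {1, -1}" and
        \<sigma>: "seg_integral (K i) (K (i+1)) (jump T \<nu> (\<lambda>x. v x \<bullet> \<nu> (edge K i)) (edge K i))
        = \<sigma> * (\<Sum>(K', j) | K' \<in> T \<and> edge K' j = edge K i. edge_flux K' (restr v K') j)"
        using jump_flux[OF nu pw K(1) ab] by blast
      have "edge K i \<in> mesh_edges T" using K(1) by (auto simp: mesh_edges_def)
      then have "seg_integral (K i) (K (i+1)) (jump T \<nu> (\<lambda>x. v x \<bullet> \<nu> (edge K i)) (edge K i)) = 0"
        using L[unfolded Let_def, rule_format, of "K i" "K (i+1)"] unfolding ab by blast
      then show "(\<Sum>(K', j) | K' \<in> T \<and> edge K' j = E. edge_flux K' (restr v K') j) = 0"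
        using \<sigma> \<open>\<sigma> \<in> {1, -1}\<close> unfolding K(2) by auto
    qed
  next
    assume R: ?R
    show ?L unfolding Let_def
    proof (intro allI impI)
      fix a b assume E: "closed_segment a b \<in> mesh_edges T"
      then obtain K i where K: "K \<in> T" and ab: "closed_segment a b = edge K i" by (auto simp: mesh_edges_def)
      have "(\<Sum>(K', j) | K' \<in> T \<and> edge K' j = edge K i. edge_flux K' (restr v K') j) = 0"
        using R K unfolding balanced_def mesh_edges_def by blast
      moreover obtain \<sigma> :: real where "seg_integral a b (jump T \<nu> (\<lambda>x. v x \<bullet> \<nu> (edge K i)) (edge K i))
        = \<sigma> * (\<Sum>(K', j) | K' \<in> T \<and> edge K' j = edge K i. edge_flux K' (restr v K') j)"
        using jump_flux[OF nu pw K ab] by blast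
      ultimately show "seg_integral a b (jump T \<nu> (\<lambda>x. v x \<bullet> \<nu> (closed_segment a b)) (closed_segment a b)) = 0"
        unfolding ab by (simp only: mult_zero_right)
    qed
  qed
  then show ?thesis unfolding Vh_def nodal_iff[symmetric] r[symmetric] using r by blast
qed

lemma integral_piecewise_constant:
  fixes q :: "real^2 \<Rightarrow> real"
  assumes q: "q \<in> L2 \<Omega>" and pw: "piecewise T q" and c: "\<And>K. K \<in> T \<Longrightarrow> restr q K = (\<lambda>x. c K)"
  shows "(LINT x|lebesgue_on \<Omega>. q x) = (\<Sum>K\<in>T. c K * measure lebesgue (cell K))"
proof -
  let ?g = "glue T (\<lambda>K x. c K) :: real^2 \<Rightarrow> real"
  have pg: "piecewise T ?g" by (rule piecewise_glue) simp
  have "ae_eq \<Omega> q ?g"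
    unfolding piecewise_ae_eq_iff[OF pw pg] using c by (simp add: restr_glue)
  moreover have "?g \<in> L2 \<Omega>" by (rule L2_glue) simp
  ultimately have "(LINT x|lebesgue_on \<Omega>. q x) = (LINT x|lebesgue_on \<Omega>. ?g x)"
    using q by (intro integral_cong_AE) (auto simp: L2_def ae_eq_def)
  also have "\<dots> = (\<Sum>K\<in>T. LINT x|lebesgue_on \<Omega>. indicator (interior (cell K)) x *\<^sub>R c K)"
  proof -
    interpret finite_measure "lebesgue_on \<Omega>"
      by (intro finite_measure_lebesgue_on lmeasurable_open bounded_dom open_dom)
    have "integrable (lebesgue_on \<Omega>) (\<lambda>x. indicator (interior (cell K)) x *\<^sub>R c K)" if "K \<in> T" for K
    proof (rule integrable_const_bound[where B = "\<bar>c K\<bar>"])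
      have "(\<lambda>x. indicator (interior (cell K)) x *\<^sub>R c K) \<in> borel_measurable borel"
        by (intro borel_measurable_scaleR borel_measurable_indicator) auto
      then have "(\<lambda>x. indicator (interior (cell K)) x *\<^sub>R c K) \<in> borel_measurable lebesgue"
        by (intro measurable_completion) simp
      then show "(\<lambda>x. indicator (interior (cell K)) x *\<^sub>R c K) \<in> borel_measurable (lebesgue_on \<Omega>)"
        by (rule measurable_restrict_space1)
    qed (auto simp: indicator_def)
    then show ?thesis unfolding glue_def by (rule Bochner_Integration.integral_sum)
  qed
  also have "\<dots> = (\<Sum>K\<in>T. c K * measure lebesgue (cell K))"
  proof (intro sum.cong refl)
    fix K assume K: "K \<in> T"
    have sub: "interior (cell K) \<subseteq> \<Omega>" by (rule interior_cell_subset[OF K])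
    have "(LINT x|lebesgue_on \<Omega>. indicator (interior (cell K)) x *\<^sub>R c K)
        = (LINT x|lebesgue_on \<Omega>. indicator (interior (cell K)) x) *\<^sub>R c K"
      by simp
    also have "(LINT x|lebesgue_on \<Omega>. indicator (interior (cell K)) x) = measure (lebesgue_on \<Omega>) (interior (cell K))"
      using sub by (simp add: Int_absorb2)
    also have "\<dots> = measure lebesgue (interior (cell K))"
      using sub by (intro measure_restrict_space) auto
    also have "\<dots> = measure lebesgue (cell K)"
      by (intro measure_interior negligible_convex_frontier) simp_all
    finally show "(LINT x|lebesgue_on \<Omega>. indicator (interior (cell K)) x *\<^sub>R c K) = c K * measure lebesgue (cell K)"
      by simp
  qed
  finally show ?thesis .
qed

lemma Ph_iff:
  "q \<in> Ph \<Omega> T \<longleftrightarrow> q \<in> L2 \<Omega> \<and> piecewise T q \<and>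
     (\<exists>c. (\<forall>K\<in>T. restr q K = (\<lambda>x. c K)) \<and> (\<Sum>K\<in>T. c K * measure lebesgue (cell K)) = 0)"
proof -
  have r: "(\<forall>K\<in>T. restricts_into q K (Pk 0)) \<longleftrightarrow> piecewise T q \<and> (\<forall>K\<in>T. restr q K \<in> Pk 0)"
    by (rule restricts_into_all_iff) (simp flip: real_polynomial_function_eq add: real_polynomial_function_Pk)
  have e: "(\<forall>K\<in>T. restr q K \<in> Pk 0) \<longleftrightarrow> (\<exists>c. \<forall>K\<in>T. restr q K = (\<lambda>x. c K))"
    unfolding Pk_0_iff by (rule bchoice_iff)
  show ?thesis unfolding Ph_def mem_Collect_eq r e using integral_piecewise_constant[of q] by auto
qed

section \<open>Fluxes with prescribed sums on the cells\<close>

lemma balanced_zero: "balanced T (\<lambda>K i. 0)"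
  by (simp add: balanced_def)

text \<open>A unit of flux crosses the common edge: it counts +1 as outflow of \<open>K'\<close> and
  -1 as outflow of \<open>K\<close>, and the two cancel on the edge.\<close>

lemma balanced_unit_flow:
  assumes "K \<in> T" "K' \<in> T" "edge K' j = edge K i"
  shows "balanced T (\<lambda>L l. (if (L, l) = (K', j) then 1 else 0) - (if (L, l) = (K, i) then 1 else 0))"
  unfolding balanced_def
proof
  fix E assume "E \<in> mesh_edges T"
  let ?S = "{(L, l). L \<in> T \<and> edge L l = E}"
  have fin: "finite ?S" by (rule finite_subset[of _ "T \<times> UNIV"]) (use finite_mesh in auto)
  have "(\<Sum>(L, l)\<in>?S. (if (L, l) = (K', j) then 1 else 0) - (if (L, l) = (K, i) then 1 else 0))
      = (\<Sum>d\<in>?S. (if d = (K', j) then 1 else 0) - (if d = (K, i) then 1 else 0 :: real))"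
    by (rule sum.cong) (auto split: if_splits)
  also have "\<dots> = (\<Sum>d\<in>?S. if d = (K', j) then 1 else 0) - (\<Sum>d\<in>?S. if d = (K, i) then 1 else 0 :: real)"
    by (rule sum_subtractf)
  also have "\<dots> = 0" using assms fin by (simp add: sum.delta)
  finally show "(\<Sum>(L, l)\<in>?S. (if (L, l) = (K', j) then 1 else 0) - (if (L, l) = (K, i) then 1 else 0)) = (0::real)" .
qed

text \<open>Chains of neighbouring cells give for each cell \<open>K\<close> a balanced flux with
  total 1 on \<open>K\<close>, -1 on a fixed cell \<open>K0\<close> and 0 elsewhere. In the
  superposition with weights \<open>d\<close>, the terms at \<open>K0\<close> add up to minus the
  total of \<open>d\<close>, which is 0.\<close>

lemma flow_exists:
  fixes d :: "quad \<Rightarrow> real"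
  assumes d: "(\<Sum>K\<in>T. d K) = 0"
  shows "\<exists>F. balanced T F \<and> (\<forall>K\<in>T. (\<Sum>i\<in>UNIV. F K i) = d K)"
proof -
  obtain K0 where K0: "K0 \<in> T" using mesh_nonempty by blast
  define reach where "reach K F \<longleftrightarrow> balanced T F \<and>
    (\<forall>L\<in>T. (\<Sum>i\<in>UNIV. F L i) = (if L = K then 1 else 0) - (if L = K0 then 1 else 0 :: real))" for K F
  have "{K \<in> T. \<exists>F. reach K F} = T"
  proof (rule mesh_edge_connected)
    have "reach K0 (\<lambda>K i. 0)" by (simp add: reach_def balanced_zero)
    then show "{K \<in> T. \<exists>F. reach K F} \<noteq> {}" using K0 by blast
    fix K K' i j assume K: "K \<in> {K \<in> T. \<exists>F. reach K F}" and K': "K' \<in> T" and e: "edge K' j = edge K i"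
    then obtain F where F: "reach K F" by blast
    let ?G = "\<lambda>L l. (if (L, l) = (K', j) then 1 else 0) - (if (L, l) = (K, i) then 1 else 0 :: real)"
    have G: "balanced T ?G" by (rule balanced_unit_flow[OF _ K' e]) (use K in simp)
    have "reach K' (\<lambda>L l. 1 * F L l + 1 * ?G L l)"
      unfolding reach_def
    proof (intro conjI ballI balanced_lincomb G)
      show "balanced T F" using F by (simp add: reach_def)
      fix L assume L: "L \<in> T"
      have "(\<Sum>l\<in>UNIV. ?G L l) = (if L = K' then 1 else 0) - (if L = K then 1 else 0)"
        by (cases "L = K'"; cases "L = K") (simp_all add: sum_subtractf sum_negf)
      then show "(\<Sum>l\<in>UNIV. 1 * F L l + 1 * ?G L l) = (if L = K' then 1 else 0) - (if L = K0 then 1 else 0)"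
        using F L by (simp add: reach_def sum.distrib)
    qed
    then show "K' \<in> {K \<in> T. \<exists>F. reach K F}" using K' by blast
  qed simp
  then have "\<forall>K\<in>T. \<exists>F. reach K F" by blast
  then obtain F where F: "\<And>K. K \<in> T \<Longrightarrow> reach K (F K)" by metis
  define G where "G L i = (\<Sum>K\<in>T. d K * F K L i)" for L i
  have "balanced T G" unfolding G_def[abs_def] by (rule balanced_sum) (use F in \<open>simp add: reach_def\<close>)
  moreover have "(\<Sum>i\<in>UNIV. G L i) = d L" if L: "L \<in> T" for L
  proof -
    have "(\<Sum>i\<in>UNIV. G L i) = (\<Sum>K\<in>T. d K * (\<Sum>i\<in>UNIV. F K L i))"
      unfolding G_def sum_distrib_left by (rule sum.swap)
    also have "\<dots> = (\<Sum>K\<in>T. d K * ((if L = K then 1 else 0) - (if L = K0 then 1 else 0)))"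
      using F L by (intro sum.cong) (simp_all add: reach_def)
    also have "\<dots> = (\<Sum>K\<in>T. (if L = K then d K else 0)) - (\<Sum>K\<in>T. d K) * (if L = K0 then 1 else 0)"
      by (simp add: right_diff_distrib sum_subtractf sum_distrib_right if_distrib[of "\<lambda>x. _ * x"] cong: if_cong)
    also have "\<dots> = d L" using L finite_mesh d by simp
    finally show ?thesis .
  qed
  ultimately show ?thesis by blast
qed

lemma measure_cell_pos:
  assumes "K \<in> T" shows "measure lebesgue (cell K) > 0"
  unfolding measure_cell[OF convex[OF assms]] using convex_quad_triangles[OF convex[OF assms]]
  by (simp add: sum_4 cross2_def algebra_simps)

section \<open>The global spaces are vector spaces\<close>

lemma fun_subspace_Wh: "fun_subspace (Wh \<Omega> T)"
  unfolding fun_subspace_def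
proof (intro conjI ballI allI)
  show "(\<lambda>x. 0) \<in> Wh \<Omega> T"
    using fun_subspace_WK[OF convex]
    by (auto simp: Wh_iff L2_zero piecewise_zero restr_zero nodal_def curl_const fun_subspace_def)
  fix f g a b assume f: "f \<in> Wh \<Omega> T" and g: "g \<in> Wh \<Omega> T"
  then have pf: "piecewise T f" "piecewise T g" by (simp_all add: Wh_iff)
  note R = restr_lincomb(1)[OF pf, of _ a b]
  let ?h = "\<lambda>x. a *\<^sub>R f x + b *\<^sub>R g x"
  have wk: "restr f K \<in> WK K" "restr g K \<in> WK K" if "K \<in> T" for K
    using f g that by (simp_all add: Wh_iff)
  have "restr ?h K \<in> WK K" if "K \<in> T" for K
    using R[OF that] fun_subspace_lincomb[OF fun_subspace_WK[OF convex[OF that]] wk[OF that]] by simp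
  moreover have "nodal (restr ?h)"
    using nodal_lincomb[of "restr f" "restr g" a b] f g nodal_cong[of "restr ?h" "\<lambda>K x. a *\<^sub>R restr f K x + b *\<^sub>R restr g K x"] R
    by (simp add: Wh_iff)
  moreover have "nodal (\<lambda>K. curl (restr ?h K))"
  proof -
    have "curl (restr ?h K) = (\<lambda>x. a *\<^sub>R curl (restr f K) x + b *\<^sub>R curl (restr g K) x)" if K: "K \<in> T" for K
      using R[OF K] curl_lincomb[OF WK_polynomial[OF K wk(1)[OF K]] WK_polynomial[OF K wk(2)[OF K]], of a b] by simp
    then show ?thesis
      using nodal_lincomb[of "\<lambda>K. curl (restr f K)" "\<lambda>K. curl (restr g K)" a b] f g
        nodal_cong[of "\<lambda>K. curl (restr ?h K)" "\<lambda>K x. a *\<^sub>R curl (restr f K) x + b *\<^sub>R curl (restr g K) x"]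
      by (simp add: Wh_iff)
  qed
  ultimately show "?h \<in> Wh \<Omega> T"
    using f g L2_lincomb[of f \<Omega> g a b] piecewise_lincomb[OF pf, of a b] by (simp add: Wh_iff)
qed

lemma edge_flux_zero: "edge_flux K (\<lambda>x. 0) i = 0"
  by (simp add: edge_flux_def)

lemma balanced_cong: "(\<And>K i. K \<in> T \<Longrightarrow> f K i = g K i) \<Longrightarrow> balanced T f \<longleftrightarrow> balanced T g"
proof -
  assume *: "\<And>K i. K \<in> T \<Longrightarrow> f K i = g K i"
  have "(\<Sum>(K, i) | K \<in> T \<and> edge K i = E. f K i) = (\<Sum>(K, i) | K \<in> T \<and> edge K i = E. g K i)" for E
    by (rule sum.cong) (use * in auto)
  then show ?thesis by (simp add: balanced_def)
qed

lemma fun_subspace_Vh: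
  assumes nu: "unit_normals T \<nu>" shows "fun_subspace (Vh \<Omega> T \<nu>)"
  unfolding fun_subspace_def
proof (intro conjI ballI allI)
  have "balanced T (\<lambda>K. edge_flux K (restr (\<lambda>x. 0) K))"
    using balanced_zero by (subst balanced_cong[where g = "\<lambda>K i. 0"]) (simp_all add: restr_zero edge_flux_zero)
  then show "(\<lambda>x. 0) \<in> Vh \<Omega> T \<nu>"
    using fun_subspace_VK[OF convex]
    by (auto simp: Vh_iff[OF nu] L2_zero piecewise_zero restr_zero nodal_def fun_subspace_def)
  fix f g a b assume f: "f \<in> Vh \<Omega> T \<nu>" and g: "g \<in> Vh \<Omega> T \<nu>"
  then have pf: "piecewise T f" "piecewise T g" by (simp_all add: Vh_iff[OF nu])
  note R = restr_lincomb(1)[OF pf, of _ a b]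
  let ?h = "\<lambda>x. a *\<^sub>R f x + b *\<^sub>R g x"
  have vk: "restr f K \<in> VK K" "restr g K \<in> VK K" if "K \<in> T" for K
    using f g that by (simp_all add: Vh_iff[OF nu])
  have "restr ?h K \<in> VK K" if "K \<in> T" for K
    using R[OF that] fun_subspace_lincomb[OF fun_subspace_VK[OF convex[OF that]] vk[OF that]] by simp
  moreover have "nodal (restr ?h)"
    using nodal_lincomb[of "restr f" "restr g" a b] f g nodal_cong[of "restr ?h" "\<lambda>K x. a *\<^sub>R restr f K x + b *\<^sub>R restr g K x"] R
    by (simp add: Vh_iff[OF nu])
  moreover have "balanced T (\<lambda>K. edge_flux K (restr ?h K))"
  proof -
    have "edge_flux K (restr ?h K) i = a * edge_flux K (restr f K) i + b * edge_flux K (restr g K) i" if K: "K \<in> T" for K i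
      using R[OF K] edge_flux_lincomb[OF VK_polynomial[OF K vk(1)[OF K]] VK_polynomial[OF K vk(2)[OF K]], of K a b i] by simp
    then show ?thesis
      using balanced_lincomb[of T "\<lambda>K. edge_flux K (restr f K)" "\<lambda>K. edge_flux K (restr g K)" a b] f g
        balanced_cong[of "\<lambda>K. edge_flux K (restr ?h K)" "\<lambda>K i. a * edge_flux K (restr f K) i + b * edge_flux K (restr g K) i"]
      by (simp add: Vh_iff[OF nu])
  qed
  ultimately show "?h \<in> Vh \<Omega> T \<nu>"
    using f g L2_lincomb[of f \<Omega> g a b] piecewise_lincomb[OF pf, of a b] by (simp add: Vh_iff[OF nu])
qed

lemma fun_subspace_Ph: "fun_subspace (Ph \<Omega> T)"
  unfolding fun_subspace_def
proof (intro conjI ballI allI)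
  show "(\<lambda>x. 0) \<in> Ph \<Omega> T"
    unfolding Ph_iff by (intro conjI exI[of _ "\<lambda>K. 0"]) (simp_all add: L2_zero piecewise_zero restr_zero)
  fix f g :: "real^2 \<Rightarrow> real" and a b assume f: "f \<in> Ph \<Omega> T" and g: "g \<in> Ph \<Omega> T"
  then have pf: "piecewise T f" "piecewise T g" by (simp_all add: Ph_iff)
  obtain c d where c: "\<forall>K\<in>T. restr f K = (\<lambda>x. c K)" "(\<Sum>K\<in>T. c K * measure lebesgue (cell K)) = 0"
    and d: "\<forall>K\<in>T. restr g K = (\<lambda>x. d K)" "(\<Sum>K\<in>T. d K * measure lebesgue (cell K)) = 0"
    using f g unfolding Ph_iff by blast
  have "(\<Sum>K\<in>T. (a * c K + b * d K) * measure lebesgue (cell K))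
      = a * (\<Sum>K\<in>T. c K * measure lebesgue (cell K)) + b * (\<Sum>K\<in>T. d K * measure lebesgue (cell K))"
    by (simp add: sum.distrib sum_distrib_left distrib_right mult.assoc)
  then have "(\<Sum>K\<in>T. (a * c K + b * d K) * measure lebesgue (cell K)) = 0" using c d by simp
  moreover have "\<forall>K\<in>T. restr (\<lambda>x. a *\<^sub>R f x + b *\<^sub>R g x) K = (\<lambda>x. a * c K + b * d K)"
    using restr_lincomb(1)[OF pf, of _ a b] c d by simp
  ultimately show "(\<lambda>x. a *\<^sub>R f x + b *\<^sub>R g x) \<in> Ph \<Omega> T"
    using f g L2_lincomb[of f \<Omega> g a b] piecewise_lincomb[OF pf, of a b]
    unfolding Ph_iff by (intro conjI exI[of _ "\<lambda>K. a * c K + b * d K"]) auto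
qed

end

section \<open>Exactness\<close>

context quad_mesh
begin

lemma cellwise_props:
  assumes "\<forall>K\<in>T. polynomial_function (D (restr f K))"
  shows "\<And>K. K \<in> T \<Longrightarrow> restr (cellwise T D f) K = D (restr f K)" "piecewise T (cellwise T D f)"
    "cellwise T D f \<in> L2 \<Omega>"
  unfolding cellwise_eq_glue using assms by (simp_all add: restr_glue piecewise_glue L2_glue)

text \<open>\<open>cellwise\<close> sees a function only through its cell polynomials, so equivalent
  functions even have identical images, and linearity reduces to linearity of \<open>D\<close> on
  polynomials.\<close>

lemma ae_linear_map_cellwise:
  assumes X: "fun_subspace X" and pw: "\<And>f. f \<in> X \<Longrightarrow> piecewise T f"
    and poly: "\<And>p. polynomial_function p \<Longrightarrow> polynomial_function (D p)"
    and lin: "\<And>p q a b. polynomial_function p \<Longrightarrow> polynomial_function q \<Longrightarrow>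
      D (\<lambda>x. a *\<^sub>R p x + b *\<^sub>R q x) = (\<lambda>x. a *\<^sub>R D p x + b *\<^sub>R D q x)"
    and into: "\<And>f. f \<in> X \<Longrightarrow> cellwise T D f \<in> Y"
  shows "ae_linear_map \<Omega> X Y (cellwise T D)"
proof -
  have pD: "\<forall>K\<in>T. polynomial_function (D (restr f K))" if "f \<in> X" for f
    using pw[OF that] by (auto intro: poly simp: piecewise_def)
  have eq: "ae_eq \<Omega> (cellwise T D f) (cellwise T D g)" if f: "f \<in> X" and g: "g \<in> X" and "ae_eq \<Omega> f g" for f g
  proof -
    have "restr f K = restr g K" if "K \<in> T" for K
      using \<open>ae_eq \<Omega> f g\<close> piecewise_ae_eq_iff[OF pw[OF f] pw[OF g]] that by blast
    then have "cellwise T D f = cellwise T D g"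
      by (intro ext, unfold cellwise_def, intro sum.cong refl) simp
    then show ?thesis by (simp add: ae_eq_refl)
  qed
  have add: "ae_eq \<Omega> (cellwise T D (\<lambda>x. a *\<^sub>R f x + b *\<^sub>R g x)) (\<lambda>x. a *\<^sub>R cellwise T D f x + b *\<^sub>R cellwise T D g x)"
    if f: "f \<in> X" and g: "g \<in> X" for f g a b
  proof -
    let ?h = "\<lambda>x. a *\<^sub>R f x + b *\<^sub>R g x"
    have h: "?h \<in> X" by (rule fun_subspace_lincomb[OF X f g])
    note cf = cellwise_props[of D f, OF pD[OF f]] and cg = cellwise_props[of D g, OF pD[OF g]]
      and ch = cellwise_props[of D ?h, OF pD[OF h]]
    note pfg = piecewise_lincomb[OF cf(2) cg(2), of a b]
    show ?thesis
    proof (rule piecewise_ae_eq_iff[THEN iffD2, OF ch(2) pfg], rule ballI)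
      fix K assume K: "K \<in> T"
      have "polynomial_function (restr f K)" "polynomial_function (restr g K)"
        using pw[OF f] pw[OF g] K by (simp_all add: piecewise_def)
      then show "restr (cellwise T D ?h) K = restr (\<lambda>x. a *\<^sub>R cellwise T D f x + b *\<^sub>R cellwise T D g x) K"
        using K by (simp add: ch(1) cf(1) cg(1) restr_lincomb(1)[OF cf(2) cg(2)] restr_lincomb(1)[OF pw[OF f] pw[OF g]] lin)
    qed
  qed
  show ?thesis unfolding ae_linear_map_def using into eq add by blast
qed

lemma curl_h_restr:
  assumes w: "w \<in> Wh \<Omega> T"
  shows "\<And>K. K \<in> T \<Longrightarrow> restr (curl_h T w) K = curl (restr w K)" "piecewise T (curl_h T w)" "curl_h T w \<in> L2 \<Omega>"
proof -
  have "\<forall>K\<in>T. polynomial_function (curl (restr w K))"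
    using w by (auto simp: Wh_iff intro!: polynomial_function_curl intro: WK_polynomial)
  from cellwise_props[of curl w, OF this]
  show "\<And>K. K \<in> T \<Longrightarrow> restr (curl_h T w) K = curl (restr w K)" "piecewise T (curl_h T w)" "curl_h T w \<in> L2 \<Omega>"
    by (simp_all add: curl_h_def)
qed

text \<open>Two cells traverse a common edge in opposite directions, so the differences of the
  shared vertex values cancel; on a boundary edge both endpoint values are 0.\<close>

lemma nodal_values_balanced:
  assumes p: "nodal p" shows "balanced T (\<lambda>K i. p K (K (i+1)) - p K (K i))"
  unfolding balanced_def balanced_edges_iff
proof (intro ballI allI conjI impI)
  have v: "p K (K i) = p K' (K' j)" if "K \<in> T" "K' \<in> T" "K i = K' j" for K K' i j
    using p that unfolding nodal_def by blast
  fix K i assume K: "K \<in> T"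
  { fix K' j assume K': "K' \<in> T" "K' \<noteq> K" and e: "edge K' j = edge K i"
    note rev = shared_edge_reversed[OF K K'(1) K'(2)[symmetric] e]
    have "p K' (K' j) = p K (K (i+1))" by (rule v[OF K'(1) K rev(1)])
    moreover have "p K' (K' (j+1)) = p K (K i)" by (rule v[OF K'(1) K rev(2)])
    ultimately show "p K (K (i+1)) - p K (K i) + (p K' (K' (j+1)) - p K' (K' j)) = 0" by simp }
  assume b: "\<forall>K'\<in>T. \<forall>j. edge K' j = edge K i \<longrightarrow> K' = K"
  have "K i \<notin> \<Omega>" by (rule boundary_edge_vertices(1)[OF K]) (use b in blast)
  moreover have "K (i+1) \<notin> \<Omega>" by (rule boundary_edge_vertices(2)[OF K]) (use b in blast)
  moreover have "p K (K l) = 0" if "K l \<notin> \<Omega>" for l using p K that unfolding nodal_def by blast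
  ultimately show "p K (K (i+1)) - p K (K i) = 0" by simp
qed

lemma curl_h_Vh:
  assumes nu: "unit_normals T \<nu>" and w: "w \<in> Wh \<Omega> T" shows "curl_h T w \<in> Vh \<Omega> T \<nu>"
proof -
  note c = curl_h_restr[OF w]
  have wk: "restr w K \<in> WK K" "real_polynomial_function (restr w K)" if "K \<in> T" for K
    using w that WK_polynomial by (auto simp: Wh_iff)
  have "curl (restr w K) \<in> VK K" if K: "K \<in> T" for K
    using curl_WK_iff[OF convex[OF K]] wk(1)[OF K] unfolding WK_iff[OF convex[OF K]] by blast
  moreover have "balanced T (\<lambda>K. edge_flux K (restr (curl_h T w) K))"
  proof (subst balanced_cong)
    show "edge_flux K (restr (curl_h T w) K) i = restr w K (K (i+1)) - restr w K (K i)" if "K \<in> T" for K i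
      using that by (simp add: c(1) edge_flux_curl wk(2))
    show "balanced T (\<lambda>K i. restr w K (K (i+1)) - restr w K (K i))"
      using w by (intro nodal_values_balanced) (simp add: Wh_iff)
  qed
  moreover have "nodal (restr (curl_h T w))"
    using w nodal_cong[of "restr (curl_h T w)" "\<lambda>K. curl (restr w K)"] c(1) by (simp add: Wh_iff)
  ultimately show ?thesis unfolding Vh_iff[OF nu] using c by simp
qed

lemma div_h_restr:
  assumes nu: "unit_normals T \<nu>" and v: "v \<in> Vh \<Omega> T \<nu>"
  shows "\<And>K. K \<in> T \<Longrightarrow> restr (div_h T v) K = divergence (restr v K)" "piecewise T (div_h T v)" "div_h T v \<in> L2 \<Omega>"
proof -
  have "\<forall>K\<in>T. polynomial_function (divergence (restr v K))"
    using v VK_polynomial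
    by (simp add: Vh_iff[OF nu] real_polynomial_function_divergence flip: real_polynomial_function_eq)
  from cellwise_props[of divergence v, OF this]
  show "\<And>K. K \<in> T \<Longrightarrow> restr (div_h T v) K = divergence (restr v K)" "piecewise T (div_h T v)" "div_h T v \<in> L2 \<Omega>"
    by (simp_all add: div_h_def)
qed

text \<open>By the divergence theorem on each cell the integral of the divergence is the sum of all
  outward fluxes, which cancel edge by edge. Hence the mean value is zero.\<close>

lemma div_h_Ph:
  assumes nu: "unit_normals T \<nu>" and v: "v \<in> Vh \<Omega> T \<nu>" shows "div_h T v \<in> Ph \<Omega> T"
proof -
  note d = div_h_restr[OF nu v]
  have "\<exists>c. divergence (restr v K) = (\<lambda>x. c) \<and> (\<Sum>i\<in>UNIV. edge_flux K (restr v K) i) = c * measure lebesgue (cell K)"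
    if "K \<in> T" for K
    using v that by (intro VK_divergence convex) (auto simp: Vh_iff[OF nu])
  then obtain c where c: "\<And>K. K \<in> T \<Longrightarrow> divergence (restr v K) = (\<lambda>x. c K)"
    "\<And>K. K \<in> T \<Longrightarrow> (\<Sum>i\<in>UNIV. edge_flux K (restr v K) i) = c K * measure lebesgue (cell K)" by metis
  have "(\<Sum>K\<in>T. \<Sum>i\<in>UNIV. edge_flux K (restr v K) i * 1) = 0"
    using v by (intro sum_balanced_edges[OF finite_mesh, where h = "\<lambda>x. 1"])
      (simp add: Vh_iff[OF nu] balanced_def)
  then have "(\<Sum>K\<in>T. c K * measure lebesgue (cell K)) = 0" using c(2) by simp
  then show ?thesis unfolding Ph_iff using d c(1) by auto
qed

text \<open>A cellwise constant function in W_h vanishes on a cell with a vertex on the boundary,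
  and zero spreads from cell to cell through the vertices of common edges.\<close>

lemma curl_h_injective:
  assumes w: "w \<in> Wh \<Omega> T" shows "ae_eq \<Omega> (curl_h T w) (\<lambda>x. 0) \<longleftrightarrow> ae_eq \<Omega> w (\<lambda>x. 0)"
proof -
  note c = curl_h_restr[OF w]
  have pw: "piecewise T w" and nod: "nodal (restr w)" using w by (simp_all add: Wh_iff)
  have pol: "real_polynomial_function (restr w K)" if "K \<in> T" for K
    using w that WK_polynomial by (auto simp: Wh_iff)
  have "(\<forall>K\<in>T. curl (restr w K) = (\<lambda>x. 0)) \<longleftrightarrow> (\<forall>K\<in>T. restr w K = (\<lambda>x. 0))"
  proof
    assume L: "\<forall>K\<in>T. curl (restr w K) = (\<lambda>x. 0)"
    have const: "restr w K x = restr w K y" if "K \<in> T" for K x y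
      using curl_0_imp_constant[OF pol[OF that]] L that by blast
    let ?A = "{K \<in> T. restr w K = (\<lambda>x. 0)}"
    have "?A = T"
    proof (rule mesh_edge_connected)
      obtain K i where K: "K \<in> T" "K i \<notin> \<Omega>" using boundary_vertex_exists by blast
      then have "restr w K (K i) = 0" using nod unfolding nodal_def by blast
      then have "restr w K = (\<lambda>x. 0)" using const[OF K(1), of _ "K i"] by auto
      then show "?A \<noteq> {}" using K(1) by blast
      fix K K' i j assume K: "K \<in> ?A" and K': "K' \<in> T" and e: "edge K' j = edge K i"
      have "K' j = K i \<or> K' j = K (i+1)" using e unfolding edge_eq_iff by (auto simp: doubleton_eq_iff)
      then obtain l where "K' j = K l" by blast
      then have "restr w K' (K' j) = restr w K (K l)" using nod K K' unfolding nodal_def by blast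
      then have "restr w K' (K' j) = 0" using K by simp
      then have "restr w K' = (\<lambda>x. 0)" using const[OF K', of _ "K' j"] by auto
      then show "K' \<in> ?A" using K' by blast
    qed simp
    then show "\<forall>K\<in>T. restr w K = (\<lambda>x. 0)" by blast
  next
    show "\<forall>K\<in>T. restr w K = (\<lambda>x. 0) \<Longrightarrow> \<forall>K\<in>T. curl (restr w K) = (\<lambda>x. 0)" by (simp add: curl_const)
  qed
  then show ?thesis
    using c(1) by (simp add: piecewise_ae_eq_iff[OF c(2) piecewise_zero] piecewise_ae_eq_iff[OF pw piecewise_zero] restr_zero)
qed

lemma kernel_div_h:
  assumes sc: "simply_connected \<Omega>" and nu: "unit_normals T \<nu>" and v: "v \<in> Vh \<Omega> T \<nu>"
    and 0: "ae_eq \<Omega> (div_h T v) (\<lambda>x. 0)"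
  shows "\<exists>w\<in>Wh \<Omega> T. ae_eq \<Omega> (curl_h T w) v"
proof -
  have pw: "piecewise T v" and vk: "\<And>K. K \<in> T \<Longrightarrow> restr v K \<in> VK K"
    and bal: "balanced T (\<lambda>K. edge_flux K (restr v K))" and nod: "nodal (restr v)"
    using v by (simp_all add: Vh_iff[OF nu])
  note d = div_h_restr[OF nu v]
  have div0: "divergence (restr v K) = (\<lambda>x. 0)" if "K \<in> T" for K
    using 0 that d(1) by (simp add: piecewise_ae_eq_iff[OF d(2) piecewise_zero] restr_zero)
  have "\<exists>w\<in>WK K. restr v K = curl w" if K: "K \<in> T" for K
    using VK_divergence_free[OF convex[OF K] vk[OF K]] div0[OF K] by simp
  then obtain w where w: "\<And>K. K \<in> T \<Longrightarrow> w K \<in> WK K" "\<And>K. K \<in> T \<Longrightarrow> restr v K = curl (w K)" by metis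
  have pol: "real_polynomial_function (w K)" if "K \<in> T" for K using WK_polynomial[OF that w(1)[OF that]] .
  have fl: "edge_flux K (restr v K) i = w K (K (i+1)) - w K (K i)" if "K \<in> T" for K i
    using edge_flux_curl[OF pol[OF that]] w(2)[OF that] by simp
  have "circulation T (\<lambda>K. edge_flux K (restr v K))"
    using bal unfolding circulation_def balanced_def by (simp add: fl sum_4)
  from potential_exists[OF sc this] obtain u
    where u: "\<And>K i. K \<in> T \<Longrightarrow> u (K (i+1)) - u (K i) = edge_flux K (restr v K) i"
      and u0: "\<And>a. a \<notin> \<Omega> \<Longrightarrow> u a = (0::real)" by blast
  \<comment> \<open>The constant aligns \<open>p K\<close> with the potential \<open>u\<close> at
    one vertex. Equal differences along the edges extend the agreement to the other vertices, and
    \<open>u\<close> does not depend on the cell.\<close>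
  define p where "p K x = w K x + (u (K 1) - w K (K 1))" for K x
  have pK: "p K \<in> WK K" if "K \<in> T" for K
    unfolding p_def[abs_def] by (rule WK_add_const[OF convex[OF that] w(1)[OF that]])
  have pu: "p K (K i) = u (K i)" if "K \<in> T" for K i
  proof -
    have "u (K (i+1)) - u (K i) = w K (K (i+1)) - w K (K i)" for i using u[OF that] fl[OF that] by simp
    from this[of 1] this[of 2] this[of 3] show ?thesis
      using exhaust_4[of i] by (auto simp: p_def)
  qed
  have cp: "curl (p K) = restr v K" if "K \<in> T" for K
  proof -
    have "curl (\<lambda>x. 1 * w K x + (u (K 1) - w K (K 1)) * 1) = (\<lambda>x. 1 *\<^sub>R curl (w K) x + (u (K 1) - w K (K 1)) *\<^sub>R curl (\<lambda>x. 1) x)"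
      by (rule curl_lincomb[OF pol[OF that] real_polynomial_function.intros(2)])
    then show ?thesis by (simp add: p_def[abs_def] w(2)[OF that] curl_const)
  qed
  have polp: "polynomial_function (p K)" if "K \<in> T" for K
    using WK_polynomial[OF that pK[OF that]] by (simp add: real_polynomial_function_eq)
  let ?w = "glue T p"
  have r: "restr ?w K = p K" if "K \<in> T" for K by (rule restr_glue[of K p, OF that polp[OF that]])
  have "nodal p" unfolding nodal_def
  proof (intro conjI ballI allI impI)
    fix K K' i j assume "K \<in> T" "K' \<in> T" "K i = K' j"
    then show "p K (K i) = p K' (K' j)" using pu[of K i] pu[of K' j] by simp
  qed (use pu u0 in simp)
  moreover have "nodal (\<lambda>K. curl (p K))" using nod nodal_cong[of "\<lambda>K. curl (p K)" "restr v"] cp by simp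
  ultimately have W: "?w \<in> Wh \<Omega> T"
    using r pK piecewise_glue[of p] L2_glue[of p] polp nodal_cong[of "restr ?w" p]
      nodal_cong[of "\<lambda>K. curl (restr ?w K)" "\<lambda>K. curl (p K)"] by (simp add: Wh_iff)
  note c = curl_h_restr[OF W]
  have "ae_eq \<Omega> (curl_h T ?w) v"
    unfolding piecewise_ae_eq_iff[OF c(2) pw] using c(1) r cp by simp
  with W show ?thesis by blast
qed

lemma div_h_curl_h:
  assumes nu: "unit_normals T \<nu>" and v: "v \<in> Vh \<Omega> T \<nu>" and w: "w \<in> Wh \<Omega> T"
    and ae: "ae_eq \<Omega> (curl_h T w) v"
  shows "ae_eq \<Omega> (div_h T v) (\<lambda>x. 0)"
proof -
  note c = curl_h_restr[OF w] and d = div_h_restr[OF nu v]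
  have pw: "piecewise T v" using v by (simp add: Vh_iff[OF nu])
  have "divergence (restr v K) = (\<lambda>x. 0)" if K: "K \<in> T" for K
  proof -
    have e: "restr v K = curl (restr w K)"
      using ae K c(1)[OF K] unfolding piecewise_ae_eq_iff[OF c(2) pw] by simp
    have "real_polynomial_function (restr w K)" using w K WK_polynomial by (auto simp: Wh_iff)
    then show ?thesis unfolding e by (intro ext divergence_curl)
  qed
  then show ?thesis unfolding piecewise_ae_eq_iff[OF d(2) piecewise_zero] using d(1) by (simp add: restr_zero)
qed

text \<open>Local fields that vanish at all vertices satisfy the vertex conditions trivially, so
  only the fluxes have to be matched; on each cell they determine the constant divergence.\<close>

lemma div_h_surjective:
  assumes nu: "unit_normals T \<nu>" and q: "q \<in> Ph \<Omega> T"
  shows "\<exists>v\<in>Vh \<Omega> T \<nu>. ae_eq \<Omega> (div_h T v) q"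
proof -
  obtain c where pq: "piecewise T q" and c: "\<And>K. K \<in> T \<Longrightarrow> restr q K = (\<lambda>x. c K)"
    and sum: "(\<Sum>K\<in>T. c K * measure lebesgue (cell K)) = 0" using q unfolding Ph_iff by blast
  obtain F where F: "balanced T F" "\<And>K. K \<in> T \<Longrightarrow> (\<Sum>i\<in>UNIV. F K i) = c K * measure lebesgue (cell K)"
    using flow_exists[OF sum] by blast
  have "\<exists>v\<in>VK K. (\<forall>i. v (K i) = 0) \<and> (\<forall>i. edge_flux K v i = F K i)" if "K \<in> T" for K
    by (rule VK_flux_exists[OF convex[OF that]])
  then obtain p where p: "\<And>K. K \<in> T \<Longrightarrow> p K \<in> VK K" "\<And>K i. K \<in> T \<Longrightarrow> p K (K i) = 0"
    "\<And>K i. K \<in> T \<Longrightarrow> edge_flux K (p K) i = F K i" by metis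
  let ?v = "glue T p"
  have pol: "polynomial_function (p K)" if "K \<in> T" for K by (rule VK_polynomial[OF that p(1)[OF that]])
  have r: "restr ?v K = p K" if "K \<in> T" for K by (rule restr_glue[of K p, OF that pol[OF that]])
  have "balanced T (\<lambda>K. edge_flux K (restr ?v K))"
    using F(1) balanced_cong[of "\<lambda>K. edge_flux K (restr ?v K)" F] r p(3) by simp
  moreover have "nodal (restr ?v)" unfolding nodal_def
  proof (intro conjI ballI allI impI)
    fix K K' i j assume "K \<in> T" "K' \<in> T" "K i = K' j"
    then show "restr ?v K (K i) = restr ?v K' (K' j)" using p(2)[of K i] p(2)[of K' j] r by simp
  qed (use r p(2) in simp)
  ultimately have V: "?v \<in> Vh \<Omega> T \<nu>"
    unfolding Vh_iff[OF nu] using r p(1) piecewise_glue[of p] L2_glue[of p] pol by simp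
  note d = div_h_restr[OF nu V]
  have "divergence (p K) = (\<lambda>x. c K)" if K: "K \<in> T" for K
  proof -
    obtain e where e: "divergence (p K) = (\<lambda>x. e)"
      "(\<Sum>i\<in>UNIV. edge_flux K (p K) i) = e * measure lebesgue (cell K)"
      using VK_divergence[OF convex[OF K] p(1)[OF K]] by blast
    have "(\<Sum>i\<in>UNIV. edge_flux K (p K) i) = (\<Sum>i\<in>UNIV. F K i)"
      by (intro sum.cong refl p(3)[OF K])
    then have "e * measure lebesgue (cell K) = c K * measure lebesgue (cell K)"
      unfolding e(2) F(2)[OF K] .
    then have "e = c K" using measure_cell_pos[OF K] by (metis less_irrefl mult_right_cancel)
    then show ?thesis using e(1) by simp
  qed
  then have "ae_eq \<Omega> (div_h T ?v) q"
    unfolding piecewise_ae_eq_iff[OF d(2) pq] using d(1) r c by simp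
  with V show ?thesis by blast
qed

end

theorem theorem3p7:
  fixes \<Omega> :: "(real^2) set" and F :: "quad set set" and T :: "quad set"
    and \<nu> :: "(real^2) set \<Rightarrow> real^2"
  assumes "lipschitz_polygonal_domain \<Omega>"
    and "simply_connected \<Omega>"
    and "\<forall>T'\<in>F. quad_partition \<Omega> T'"
    and "shape_regular F"
    and "quasi_uniform F"
    and "T \<in> F"
    and "unit_normals T \<nu>"
  shows "short_exact \<Omega> (Wh \<Omega> T) (Vh \<Omega> T \<nu>) (Ph \<Omega> T) (curl_h T) (div_h T)"
proof -
  interpret quad_mesh \<Omega> T using assms by unfold_locales auto
  note nu = \<open>unit_normals T \<nu>\<close>
  have "ae_linear_map \<Omega> (Wh \<Omega> T) (Vh \<Omega> T \<nu>) (curl_h T)"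
    unfolding curl_h_def
  proof (rule ae_linear_map_cellwise[OF fun_subspace_Wh])
    fix p q :: "real^2 \<Rightarrow> real" and a b
    assume "polynomial_function p" "polynomial_function q"
    then show "curl (\<lambda>x. a *\<^sub>R p x + b *\<^sub>R q x) = (\<lambda>x. a *\<^sub>R curl p x + b *\<^sub>R curl q x)"
      using curl_lincomb[of p q a b] by (simp add: real_polynomial_function_eq)
  qed (use curl_h_Vh[OF nu] in \<open>simp_all add: Wh_iff curl_h_def polynomial_function_curl real_polynomial_function_eq\<close>)
  moreover have "ae_linear_map \<Omega> (Vh \<Omega> T \<nu>) (Ph \<Omega> T) (div_h T)"
    unfolding div_h_def
  proof (rule ae_linear_map_cellwise[OF fun_subspace_Vh[OF nu]])
    fix p q :: "real^2 \<Rightarrow> real^2" and a b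
    assume "polynomial_function p" "polynomial_function q"
    then show "divergence (\<lambda>x. a *\<^sub>R p x + b *\<^sub>R q x) = (\<lambda>x. a *\<^sub>R divergence p x + b *\<^sub>R divergence q x)"
      using divergence_lincomb[of p q a b] by simp
  next
    fix p :: "real^2 \<Rightarrow> real^2" assume "polynomial_function p"
    then show "polynomial_function (divergence p)"
      using real_polynomial_function_divergence real_polynomial_function_eq by blast
  next
    fix v assume v: "v \<in> Vh \<Omega> T \<nu>"
    then show "piecewise T v" by (simp add: Vh_iff[OF nu])
    show "cellwise T divergence v \<in> Ph \<Omega> T" using div_h_Ph[OF nu v] by (simp add: div_h_def)
  qed
  ultimately show ?thesis
    unfolding short_exact_def
    using fun_subspace_Wh fun_subspace_Vh[OF nu] fun_subspace_Ph curl_h_injective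
      kernel_div_h[OF \<open>simply_connected \<Omega>\<close> nu] div_h_curl_h[OF nu] div_h_surjective[OF nu]
    by blast
qed

end
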